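(* Let $\lambda>\lambda_c$. Then, as $T\to\infty$, the random measures $\tau^{\mathrm p}_T$ on $[0,1]$ converge in distribution (with respect to the topology of weak convergence of measures on $[0,1]$) to the random measure $\theta\big(X^{\mathrm s}(t);\lambda^{\mathrm f}(t)\big)\,\mathrm dt$ on $[0,1]$.
   Context: Two-scale mobility model. Fix $d\ge 2$, a connection threshold $r>0$ and $\lambda>0$. Let $\kappa(\mathrm dv)$ be an isotropic probability distribution on $\mathbb R^d$ with bounded support that is absolutely continuous with respect to Lebesgue measure. Let $X=\{X_i\}_{i\ge1}$ be a homogeneous Poisson point process on $\mathbb R^d$ with intensity $\lambda$ and, independently, let $\{V_{i,j}\}_{i\ge0,j\ge0}$ be i.i.d. with law $\kappa$. For a parameter $T>0$ define waypoints $P_{i,0}=X_i$, $P_{i,j+1}=P_{i,j}+T^{\,j\bmod 2}V_{i,j}$ for $i\ge 1$, rescaled arrival times $T^0_{i,0}=0$, $T^0_{i,j+1}=T^0_{i,j}+|V_{i,j}|$, and arrival times $T_{i,j}=T\,T^0_{i,j}$, for $i\ge 0$. Node $X_i$ is at $P_{i,j}$ at time $T_{i,j}$ and moves at constant speed along the straight segment from $P_{i,j}$ to $P_{i,j+1}$ during $[T_{i,j},T_{i,j+1}]$; its position at time $t$ is $X_i(t)$, and $X(t)=\{X_i(t)\}_{i\ge1}$. Percolation. For a locally finite set $\varphi\subset\mathbb R^d$, the Gilbert graph on $\varphi$ has an edge between any two points at distance at most $r$, and $\pi(\varphi)\in\{0,1\}$ is the indicator that the origin $o$ lies in an unbounded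 connected component of the Gilbert graph on $\{o\}\cup\varphi$. For $\lambda'\ge0$, $\theta(\lambda')=\mathbb E[\pi(X^{(\lambda')})]$ where $X^{(\lambda')}$ is a homogeneous Poisson point process with intensity $\lambda'$, and $\lambda_c=\inf\{\lambda'\ge0:\theta(\lambda')>0\}$. The empirical percolation time measure is $\tau^{\mathrm p}_T=\int_0^1\pi(X(tT))\,\delta_t\,\mathrm dt$. Limit objects. Let $\nu(\mathrm dt)=\mathbb E\big[\sum_{j\ge0}\delta_{T^0_{0,2j}}(\mathrm dt)\big]$ on $[0,\infty)$. Let $X^{\mathrm{bd}}=\{(X^{\mathrm{bd}}_i,\sigma_i,V_i)\}_{i\ge1}$ be a Poisson point process on $\mathbb R^d\times[0,1]\times\mathbb R^d$ with intensity measure $\lambda\,\mathrm dx\otimes\nu(\mathrm dt)\otimes\kappa(\mathrm dv)$ and, for $t\in[0,1]$, let $$X^{\mathrm s}(t)=\{X^{\mathrm{bd}}_i+(t-\sigma_i)V_i/|V_i| : \sigma_i\le t\le\sigma_i+|V_i|\}.$$ Let $I^{\mathrm f}=\bigcup_{j\ge0}[T^0_{0,2j+1},T^0_{0,2j+2}]$ and $\lambda^{\mathrm f}(t)=\lambda\,\mathbb P(t\in I^{\mathrm f})$. Finally $\theta(X^{\mathrm s}(t);\lambda^{\mathrm f}(t))=\mathbb E[\pi(X^{\mathrm s}(t)\cup X')\mid X^{\mathrm s}(t)]$, where $X'$ is a homogeneous Poisson point process with intensity $\lambda^{\mathrm f}(t)$ independent of $X^{\mathrm s}(t)$. *)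

theory Defs
  imports "HOL-Probability.Probability"
begin

section \<open>Laws on Euclidean space\<close>

definition measure_support :: "'a::topological_space measure \<Rightarrow> 'a set" where
  "measure_support \<mu> = {x. \<forall>U. open U \<longrightarrow> x \<in> U \<longrightarrow> emeasure \<mu> U > 0}"

definition isotropic :: "'a::euclidean_space measure \<Rightarrow> bool" where
  "isotropic \<mu> \<longleftrightarrow> (\<forall>f. orthogonal_transformation f \<longrightarrow> distr \<mu> borel f = \<mu>)"


section \<open>Point processes as random sets\<close>

text \<open>
  Only intensity measures without atoms occur below, so the processes are simple and a realization
  is identified with its set of points. In \<open>poisson_point_process\<close>, the explicit
  formula (with \<open>0 ^ 0 = 1\<close>) covers intensity zero, which \<^const>\<open>poisson_pmf\<close> does not.
\<close>

definition locally_finite_set :: "'b::metric_space set \<Rightarrow> bool" where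
  "locally_finite_set \<phi> \<longleftrightarrow> (\<forall>B. bounded B \<longrightarrow> finite (\<phi> \<inter> B))"

definition poisson_point_process ::
    "'w measure \<Rightarrow> 'b::euclidean_space measure \<Rightarrow> ('w \<Rightarrow> 'b set) \<Rightarrow> bool" where
  "poisson_point_process M \<mu> \<Phi> \<longleftrightarrow>
     prob_space M \<and>
     (\<forall>\<omega>\<in>space M. locally_finite_set (\<Phi> \<omega>)) \<and>
     (\<forall>B\<in>sets borel. bounded B \<longrightarrow>
        emeasure \<mu> B < \<infinity> \<and>
        (\<lambda>\<omega>. card (\<Phi> \<omega> \<inter> B)) \<in> measurable M (count_space UNIV) \<and>
        (\<forall>k. measure M {\<omega>\<in>space M. card (\<Phi> \<omega> \<inter> B) = k}
               = measure \<mu> B ^ k / fact k * exp (- measure \<mu> B))) \<and>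
     (\<forall>\<B>. finite \<B> \<longrightarrow> disjoint \<B> \<longrightarrow> (\<forall>B\<in>\<B>. B \<in> sets borel \<and> bounded B) \<longrightarrow>
        prob_space.indep_vars M (\<lambda>_. count_space UNIV) (\<lambda>B \<omega>. card (\<Phi> \<omega> \<inter> B)) \<B>)"

definition homogeneous_poisson ::
    "'w measure \<Rightarrow> real \<Rightarrow> ('w \<Rightarrow> 'a::euclidean_space set) \<Rightarrow> bool" where
  "homogeneous_poisson M lam \<Phi> \<longleftrightarrow>
     poisson_point_process M (scale_measure (ennreal lam) lborel) \<Phi>"

definition generated_algebra ::
    "'w measure \<Rightarrow> ('w \<Rightarrow> 'b::euclidean_space set) \<Rightarrow> 'w measure" where
  "generated_algebra M \<Phi> =
     sigma (space M)
       {{\<omega>\<in>space M. card (\<Phi> \<omega> \<inter> B) = k} | B k. B \<in> sets borel \<and> bounded B}"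


section \<open>Percolation\<close>

definition gilbert_edges :: "real \<Rightarrow> 'a::metric_space set \<Rightarrow> ('a \<times> 'a) set" where
  "gilbert_edges r \<phi> = {(x, y). x \<in> \<phi> \<and> y \<in> \<phi> \<and> x \<noteq> y \<and> dist x y \<le> r}"

definition gilbert_component :: "real \<Rightarrow> 'a::metric_space set \<Rightarrow> 'a \<Rightarrow> 'a set" where
  "gilbert_component r \<phi> x = {y. (x, y) \<in> (gilbert_edges r \<phi>)\<^sup>*}"

definition perc :: "real \<Rightarrow> 'a::euclidean_space set \<Rightarrow> real" where
  "perc r \<phi> = of_bool (\<not> bounded (gilbert_component r (insert 0 \<phi>) 0))"

text \<open>Here \<open>Y lam\<close> is a homogeneous Poisson point process with intensity \<open>lam\<close> on \<open>L\<close>.\<close>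

definition perc_prob ::
    "real \<Rightarrow> 'u measure \<Rightarrow> (real \<Rightarrow> 'u \<Rightarrow> 'a::euclidean_space set) \<Rightarrow> real \<Rightarrow> real" where
  "perc_prob r L Y lam = (\<integral>\<omega>. perc r (Y lam \<omega>) \<partial>L)"

definition critical_intensity ::
    "real \<Rightarrow> 'u measure \<Rightarrow> (real \<Rightarrow> 'u \<Rightarrow> 'a::euclidean_space set) \<Rightarrow> ereal" where
  "critical_intensity r L Y = Inf {ereal lam | lam. 0 \<le> lam \<and> perc_prob r L Y lam > 0}"


section \<open>The two-scale mobility model\<close>

text \<open>A single trajectory is determined by its starting point \<open>x\<close> and the sequence \<open>v\<close> of increments.\<close>

primrec waypoint :: "real \<Rightarrow> 'a::real_normed_vector \<Rightarrow> (nat \<Rightarrow> 'a) \<Rightarrow> nat \<Rightarrow> 'a" where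
  "waypoint T x v 0 = x"
| "waypoint T x v (Suc j) = waypoint T x v j + T ^ (j mod 2) *\<^sub>R v j"

primrec arrival0 :: "(nat \<Rightarrow> 'a::real_normed_vector) \<Rightarrow> nat \<Rightarrow> real" where
  "arrival0 v 0 = 0"
| "arrival0 v (Suc j) = arrival0 v j + norm (v j)"

definition arrival :: "real \<Rightarrow> (nat \<Rightarrow> 'a::real_normed_vector) \<Rightarrow> nat \<Rightarrow> real" where
  "arrival T v j = T * arrival0 v j"

text \<open>
  For \<open>t \<ge> 0\<close> the index \<open>j\<close> below satisfies \<open>arrival T v j \<le> t < arrival T v (Suc j)\<close>, provided that
  the arrival times are unbounded (almost surely the case for i.i.d. non-degenerate increments).
\<close>

definition position :: "real \<Rightarrow> 'a::real_normed_vector \<Rightarrow> (nat \<Rightarrow> 'a) \<Rightarrow> real \<Rightarrow> 'a" where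
  "position T x v t =
     (let j = (LEAST j. t < arrival T v (Suc j)) in
        waypoint T x v j
        + ((t - arrival T v j) / (arrival T v (Suc j) - arrival T v j))
            *\<^sub>R (waypoint T x v (Suc j) - waypoint T x v j))"

definition nodes ::
    "(nat \<Rightarrow> 'w \<Rightarrow> 'a::real_normed_vector) \<Rightarrow> (nat \<Rightarrow> nat \<Rightarrow> 'w \<Rightarrow> 'a) \<Rightarrow> real \<Rightarrow> real \<Rightarrow> 'w \<Rightarrow> 'a set" where
  "nodes X V T t \<omega> = (\<lambda>i. position T (X i \<omega>) (\<lambda>j. V i j \<omega>) t) ` {1..}"

definition percolation_time ::
    "real \<Rightarrow> (nat \<Rightarrow> 'w \<Rightarrow> 'a::euclidean_space) \<Rightarrow> (nat \<Rightarrow> nat \<Rightarrow> 'w \<Rightarrow> 'a) \<Rightarrow> real \<Rightarrow> 'w \<Rightarrow> real measure" where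
  "percolation_time r X V T \<omega> =
     density (restrict_space lborel {0..1}) (\<lambda>t. ennreal (perc r (nodes X V T (t * T) \<omega>)))"


section \<open>The limit objects\<close>

text \<open>In this section \<open>v j\<close> is the random increment with indices \<open>0, j\<close>.\<close>

definition slow_start_measure :: "'w measure \<Rightarrow> (nat \<Rightarrow> 'w \<Rightarrow> 'a::euclidean_space) \<Rightarrow> real measure" where
  "slow_start_measure M v =
     measure_of UNIV (sets borel)
       (\<lambda>A. \<integral>\<^sup>+\<omega>. (\<Sum>j. indicator A (arrival0 (\<lambda>k. v k \<omega>) (2 * j))) \<partial>M)"

lemma emeasure_slow_start_measure:
  assumes v: "\<And>j. v j \<in> borel_measurable M" and A: "A \<in> sets borel"
  shows "emeasure (slow_start_measure M v) A =
    (\<integral>\<^sup>+\<omega>. (\<Sum>j. indicator A (arrival0 (\<lambda>k. v k \<omega>) (2 * j))) \<partial>M)"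
proof -
  have arr [measurable]: "(\<lambda>\<omega>. arrival0 (\<lambda>k. v k \<omega>) n) \<in> borel_measurable M" for n
    by (induction n) (use v in auto)
  have ind [measurable]: "(\<lambda>\<omega>. indicator B (arrival0 (\<lambda>k. v k \<omega>) n) :: ennreal) \<in> borel_measurable M"
    if "B \<in> sets borel" for B n
    using that by measurable
  have sets: "sets (slow_start_measure M v) = sets borel"
    unfolding slow_start_measure_def using sets.sigma_sets_eq[of borel] by simp
  have swap: "(\<Sum>n. \<Sum>j. f n j) = (\<Sum>j. \<Sum>n. f n j)" for f :: "nat \<Rightarrow> nat \<Rightarrow> ennreal"
    using nn_integral_suminf[of f "count_space UNIV"] by (simp add: nn_integral_count_space_nat)
  show ?thesis
  proof (rule emeasure_measure_of[OF slow_start_measure_def])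
    show "countably_additive (sets (slow_start_measure M v))
      (\<lambda>A. \<integral>\<^sup>+\<omega>. (\<Sum>j. indicator A (arrival0 (\<lambda>k. v k \<omega>) (2 * j))) \<partial>M)"
      unfolding sets
    proof (rule countably_additiveI)
      fix B :: "nat \<Rightarrow> real set"
      assume B: "range B \<subseteq> sets borel" "disjoint_family B"
      then have B': "B n \<in> sets borel" for n by auto
      have "(\<Sum>n. \<integral>\<^sup>+\<omega>. (\<Sum>j. indicator (B n) (arrival0 (\<lambda>k. v k \<omega>) (2 * j))) \<partial>M) =
          (\<integral>\<^sup>+\<omega>. (\<Sum>n. \<Sum>j. indicator (B n) (arrival0 (\<lambda>k. v k \<omega>) (2 * j))) \<partial>M)"
        by (intro nn_integral_suminf[symmetric] borel_measurable_suminf_order ind B')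
      also have "\<dots> = (\<integral>\<^sup>+\<omega>. (\<Sum>j. \<Sum>n. indicator (B n) (arrival0 (\<lambda>k. v k \<omega>) (2 * j))) \<partial>M)"
        by (subst swap) simp
      also have "\<dots> = (\<integral>\<^sup>+\<omega>. (\<Sum>j. indicator (\<Union>n. B n) (arrival0 (\<lambda>k. v k \<omega>) (2 * j))) \<partial>M)"
        using B(2) by (simp add: suminf_indicator)
      finally show "(\<Sum>n. \<integral>\<^sup>+\<omega>. (\<Sum>j. indicator (B n) (arrival0 (\<lambda>k. v k \<omega>) (2 * j))) \<partial>M) =
          (\<integral>\<^sup>+\<omega>. (\<Sum>j. indicator (\<Union>n. B n) (arrival0 (\<lambda>k. v k \<omega>) (2 * j))) \<partial>M)" .
    qed
  qed (use A sets in \<open>auto simp: positive_def\<close>)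
qed

definition fast_times :: "(nat \<Rightarrow> 'a::real_normed_vector) \<Rightarrow> real set" where
  "fast_times v = (\<Union>j. {arrival0 v (2 * j + 1)..arrival0 v (2 * j + 2)})"

definition fast_intensity ::
    "real \<Rightarrow> 'w measure \<Rightarrow> (nat \<Rightarrow> 'w \<Rightarrow> 'a::euclidean_space) \<Rightarrow> real \<Rightarrow> real" where
  "fast_intensity lam M v t = lam * measure M {\<omega>\<in>space M. t \<in> fast_times (\<lambda>k. v k \<omega>)}"

text \<open>
  The restriction of the birth times to the unit interval is encoded by a density, so that
  this is a measure on the Borel sets of the full product space.
\<close>

definition birth_death_intensity ::
    "real \<Rightarrow> real measure \<Rightarrow> 'a::euclidean_space measure \<Rightarrow> ('a \<times> real \<times> 'a) measure" where
  "birth_death_intensity lam \<nu> \<kappa> =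
     scale_measure (ennreal lam) lborel \<Otimes>\<^sub>M (density \<nu> (indicator {0..1}) \<Otimes>\<^sub>M \<kappa>)"

definition slow_nodes ::
    "('v \<Rightarrow> ('a \<times> real \<times> 'a::euclidean_space) set) \<Rightarrow> real \<Rightarrow> 'v \<Rightarrow> 'a set" where
  "slow_nodes Xbd t \<omega> =
     {x + ((t - \<sigma>) / norm v) *\<^sub>R v | x \<sigma> v. (x, \<sigma>, v) \<in> Xbd \<omega> \<and> \<sigma> \<le> t \<and> t \<le> \<sigma> + norm v}"

text \<open>
  A conditional expectation is determined only almost surely, for each \<open>t\<close> separately. To serve as a
  density of a random measure, the versions must be chosen jointly measurably in \<open>(t, \<omega>)\<close>; any two
  such choices give almost surely the same measure.
\<close>

definition conditional_perc_version ::
    "real \<Rightarrow> 'v measure \<Rightarrow> (real \<Rightarrow> 'v \<Rightarrow> 'a::euclidean_space set) \<Rightarrow> (real \<Rightarrow> 'v \<Rightarrow> 'a set) \<Rightarrow>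
       (real \<Rightarrow> 'v \<Rightarrow> real) \<Rightarrow> bool" where
  "conditional_perc_version r N S X' \<Theta> \<longleftrightarrow>
     (\<lambda>(t, \<omega>). \<Theta> t \<omega>) \<in> borel_measurable (restrict_space borel {0..1} \<Otimes>\<^sub>M N) \<and>
     (\<forall>t\<in>{0..1}. \<forall>\<omega>\<in>space N. \<Theta> t \<omega> \<in> {0..1}) \<and>
     (\<forall>t\<in>{0..1}. AE \<omega> in N.
        \<Theta> t \<omega> = real_cond_exp N (generated_algebra N (S t)) (\<lambda>\<omega>'. perc r (S t \<omega>' \<union> X' t \<omega>')) \<omega>)"


section \<open>Convergence in distribution of random measures\<close>

definition weak_measure_topology :: "'a::topological_space set \<Rightarrow> 'a measure topology" where
  "weak_measure_topology K =
     topology_generated_by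
       {{\<mu>. sets \<mu> = sets (restrict_space borel K) \<and> finite_measure \<mu> \<and> (\<integral>x. f x \<partial>\<mu>) \<in> U} | f U.
          continuous_on K f \<and> bounded (f ` K) \<and> open (U :: real set)}"

lemma topspace_weak_measure_topology:
  "topspace (weak_measure_topology K) = {\<mu>. sets \<mu> = sets (restrict_space borel K) \<and> finite_measure \<mu>}"
  (is "_ = ?A")
proof
  show "topspace (weak_measure_topology K) \<subseteq> ?A"
    unfolding weak_measure_topology_def topology_generated_by_topspace by auto
  have "\<exists>f U. ?A = {\<mu>. sets \<mu> = sets (restrict_space borel K) \<and> finite_measure \<mu> \<and> (\<integral>x. f x \<partial>\<mu>) \<in> U} \<and>
      continuous_on K f \<and> bounded (f ` K) \<and> open (U :: real set)"
    by (intro exI[of _ "\<lambda>_. 0"] exI[of _ UNIV]) (auto simp: bounded_iff)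
  then show "?A \<subseteq> topspace (weak_measure_topology K)"
    unfolding weak_measure_topology_def topology_generated_by_topspace
    by (intro Union_upper CollectI)
qed

definition random_element :: "'w measure \<Rightarrow> 'z topology \<Rightarrow> ('w \<Rightarrow> 'z) \<Rightarrow> bool" where
  "random_element M Z X \<longleftrightarrow>
     (\<forall>\<omega>\<in>space M. X \<omega> \<in> topspace Z) \<and> (\<forall>U. openin Z U \<longrightarrow> X -` U \<inter> space M \<in> sets M)"

definition converges_in_distribution ::
    "'z topology \<Rightarrow> 'w measure \<Rightarrow> ('i \<Rightarrow> 'w \<Rightarrow> 'z) \<Rightarrow> 'i filter \<Rightarrow> 'v measure \<Rightarrow> ('v \<Rightarrow> 'z) \<Rightarrow> bool" where
  "converges_in_distribution Z M X F N Y \<longleftrightarrow>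
     (\<forall>\<^sub>F i in F. random_element M Z (X i)) \<and> random_element N Z Y \<and>
     (\<forall>f. continuous_map Z euclideanreal f \<longrightarrow> bounded (f ` topspace Z) \<longrightarrow>
        ((\<lambda>i. \<integral>\<omega>. f (X i \<omega>) \<partial>M) \<longlongrightarrow> (\<integral>\<omega>. f (Y \<omega>) \<partial>N)) F)"

end

theory Submission
  imports Defs
begin

text \<open>
  Rescaling time by \<open>T\<close>, the displacement of a node at time \<open>t T\<close> is \<open>S\<^sub>t + T F\<^sub>t\<close>, where the slow part \<open>S\<close>
  and the fast part \<open>F\<close> depend on the increments but not on \<open>T\<close>. By the marking theorem, the probability that
  the nodes avoid \<open>A\<^sub>k\<close> at the times \<open>t\<^sub>k T\<close> for all \<open>k\<close> is \<open>exp (- lam E \<bar>\<Union>\<^sub>k (A\<^sub>k - S\<^sub>t\<^sub>k - T F\<^sub>t\<^sub>k)\<bar>)\<close>. For almost all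
  times, \<open>F\<^sub>t\<^sub>k = F\<^sub>t\<^sub>l\<close> only if both times lie in the same slow leg, so as \<open>T \<rightarrow> \<infinity>\<close> the union
  splits into the contributions of distinct slow legs and of single fast positions. This is the void
  probability of the slow nodes together with independent Poisson processes of the fast intensities.

  Percolation is bounded from above by a finite-range discretization, a linear combination of finitely many void
  indicators. Its error at one time is an expected value that only involves the one-time law of the nodes;
  that law is Poisson with intensity \<open>lam\<close> for every \<open>T\<close> and in the limit, so the error is uniform in \<open>T\<close>. Hence
  \<open>E \<Prod>\<^sub>k \<pi>(X(t\<^sub>k T))\<close> converges to \<open>E \<Prod>\<^sub>k \<theta>(X\<^sup>s(t\<^sub>k); \<lambda>\<^sup>f(t\<^sub>k))\<close> for almost all \<open>t\<close>, which gives the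
  mixed moments of the distribution functions of the random measures. These functions lie in a compact set of
  Lipschitz functions, and Stone-Weierstrass concludes.
\<close>

text \<open>Percolation is neither local nor continuous, so convergence of void probabilities does
  not pass to it directly. The obstacle is overcome by making the discretization one-sided: since
  \<open>coarse_perc\<close> dominates \<open>perc\<close>, the error is nonnegative, and its mean
  is a difference of two expectations at a single time. Those are the same for every
  \<open>T\<close>, because a single translated set has the volume of the set itself. The starting
  points are governed by Lebesgue measure, so the effect of the fast legs is purely geometric:
  distinct fast displacements pull translates of bounded sets apart linearly in \<open>T\<close>,
  and for a generic path the union is disjoint across groups from some \<open>T\<close> on. Expected
  volumes sit in the exponent of the void probability, so additivity of volumes turns into
  independence. In particular distinct fast times decouple, which is why the limit of the product
  moments is a product of conditional probabilities given the slow nodes under one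
  expectation.\<close>

section \<open>Discretized percolation\<close>

text \<open>Moebius inversion on the lattice of subsets. When \<open>x\<close> is added to
  \<open>F\<close>, the sets containing \<open>x\<close> receive the coefficients of the difference
  \<open>G (insert x U) - G U\<close>, the others keep those of \<open>G\<close>. It later turns a
  function of the empty lattice sites into a combination of void indicators.\<close>

lemma subset_sum_representation:
  fixes G :: "'b set \<Rightarrow> real"
  assumes "finite F"
  shows "\<exists>c. \<forall>U\<subseteq>F. G U = (\<Sum>K\<in>Pow U. c K)"
  using assms
proof (induction F arbitrary: G)
  case empty
  show ?case by (intro exI[of _ G]) auto
next
  case (insert x F)
  obtain c0 where c0: "\<And>U. U \<subseteq> F \<Longrightarrow> G U = (\<Sum>K\<in>Pow U. c0 K)"
    using insert.IH[of G] by auto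
  obtain c1 where c1: "\<And>U. U \<subseteq> F \<Longrightarrow> G (insert x U) - G U = (\<Sum>K\<in>Pow U. c1 K)"
    using insert.IH[of "\<lambda>U. G (insert x U) - G U"] by auto
  define c where "c K = (if x \<in> K then c1 (K - {x}) else c0 K)" for K
  have F: "(\<Sum>K\<in>Pow U. c K) = G U" if "U \<subseteq> F" for U
  proof -
    have "(\<Sum>K\<in>Pow U. c K) = (\<Sum>K\<in>Pow U. c0 K)"
      by (intro sum.cong refl) (use that insert.hyps in \<open>auto simp: c_def\<close>)
    then show ?thesis using c0[OF that] by simp
  qed
  have "G U = (\<Sum>K\<in>Pow U. c K)" if "U \<subseteq> insert x F" for U
  proof (cases "x \<in> U")
    case True
    define U' where "U' = U - {x}"
    have U': "U' \<subseteq> F" "x \<notin> U'" "U = insert x U'" "finite U'"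
      using that True insert.hyps finite_subset[of U' F] by (auto simp: U'_def)
    have "(\<Sum>K\<in>Pow U. c K) = (\<Sum>K\<in>Pow U'. c K) + (\<Sum>K\<in>insert x ` Pow U'. c K)"
      unfolding U'(3) Pow_insert by (rule sum.union_disjoint) (use U' in auto)
    also have "(\<Sum>K\<in>insert x ` Pow U'. c K) = (\<Sum>K\<in>Pow U'. c (insert x K))"
      by (rule sum.reindex_cong[of "insert x"]) (use U' in \<open>auto simp: inj_on_def\<close>)
    also have "\<dots> = (\<Sum>K\<in>Pow U'. c1 K)"
    proof (intro sum.cong refl)
      fix K assume "K \<in> Pow U'"
      then have "insert x K - {x} = K" using U'(2) by auto
      then show "c (insert x K) = c1 K" by (simp add: c_def)
    qed
    also have "\<dots> = G U - G U'" using c1[OF U'(1)] U'(3) by simp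
    finally show ?thesis using F[OF U'(1)] by simp
  next
    case False
    then have "U \<subseteq> F" using that by auto
    then show ?thesis using F by simp
  qed
  then show ?case by blast
qed

text \<open>Rounding to a grid of mesh \<open>1 / Suc m\<close> that contains the origin, so that
  the distinguished vertex 0 of the Gilbert graph is unmoved.\<close>

definition lattice_round :: "nat \<Rightarrow> 'a::euclidean_space \<Rightarrow> 'a" where
  "lattice_round m x = (\<Sum>b\<in>Basis. (of_int \<lfloor>real (Suc m) * (x \<bullet> b)\<rfloor> / real (Suc m)) *\<^sub>R b)"

lemma lattice_round_0 [simp]: "lattice_round m 0 = 0"
  by (simp add: lattice_round_def)

lemma lattice_round_inner: "b \<in> Basis \<Longrightarrow> lattice_round m x \<bullet> b = of_int \<lfloor>real (Suc m) * (x \<bullet> b)\<rfloor> / real (Suc m)"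
  by (simp add: lattice_round_def)

lemma lattice_round_error: "dist (lattice_round m x) (x :: 'a::euclidean_space) \<le> DIM('a) / Suc m"
proof -
  have "\<bar>(lattice_round m x - x) \<bullet> b\<bar> \<le> 1 / Suc m" if "b \<in> Basis" for b
  proof -
    have "\<bar>of_int \<lfloor>real (Suc m) * (x \<bullet> b)\<rfloor> - real (Suc m) * (x \<bullet> b)\<bar> \<le> 1" by linarith
    then have "\<bar>of_int \<lfloor>real (Suc m) * (x \<bullet> b)\<rfloor> - real (Suc m) * (x \<bullet> b)\<bar> / real (Suc m) \<le> 1 / real (Suc m)"
      by (intro divide_right_mono) auto
    also have "\<bar>of_int \<lfloor>real (Suc m) * (x \<bullet> b)\<rfloor> - real (Suc m) * (x \<bullet> b)\<bar> / real (Suc m) =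
      \<bar>(of_int \<lfloor>real (Suc m) * (x \<bullet> b)\<rfloor> - real (Suc m) * (x \<bullet> b)) / real (Suc m)\<bar>"
      by (simp add: abs_divide)
    also have "\<dots> = \<bar>(lattice_round m x - x) \<bullet> b\<bar>"
      by (simp add: inner_diff_left lattice_round_inner[OF that] diff_divide_distrib del: of_nat_Suc)
    finally show ?thesis .
  qed
  then have "(\<Sum>b\<in>Basis. \<bar>(lattice_round m x - x) \<bullet> b\<bar>) \<le> of_nat DIM('a) * (1 / Suc m)"
    by (intro sum_bounded_above) auto
  then show ?thesis
    using norm_le_l1[of "lattice_round m x - x"] by (simp add: dist_norm)
qed

lemma lattice_round_measurable [measurable]: "lattice_round m \<in> borel_measurable borel"
  unfolding lattice_round_def by measurable

lemma finite_lattice_ball: "finite (range (lattice_round m) \<inter> cball (0::'a::euclidean_space) R)"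
proof -
  define k where "k = \<lceil>\<bar>R\<bar> * real (Suc m)\<rceil>"
  let ?g = "\<lambda>f. \<Sum>b\<in>Basis. (of_int (f b) / real (Suc m)) *\<^sub>R (b::'a)"
  have "range (lattice_round m) \<inter> cball (0::'a) R \<subseteq> ?g ` (PiE Basis (\<lambda>_. {-k..k}))"
  proof
    fix y :: 'a assume y: "y \<in> range (lattice_round m) \<inter> cball 0 R"
    then obtain x where x: "y = lattice_round m x" and n: "norm y \<le> R" by auto
    define f where "f = (\<lambda>b\<in>Basis. \<lfloor>real (Suc m) * (x \<bullet> b)\<rfloor>)"
    have "?g f = y"
      unfolding x lattice_round_def f_def by (intro sum.cong) auto
    moreover have "f b \<in> {-k..k}" if b: "b \<in> Basis" for b
    proof -
      have "\<bar>y \<bullet> b\<bar> \<le> \<bar>R\<bar>" using Basis_le_norm[OF b, of y] n by linarith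
      then have "\<bar>real_of_int (f b)\<bar> / real (Suc m) \<le> \<bar>R\<bar>"
        using b by (simp add: x lattice_round_inner f_def abs_divide del: of_nat_Suc)
      then have "\<bar>real_of_int (f b)\<bar> \<le> \<bar>R\<bar> * real (Suc m)" by (simp add: field_simps)
      then have "\<bar>real_of_int (f b)\<bar> \<le> real_of_int k" unfolding k_def by linarith
      then show ?thesis by auto
    qed
    ultimately show "y \<in> ?g ` (PiE Basis (\<lambda>_. {-k..k}))"
      by (intro image_eqI[of _ _ f]) (auto simp: f_def)
  qed
  then show ?thesis by (rule finite_subset) (intro finite_imageI finite_PiE; simp)
qed

text \<open>
  Enlarging the connection radius by twice the rounding error turns this finite-range functional into an
  upper bound of \<^const>\<open>perc\<close>.
\<close>

definition coarse_perc :: "real \<Rightarrow> nat \<Rightarrow> 'a::euclidean_space set \<Rightarrow> real" where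
  "coarse_perc r m \<phi> = (let s = r + 2 * (DIM('a) / Suc m) in
     of_bool (\<exists>y\<in>gilbert_component s (insert 0 (lattice_round m ` \<phi> \<inter> cball 0 (m + s))) 0. m \<le> norm y))"

lemma coarse_perc_range: "coarse_perc r m \<phi> \<in> {0..1}"
  by (auto simp: coarse_perc_def Let_def)

lemma gilbert_component_start: "x \<in> gilbert_component r \<phi> x"
  by (simp add: gilbert_component_def)

lemma gilbert_component_step:
  assumes "y \<in> gilbert_component r \<phi> x" "y \<in> \<phi>" "z \<in> \<phi>" "dist y z \<le> r"
  shows "z \<in> gilbert_component r \<phi> x"
proof (cases "y = z")
  case False
  then have "(y, z) \<in> gilbert_edges r \<phi>" using assms by (auto simp: gilbert_edges_def)
  then show ?thesis using assms(1) by (auto simp: gilbert_component_def intro: rtrancl_into_rtrancl)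
qed (use assms in simp)

lemma gilbert_component_induct [consumes 1, case_names start step]:
  assumes "y \<in> gilbert_component r \<phi> x" and "P x"
    and "\<And>y z. y \<in> gilbert_component r \<phi> x \<Longrightarrow> P y \<Longrightarrow> y \<in> \<phi> \<Longrightarrow> z \<in> \<phi> \<Longrightarrow> dist y z \<le> r \<Longrightarrow> P z"
  shows "P y"
proof -
  have "(x, y) \<in> (gilbert_edges r \<phi>)\<^sup>*" using assms(1) by (simp add: gilbert_component_def)
  then show ?thesis
    by induction (use assms(2,3) in \<open>auto simp: gilbert_component_def gilbert_edges_def\<close>)
qed

lemma gilbert_component_subset: "x \<in> \<phi> \<Longrightarrow> gilbert_component r \<phi> x \<subseteq> \<phi>"
  by (auto elim: gilbert_component_induct)

text \<open>Rounding a path of the Gilbert graph changes each step by at most two rounding errors,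
  so the rounded path uses edges of length at most \<open>s\<close>. The truncation to the ball of
  radius \<open>m + s\<close> does no harm: until the rounded path reaches norm \<open>m\<close>,
  its next point still lies in that ball.\<close>

lemma perc_le_coarse_perc:
  assumes r: "r > 0"
  shows "perc r (\<phi> :: 'a::euclidean_space set) \<le> coarse_perc r m \<phi>"
proof (cases "bounded (gilbert_component r (insert 0 \<phi>) 0)")
  case True
  then show ?thesis using coarse_perc_range[of r m \<phi>] by (simp add: perc_def)
next
  case False
  define \<delta> where "\<delta> = DIM('a) / Suc m"
  define s where "s = r + 2 * \<delta>"
  let ?\<psi> = "insert 0 (lattice_round m ` \<phi> \<inter> cball 0 (m + s))"
  let ?C = "gilbert_component s ?\<psi> 0"
  have err: "dist (lattice_round m x) x \<le> \<delta>" for x :: 'a unfolding \<delta>_def by (rule lattice_round_error)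
  \<comment> \<open>The second alternative records that the rounded path has already reached norm
    \<open>m\<close>; after that its continuation is irrelevant.\<close>
  have claim: "lattice_round m y \<in> ?C \<or> (\<exists>z\<in>?C. m \<le> norm z)"
    if "y \<in> gilbert_component r (insert 0 \<phi>) 0" for y
    using that
  proof (induction rule: gilbert_component_induct)
    case start
    show ?case by (simp add: gilbert_component_start)
  next
    case (step y z)
    show ?case
    proof (cases "lattice_round m y \<in> ?C \<and> norm (lattice_round m y) < m")
      case True
      have d: "dist (lattice_round m y) (lattice_round m z) \<le> s"
        using err[of y] err[of z] step.hyps(4) dist_triangle[of "lattice_round m y" "lattice_round m z" y]
          dist_triangle[of y "lattice_round m z" z] unfolding s_def by (simp add: dist_commute)
      then have "norm (lattice_round m z) \<le> m + s"
        using True norm_triangle_ineq2[of "lattice_round m z" "lattice_round m y"]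
        by (simp add: dist_norm norm_minus_commute)
      then have "lattice_round m z \<in> ?\<psi>" using step.hyps(3) by auto
      moreover have "lattice_round m y \<in> ?\<psi>" using True gilbert_component_subset[of 0 ?\<psi> s] by blast
      ultimately show ?thesis using gilbert_component_step[OF _ _ _ d] True by blast
    next
      case False
      then show ?thesis using step.IH by force
    qed
  qed
  \<comment> \<open>The extra \<open>\<delta>\<close> pays for the rounding of
    \<open>y\<close>.\<close>
  obtain y where y: "y \<in> gilbert_component r (insert 0 \<phi>) 0" "norm y > m + \<delta>"
    using False by (auto simp: bounded_iff not_le)
  have "norm (lattice_round m y) \<ge> m"
    using err[of y] y(2) norm_triangle_ineq2[of y "lattice_round m y"] by (simp add: dist_norm norm_minus_commute)
  then have "\<exists>z\<in>?C. m \<le> norm z" using claim[OF y(1)] by blast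
  then have "coarse_perc r m \<phi> = 1"
    by (simp add: coarse_perc_def Let_def s_def \<delta>_def)
  then show ?thesis by (simp add: perc_def)
qed

text \<open>If 0 percolates, both sides are 1 by the upper bound. Otherwise the component is finite,
  and local finiteness leaves a gap: no further vertex lies within \<open>r + \<eta>\<close> of it.
  A rounding error below \<open>\<eta> / 4\<close> cannot bridge this gap, so the coarse component
  is the rounded image of the true one and stays below norm \<open>m\<close>.\<close>

lemma coarse_perc_tendsto:
  fixes \<phi> :: "'a::euclidean_space set"
  assumes r: "r > 0" and lf: "locally_finite_set \<phi>"
  shows "(\<lambda>m. coarse_perc r m \<phi>) \<longlonglongrightarrow> perc r \<phi>"
proof (cases "bounded (gilbert_component r (insert 0 \<phi>) 0)")
  case False
  then have p: "perc r \<phi> = 1" by (simp add: perc_def)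
  have "coarse_perc r m \<phi> = 1" for m
    using perc_le_coarse_perc[OF r, of \<phi> m] coarse_perc_range[of r m \<phi>] p by simp
  then show ?thesis using p by simp
next
  case True
  let ?C = "gilbert_component r (insert 0 \<phi>) 0"
  obtain R where R: "R \<ge> 0" "\<And>y. y \<in> ?C \<Longrightarrow> norm y \<le> R"
    using True unfolding bounded_pos by (metis less_imp_le)
  have Csub: "?C \<subseteq> insert 0 \<phi>" by (rule gilbert_component_subset) simp
  have fin: "finite (insert 0 \<phi> \<inter> cball 0 S)" for S
    using lf by (simp add: locally_finite_set_def Int_insert_left)
  \<comment> \<open>These are the only vertices outside the component that can lie within
    \<open>r + 1\<close> of it. The element 1 inserted below caps \<open>\<eta>\<close> at 1, so
    that examining them suffices, and keeps the minimum defined if \<open>D\<close> is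
    empty.\<close>
  define D where "D = insert 0 \<phi> \<inter> cball 0 (R + r + 1) - ?C"
  have finC: "finite ?C" by (rule finite_subset[OF _ fin[of R]]) (use R Csub in auto)
  have finD: "finite D" unfolding D_def using fin by blast
  define \<eta> where "\<eta> = Min (insert 1 ((\<lambda>(x, y). dist x y - r) ` (?C \<times> D)))"
  have fp: "finite (insert 1 ((\<lambda>(x, y). dist x y - r) ` (?C \<times> D)))" using finC finD by auto
  have "\<eta> > 0" unfolding \<eta>_def
    using gilbert_component_step[of _ r "insert 0 \<phi>" 0] Csub
    by (subst Min_gr_iff[OF fp]) (auto simp: D_def not_le[symmetric])
  have gap: "y \<in> ?C" if "x \<in> ?C" "y \<in> insert 0 \<phi>" "dist x y < r + \<eta>" for x y
  proof (rule ccontr)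
    assume ny: "y \<notin> ?C"
    have "\<eta> \<le> 1" unfolding \<eta>_def using fp by (intro Min_le) auto
    then have "norm y \<le> R + r + 1"
      using that R(2)[OF that(1)] norm_triangle_ineq2[of y x] by (simp add: dist_norm norm_minus_commute)
    then have "y \<in> D" using ny that by (simp add: D_def)
    then have "\<eta> \<le> dist x y - r" unfolding \<eta>_def using fp that(1) by (intro Min_le) auto
    then show False using that by simp
  qed
  define \<delta> where "\<delta> m = DIM('a) / Suc m" for m
  have \<delta>0: "\<delta> \<longlonglongrightarrow> 0" unfolding \<delta>_def by real_asymp
  \<comment> \<open>The enlarged radius contributes \<open>2 * \<delta> m\<close> and undoing the
    rounding of both endpoints another \<open>2 * \<delta> m\<close>; hence the factor 4.\<close>
  have e1: "\<forall>\<^sub>F m in sequentially. \<delta> m < min (\<eta> / 4) 1"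
    by (rule order_tendstoD(2)[OF \<delta>0]) (use \<open>\<eta> > 0\<close> in simp)
  have e2: "\<forall>\<^sub>F m in sequentially. real m > R + 1"
    by real_asymp
  have "\<forall>\<^sub>F m in sequentially. coarse_perc r m \<phi> = 0"
    using e1 e2
  proof eventually_elim
    case (elim m)
    define s where "s = r + 2 * \<delta> m"
    let ?\<psi> = "insert 0 (lattice_round m ` \<phi> \<inter> cball 0 (m + s))"
    have err: "dist (lattice_round m x) x \<le> \<delta> m" for x :: 'a unfolding \<delta>_def by (rule lattice_round_error)
    have "y \<in> lattice_round m ` ?C" if "y \<in> gilbert_component s ?\<psi> 0" for y
      using that
    proof (induction rule: gilbert_component_induct)
      case start
      show ?case using gilbert_component_start[of 0 r "insert 0 \<phi>"] by (intro image_eqI[of _ _ 0]) auto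
    next
      case (step y z)
      obtain x where x: "x \<in> ?C" "y = lattice_round m x" using step.IH by blast
      obtain w where w: "w \<in> insert 0 \<phi>" "z = lattice_round m w"
        using step.hyps(3) by (metis IntE imageE insert_iff lattice_round_0)
      have "dist x w \<le> dist x y + dist y z + dist z w"
        using dist_triangle[of x w y] dist_triangle[of y w z] by linarith
      also have "\<dots> \<le> \<delta> m + s + \<delta> m"
        using err[of x] err[of w] x w step.hyps(4) by (simp add: dist_commute)
      also have "\<dots> < r + \<eta>" using elim by (simp add: s_def)
      finally show ?case using gap[OF x(1) w(1)] w(2) by blast
    qed
    then have img: "gilbert_component s ?\<psi> 0 \<subseteq> lattice_round m ` ?C" by blast
    have "norm y < m" if "y \<in> gilbert_component s ?\<psi> 0" for y
    proof -
      obtain x where x: "x \<in> ?C" "y = lattice_round m x" using img \<open>y \<in> gilbert_component s ?\<psi> 0\<close> by blast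
      then show ?thesis
        using err[of x] R(2)[OF x(1)] elim norm_triangle_ineq2[of y x] by (simp add: dist_norm)
    qed
    then have "\<not> (\<exists>y\<in>gilbert_component s ?\<psi> 0. m \<le> norm y)" by (meson not_le)
    moreover have "coarse_perc r m \<phi> = of_bool (\<exists>y\<in>gilbert_component s ?\<psi> 0. m \<le> norm y)"
      by (simp only: coarse_perc_def Let_def s_def \<delta>_def)
    ultimately show ?case by simp
  qed
  then show ?thesis
    using True by (simp add: perc_def tendsto_eventually)
qed

text \<open>The coarse functional depends on the points only through the set \<open>U\<close> of
  empty sites among finitely many lattice sites. Moebius inversion in \<open>U\<close> applies, and
  \<open>K \<subseteq> U\<close> says exactly that the union \<open>cell K\<close> of the cells of
  \<open>K\<close> is void.\<close>

lemma coarse_perc_void_expansion: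
  obtains \<B> :: "'a::euclidean_space set set" and c where "finite \<B>"
    "\<And>B. B \<in> \<B> \<Longrightarrow> B \<in> sets borel" "\<And>B. B \<in> \<B> \<Longrightarrow> bounded B"
    "\<And>\<phi>. coarse_perc r m \<phi> = (\<Sum>B\<in>\<B>. c B * of_bool (\<phi> \<inter> B = {}))"
proof -
  let ?q = "lattice_round m :: 'a \<Rightarrow> 'a"
  define s where "s = r + 2 * (DIM('a) / Suc m)"
  define S where "S = range ?q \<inter> cball 0 (m + s)"
  have finS: "finite S" unfolding S_def by (rule finite_lattice_ball)
  define G :: "'a set \<Rightarrow> real" where
    "G U = of_bool (\<exists>y\<in>gilbert_component s (insert 0 (S - U)) 0. m \<le> norm y)" for U
  obtain c where c: "\<And>U. U \<subseteq> S \<Longrightarrow> G U = (\<Sum>K\<in>Pow U. c K)"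
    using subset_sum_representation[OF finS, of G] by auto
  define cell where "cell K = ?q -` K" for K
  \<comment> \<open>Every site is its own rounding, so \<open>K\<close> can be recovered from
    \<open>cell K\<close>. This permits indexing the sum by the void sets themselves.\<close>
  have inj: "inj_on cell (Pow S)"
  proof (rule inj_onI)
    fix K K' assume "K \<in> Pow S" "K' \<in> Pow S" "cell K = cell K'"
    have "?q ` cell K = K" if "K \<in> Pow S" for K
      using that by (auto simp: cell_def S_def image_iff)
    then have "?q ` cell K = K" "?q ` cell K' = K'" using \<open>K \<in> Pow S\<close> \<open>K' \<in> Pow S\<close> by blast+
    then show "K = K'" using \<open>cell K = cell K'\<close> by metis
  qed
  show thesis
  proof (rule that[of "cell ` Pow S" "\<lambda>B. c (?q ` B)"])
    show "finite (cell ` Pow S)" using finS by simp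
    fix B assume "B \<in> cell ` Pow S"
    then obtain K where K: "K \<subseteq> S" "B = cell K" by auto
    have "finite K" using K finS finite_subset by blast
    then have "K \<in> sets borel" by (intro borel_closed finite_imp_closed)
    then show "B \<in> sets borel"
      unfolding K cell_def using measurable_sets[OF lattice_round_measurable, of K m] by simp
    have "norm x \<le> m + s + DIM('a) / Suc m" if "x \<in> B" for x
    proof -
      have "norm (?q x) \<le> m + s" using that K by (auto simp: cell_def S_def)
      then show ?thesis
        using lattice_round_error[of m x] norm_triangle_ineq2[of x "?q x"] by (simp add: dist_norm norm_minus_commute)
    qed
    then show "bounded B" by (auto simp: bounded_iff)
  next
    fix \<phi> :: "'a set"
    let ?U = "S - ?q ` \<phi>"
    have "S - ?U = ?q ` \<phi> \<inter> cball 0 (m + s)" by (auto simp: S_def)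
    then have "coarse_perc r m \<phi> = G ?U"
      by (simp add: coarse_perc_def Let_def G_def s_def)
    also have "\<dots> = (\<Sum>K\<in>Pow ?U. c K)" by (rule c) auto
    also have "\<dots> = (\<Sum>K\<in>Pow S. c K * of_bool (\<phi> \<inter> cell K = {}))"
      by (rule sum.mono_neutral_cong_left) (use finS in \<open>auto simp: cell_def\<close>)
    also have "\<dots> = (\<Sum>K\<in>Pow S. c (?q ` cell K) * of_bool (\<phi> \<inter> cell K = {}))"
    proof (intro sum.cong refl)
      fix K assume "K \<in> Pow S"
      then have "?q ` cell K = K" by (auto simp: cell_def S_def)
      then show "c K * of_bool (\<phi> \<inter> cell K = {}) = c (?q ` cell K) * of_bool (\<phi> \<inter> cell K = {})" by simp
    qed
    also have "\<dots> = (\<Sum>B\<in>cell ` Pow S. c (?q ` B) * of_bool (\<phi> \<inter> B = {}))"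
      by (subst sum.reindex[OF inj]) simp
    finally show "coarse_perc r m \<phi> = (\<Sum>B\<in>cell ` Pow S. c (?q ` B) * of_bool (\<phi> \<inter> B = {}))" .
  qed
qed

section \<open>Measurability of percolation\<close>

text \<open>Reachability from the origin by \<open>k\<close> further steps after the first, phrased
  with indices of points instead of points. With countably many indices it is built from countable
  operations on measurable events; \<open>D\<close> marks the indices that are present.\<close>

primrec gilbert_hop :: "real \<Rightarrow> ('i \<Rightarrow> bool) \<Rightarrow> ('i \<Rightarrow> 'a::real_normed_vector) \<Rightarrow> nat \<Rightarrow> 'i \<Rightarrow> bool" where
  "gilbert_hop r D Z 0 i \<longleftrightarrow> D i \<and> norm (Z i) \<le> r"
| "gilbert_hop r D Z (Suc k) i \<longleftrightarrow> D i \<and> (\<exists>j. gilbert_hop r D Z k j \<and> dist (Z j) (Z i) \<le> r)"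

text \<open>A path that returns to the origin can be restarted there, so only chains with all later
  vertices among the indexed points need to be counted. Steps between equal points are
  harmless.\<close>

lemma gilbert_component_hop:
  "gilbert_component r (insert 0 {Z i | i. D i}) 0 = insert 0 {Z i | i. \<exists>k. gilbert_hop r D Z k i}"
proof (intro equalityI subsetI)
  fix y assume "y \<in> gilbert_component r (insert 0 {Z i | i. D i}) 0"
  then show "y \<in> insert 0 {Z i | i. \<exists>k. gilbert_hop r D Z k i}"
  proof (induction rule: gilbert_component_induct)
    case (step y z)
    show ?case
    proof (cases "z = 0")
      case False
      then obtain i where i: "z = Z i" "D i" using step.hyps by blast
      consider "y = 0" | j k where "y = Z j" "gilbert_hop r D Z k j" using step.IH by blast
      then have "\<exists>k. gilbert_hop r D Z k i"
      proof cases
        case 1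
        then have "gilbert_hop r D Z 0 i" using i step.hyps(4) by simp
        then show ?thesis by blast
      next
        case (2 j k)
        then have "gilbert_hop r D Z (Suc k) i" using i step.hyps(4) by auto
        then show ?thesis by blast
      qed
      then show ?thesis using i by blast
    qed simp
  qed simp
next
  let ?\<phi> = "insert 0 {Z i | i. D i}"
  have D: "D i" if "gilbert_hop r D Z k i" for k i using that by (cases k) auto
  have "Z i \<in> gilbert_component r ?\<phi> 0" if "gilbert_hop r D Z k i" for k i
    using that
  proof (induction k arbitrary: i)
    case 0
    then have "Z i \<in> ?\<phi>" "dist 0 (Z i) \<le> r" by auto
    then show ?case by (intro gilbert_component_step[OF gilbert_component_start _ \<open>Z i \<in> ?\<phi>\<close> \<open>dist 0 (Z i) \<le> r\<close>]) simp
  next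
    case (Suc k)
    from Suc.prems obtain j where j: "gilbert_hop r D Z k j" "dist (Z j) (Z i) \<le> r" and "D i" by auto
    have "Z j \<in> ?\<phi>" using D[OF j(1)] by blast
    moreover have "Z i \<in> ?\<phi>" using \<open>D i\<close> by blast
    ultimately show ?case by (rule gilbert_component_step[OF Suc.IH[OF j(1)] _ _ j(2)])
  qed
  then show "y \<in> gilbert_component r ?\<phi> 0" if "y \<in> insert 0 {Z i | i. \<exists>k. gilbert_hop r D Z k i}" for y
    using that gilbert_component_start[of 0] by auto
qed

text \<open>Unboundedness is tested along integer radii, which leaves countable quantifiers over
  hops and indices.\<close>

lemma perc_measurable:
  fixes Z :: "'i::countable \<Rightarrow> 'w \<Rightarrow> 'a::euclidean_space"
  assumes Z [measurable]: "\<And>i. Z i \<in> borel_measurable M" and D [measurable]: "\<And>i. Measurable.pred M (D i)"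
  shows "(\<lambda>\<omega>. perc r {Z i \<omega> | i. D i \<omega>}) \<in> borel_measurable M"
proof -
  have hop [measurable]: "Measurable.pred M (\<lambda>\<omega>. gilbert_hop r (\<lambda>i. D i \<omega>) (\<lambda>i. Z i \<omega>) k i)" for k i
    by (induction k arbitrary: i) simp_all
  have "perc r {Z i \<omega> | i. D i \<omega>} =
      of_bool (\<forall>n::nat. \<exists>i k. gilbert_hop r (\<lambda>i. D i \<omega>) (\<lambda>i. Z i \<omega>) k i \<and> real n < norm (Z i \<omega>))" for \<omega>
  proof -
    have "\<not> bounded (gilbert_component r (insert 0 {Z i \<omega> | i. D i \<omega>}) 0) \<longleftrightarrow>
        (\<forall>b. \<exists>i k. gilbert_hop r (\<lambda>i. D i \<omega>) (\<lambda>i. Z i \<omega>) k i \<and> b < norm (Z i \<omega>))"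
    proof -
      have "bounded {Z i \<omega> | i. Q i} \<longleftrightarrow> (\<exists>b. \<forall>i. Q i \<longrightarrow> norm (Z i \<omega>) \<le> b)" for Q
        unfolding bounded_iff by blast
      from this[of "\<lambda>i. \<exists>k. gilbert_hop r (\<lambda>i. D i \<omega>) (\<lambda>i. Z i \<omega>) k i"] show ?thesis
        unfolding gilbert_component_hop[of r "\<lambda>i. Z i \<omega>" "\<lambda>i. D i \<omega>"] bounded_insert not_le[symmetric]
        by blast
    qed
    also have "\<dots> \<longleftrightarrow> (\<forall>n::nat. \<exists>i k. gilbert_hop r (\<lambda>i. D i \<omega>) (\<lambda>i. Z i \<omega>) k i \<and> real n < norm (Z i \<omega>))"
    proof (intro iffI allI)
      fix b :: real
      obtain n :: nat where "b < n" using reals_Archimedean2 by blast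
      assume "\<forall>n::nat. \<exists>i k. gilbert_hop r (\<lambda>i. D i \<omega>) (\<lambda>i. Z i \<omega>) k i \<and> real n < norm (Z i \<omega>)"
      then obtain i k where "gilbert_hop r (\<lambda>i. D i \<omega>) (\<lambda>i. Z i \<omega>) k i" "real n < norm (Z i \<omega>)" by blast
      then show "\<exists>i k. gilbert_hop r (\<lambda>i. D i \<omega>) (\<lambda>i. Z i \<omega>) k i \<and> b < norm (Z i \<omega>)"
        using \<open>b < n\<close> order_less_trans by blast
    qed blast
    finally show ?thesis by (simp add: perc_def)
  qed
  then show ?thesis by (simp only:) measurable
qed

section \<open>Poisson point processes\<close>

lemma poisson_point_processD:
  assumes "poisson_point_process M \<mu> \<Phi>"
  shows "prob_space M" "\<And>\<omega>. \<omega> \<in> space M \<Longrightarrow> locally_finite_set (\<Phi> \<omega>)"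
    "\<And>B. B \<in> sets borel \<Longrightarrow> bounded B \<Longrightarrow> emeasure \<mu> B < \<infinity>"
    "\<And>B. B \<in> sets borel \<Longrightarrow> bounded B \<Longrightarrow> (\<lambda>\<omega>. card (\<Phi> \<omega> \<inter> B)) \<in> measurable M (count_space UNIV)"
    "\<And>B k. B \<in> sets borel \<Longrightarrow> bounded B \<Longrightarrow> measure M {\<omega>\<in>space M. card (\<Phi> \<omega> \<inter> B) = k}
               = measure \<mu> B ^ k / fact k * exp (- measure \<mu> B)"
    "\<And>\<B>. finite \<B> \<Longrightarrow> disjoint \<B> \<Longrightarrow> (\<And>B. B \<in> \<B> \<Longrightarrow> B \<in> sets borel) \<Longrightarrow> (\<And>B. B \<in> \<B> \<Longrightarrow> bounded B) \<Longrightarrow>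
        prob_space.indep_vars M (\<lambda>_. count_space UNIV) (\<lambda>B \<omega>. card (\<Phi> \<omega> \<inter> B)) \<B>"
  using assms unfolding poisson_point_process_def by blast+

lemma locally_finite_Int: "locally_finite_set \<phi> \<Longrightarrow> bounded B \<Longrightarrow> finite (\<phi> \<inter> B)"
  by (simp add: locally_finite_set_def)

subsection \<open>Measurable enumeration of the points\<close>

lemma countable_range_lattice_round: "countable (range (lattice_round m :: 'a::euclidean_space \<Rightarrow> 'a))"
proof -
  have "range (lattice_round m) = (\<Union>n::nat. range (lattice_round m) \<inter> cball (0::'a) n)"
    using real_arch_simple by (auto simp: set_eq_iff)
  then show ?thesis
    by (metis (mono_tags, lifting) countable_UN countable_finite finite_lattice_ball countableI_type)
qed

text \<open>A pair consists of a mesh level and the number of a site in an enumeration of that grid;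
  this gives countably many bounded cells of arbitrarily small diameter.\<close>

definition lattice_cell :: "nat \<times> nat \<Rightarrow> 'a::euclidean_space set" where
  "lattice_cell p = lattice_round (fst p) -` {from_nat_into (range (lattice_round (fst p))) (snd p)}"

lemma lattice_cell_dist:
  assumes "x \<in> lattice_cell p" "y \<in> lattice_cell p"
  shows "dist x (y::'a::euclidean_space) \<le> 2 * (DIM('a) / Suc (fst p))"
  using lattice_round_error[of "fst p" x] lattice_round_error[of "fst p" y] assms
    dist_triangle[of x y "lattice_round (fst p) x"]
  by (auto simp: lattice_cell_def dist_commute)

lemma lattice_cell_borel [measurable]: "lattice_cell p \<in> sets borel"
  unfolding lattice_cell_def
  by (rule measurable_sets_borel[OF lattice_round_measurable]) simp

lemma bounded_lattice_cell: "bounded (lattice_cell p)"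
  using lattice_cell_dist unfolding bounded_two_points by blast

lemma lattice_cell_ex:
  obtains n where "x \<in> lattice_cell (m, n)"
  using from_nat_into_surj[OF countable_range_lattice_round, of "lattice_round m x" m]
  by (auto simp: lattice_cell_def dest: sym)

lemma lattice_cell_isolates:
  assumes lf: "locally_finite_set \<phi>" and x: "x \<in> \<phi>"
  obtains p where "\<phi> \<inter> lattice_cell p = {x :: 'a::euclidean_space}"
proof -
  have fin: "finite (\<phi> \<inter> cball x 1 - {x})" using lf by (auto intro: locally_finite_Int)
  \<comment> \<open>Distance to the nearest other point, capped at 1 so that only the finitely many
    points of the unit ball matter.\<close>
  define \<eta> where "\<eta> = Min (insert 1 (dist x ` (\<phi> \<inter> cball x 1 - {x})))"
  have "\<eta> > 0" unfolding \<eta>_def using fin by (subst Min_gr_iff) auto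
  then obtain m where m: "2 * (DIM('a) / Suc m) < \<eta>"
    using reals_Archimedean2[of "2 * DIM('a) / \<eta>"] by (auto simp: field_simps) (metis add.commute distrib_left less_add_same_cancel1 less_trans mult.commute)
  obtain n where n: "x \<in> lattice_cell (m, n)" by (rule lattice_cell_ex)
  have "y = x" if "y \<in> \<phi> \<inter> lattice_cell (m, n)" for y
  proof (rule ccontr)
    assume "y \<noteq> x"
    have d: "dist x y < \<eta>" using lattice_cell_dist[OF n, of y] m that by simp
    moreover have "\<eta> \<le> 1" unfolding \<eta>_def using fin by (intro Min_le) auto
    ultimately have "\<eta> \<le> dist x y"
      unfolding \<eta>_def using fin that \<open>y \<noteq> x\<close> by (intro Min_le) auto
    then show False using d by simp
  qed
  then show ?thesis using that[of "(m, n)"] n x by blast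
qed

text \<open>Only counts are known to be measurable. By local finiteness each point is alone in some
  cell, so the cells with count one list all points, possibly repeatedly. The sole point of a cell
  lies in an open \<open>S\<close> iff the count in the intersection with \<open>S\<close> is still
  one.\<close>

lemma measurable_enumeration:
  fixes \<Phi> :: "'w \<Rightarrow> 'a::euclidean_space set"
  assumes lf: "\<And>\<omega>. \<omega> \<in> space M \<Longrightarrow> locally_finite_set (\<Phi> \<omega>)"
    and card: "\<And>B. B \<in> sets borel \<Longrightarrow> bounded B \<Longrightarrow> (\<lambda>\<omega>. card (\<Phi> \<omega> \<inter> B)) \<in> measurable M (count_space UNIV)"
  obtains Z :: "nat \<times> nat \<Rightarrow> 'w \<Rightarrow> 'a" and D where "\<And>p. Z p \<in> borel_measurable M" "\<And>p. Measurable.pred M (D p)"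
    "\<And>\<omega>. \<omega> \<in> space M \<Longrightarrow> \<Phi> \<omega> = {Z p \<omega> | p. D p \<omega>}"
proof -
  define D where "D p \<omega> \<longleftrightarrow> card (\<Phi> \<omega> \<inter> lattice_cell p) = 1" for p \<omega>
  \<comment> \<open>The default 0 is never listed, since the enumeration uses only those
    \<open>p\<close> with \<open>D p \<omega>\<close>; it does enter the preimage computation
    below.\<close>
  define Z where "Z p \<omega> = (if D p \<omega> then the_elem (\<Phi> \<omega> \<inter> lattice_cell p) else 0)" for p \<omega>
  have cardm: "Measurable.pred M (\<lambda>\<omega>. card (\<Phi> \<omega> \<inter> B) = k)" if "B \<in> sets borel" "bounded B" for B k
    using card[OF that] by measurable
  have D: "Measurable.pred M (D p)" for p
    unfolding D_def by (intro cardm lattice_cell_borel bounded_lattice_cell)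
  show thesis
  proof (rule that[of Z D])
    show "Measurable.pred M (D p)" for p by (rule D)
    show "Z p \<in> borel_measurable M" for p
    proof (rule borel_measurableI)
      fix S :: "'a set" assume S: "open S"
      have "Z p \<omega> \<in> S \<longleftrightarrow> (D p \<omega> \<and> card (\<Phi> \<omega> \<inter> (lattice_cell p \<inter> S)) = 1) \<or> (\<not> D p \<omega> \<and> 0 \<in> S)" for \<omega>
      proof (cases "D p \<omega>")
        case True
        then obtain x where x: "\<Phi> \<omega> \<inter> lattice_cell p = {x}" by (auto simp: D_def card_1_singleton_iff)
        have "\<Phi> \<omega> \<inter> (lattice_cell p \<inter> S) = {x} \<inter> S" using x by blast
        then have "card (\<Phi> \<omega> \<inter> (lattice_cell p \<inter> S)) = 1 \<longleftrightarrow> x \<in> S" by (cases "x \<in> S") auto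
        then show ?thesis using True x by (simp add: Z_def)
      qed (simp add: Z_def)
      then have "Z p -` S \<inter> space M = {\<omega>\<in>space M. (D p \<omega> \<and> card (\<Phi> \<omega> \<inter> (lattice_cell p \<inter> S)) = 1) \<or> (\<not> D p \<omega> \<and> 0 \<in> S)}"
        by auto
      also have "\<dots> \<in> sets M"
      proof -
        have [measurable]: "Measurable.pred M (\<lambda>\<omega>. card (\<Phi> \<omega> \<inter> (lattice_cell p \<inter> S)) = 1)"
          using S bounded_lattice_cell by (intro cardm bounded_subset[OF bounded_lattice_cell[of p]]) auto
        note D[measurable]
        show ?thesis by measurable
      qed
      finally show "Z p -` S \<inter> space M \<in> sets M" .
    qed
    fix \<omega> assume \<omega>: "\<omega> \<in> space M"
    show "\<Phi> \<omega> = {Z p \<omega> | p. D p \<omega>}"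
    proof (intro equalityI subsetI)
      fix x assume "x \<in> \<Phi> \<omega>"
      then obtain p where "\<Phi> \<omega> \<inter> lattice_cell p = {x}" using lattice_cell_isolates[OF lf[OF \<omega>]] by blast
      then show "x \<in> {Z p \<omega> | p. D p \<omega>}" by (intro CollectI exI[of _ p]) (simp add: Z_def D_def)
    next
      fix x assume "x \<in> {Z p \<omega> | p. D p \<omega>}"
      then obtain p where p: "x = Z p \<omega>" "D p \<omega>" by blast
      then obtain y where "\<Phi> \<omega> \<inter> lattice_cell p = {y}" by (auto simp: D_def card_1_singleton_iff)
      then show "x \<in> \<Phi> \<omega>" using p by (auto simp: Z_def)
    qed
  qed
qed

subsection \<open>Void probabilities and the generating functional\<close>

text \<open>The defining properties speak of bounded sets; exhaustion by balls and continuity of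
  measures extend them. Unbounded sets occur later among births, where the velocity coordinate is
  unrestricted.\<close>

lemma poisson_void:
  fixes B :: "'b::euclidean_space set"
  assumes ppp: "poisson_point_process M \<mu> \<Phi>" and \<mu>: "sets \<mu> = sets borel" and B: "B \<in> sets borel"
  shows "{\<omega>\<in>space M. \<Phi> \<omega> \<inter> B = {}} \<in> sets M"
    and "emeasure \<mu> B < \<infinity> \<Longrightarrow> measure M {\<omega>\<in>space M. \<Phi> \<omega> \<inter> B = {}} = exp (- measure \<mu> B)"
proof -
  interpret prob_space M by (rule poisson_point_processD(1)[OF ppp])
  have eq: "{\<omega>\<in>space M. \<Phi> \<omega> \<inter> C = {}} = {\<omega>\<in>space M. card (\<Phi> \<omega> \<inter> C) = 0}" if "bounded C" for C
    using locally_finite_Int[OF poisson_point_processD(2)[OF ppp] that] by auto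
  have ms: "{\<omega>\<in>space M. \<Phi> \<omega> \<inter> C = {}} \<in> sets M" if "C \<in> sets borel" "bounded C" for C
    unfolding eq[OF that(2)] using poisson_point_processD(4)[OF ppp that] by measurable
  have pr: "prob {\<omega>\<in>space M. \<Phi> \<omega> \<inter> C = {}} = exp (- measure \<mu> C)" if "C \<in> sets borel" "bounded C" for C
    unfolding eq[OF that(2)] using poisson_point_processD(5)[OF ppp that, of 0] by simp
  define Bn where "Bn n = B \<inter> cball 0 (real n)" for n
  have Bn: "Bn n \<in> sets borel" "bounded (Bn n)" for n
    using B by (auto simp: Bn_def bounded_Int)
  have UB: "(\<Union>n. Bn n) = B"
    using real_arch_simple by (auto simp: Bn_def) blast
  have Veq: "{\<omega>\<in>space M. \<Phi> \<omega> \<inter> B = {}} = (\<Inter>n. {\<omega>\<in>space M. \<Phi> \<omega> \<inter> Bn n = {}})"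
    using UB by blast
  show "{\<omega>\<in>space M. \<Phi> \<omega> \<inter> B = {}} \<in> sets M"
    unfolding Veq by (intro sets.countable_INT) (use ms[OF Bn] in auto)
  assume fin: "emeasure \<mu> B < \<infinity>"
  have inc: "incseq Bn" by (rule incseq_SucI) (auto simp: Bn_def)
  have l1: "(\<lambda>n. prob {\<omega>\<in>space M. \<Phi> \<omega> \<inter> Bn n = {}}) \<longlonglongrightarrow> prob {\<omega>\<in>space M. \<Phi> \<omega> \<inter> B = {}}"
    unfolding Veq
  proof (rule finite_Lim_measure_decseq)
    show "decseq (\<lambda>n. {\<omega>\<in>space M. \<Phi> \<omega> \<inter> Bn n = {}})"
      using inc unfolding decseq_def incseq_def by blast
  qed (use ms[OF Bn] in auto)
  have "(\<lambda>n. measure \<mu> (Bn n)) \<longlonglongrightarrow> measure \<mu> (\<Union>n. Bn n)"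
    by (rule Lim_measure_incseq) (use Bn inc fin UB \<mu> in auto)
  then have "(\<lambda>n. exp (- measure \<mu> (Bn n))) \<longlonglongrightarrow> exp (- measure \<mu> B)"
    unfolding UB by (intro tendsto_intros)
  then show "prob {\<omega>\<in>space M. \<Phi> \<omega> \<inter> B = {}} = exp (- measure \<mu> B)"
    using l1 unfolding pr[OF Bn] by (rule LIMSEQ_unique[rotated])
qed

lemma poisson_pgf:
  assumes ppp: "poisson_point_process M \<mu> \<Phi>" and C: "C \<in> sets borel" "bounded C"
    and s: "0 \<le> s" "s \<le> (1::real)"
  shows "(\<integral>\<omega>. s ^ card (\<Phi> \<omega> \<inter> C) \<partial>M) = exp (- (measure \<mu> C * (1 - s)))"
proof -
  interpret prob_space M by (rule poisson_point_processD(1)[OF ppp])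
  define K where "K \<omega> = card (\<Phi> \<omega> \<inter> C)" for \<omega>
  have K [measurable]: "K \<in> measurable M (count_space UNIV)"
    unfolding K_def by (rule poisson_point_processD(4)[OF ppp C])
  let ?f = "\<lambda>k \<omega>. s ^ k * indicator {\<omega>\<in>space M. K \<omega> = k} \<omega>"
  have Kset [measurable]: "{\<omega>\<in>space M. K \<omega> = k} \<in> sets M" for k by measurable
  have sing: "(\<lambda>k. ?f k \<omega>) sums (s ^ K \<omega>)" if "\<omega> \<in> space M" for \<omega>
  proof -
    have "?f k \<omega> = (if k = K \<omega> then s ^ k else 0)" for k using that by (auto simp: indicator_def)
    then show ?thesis using sums_single[of "K \<omega>" "\<lambda>k. s ^ k"] by simp
  qed
  have int: "(\<integral>\<omega>. ?f k \<omega> \<partial>M) = exp (- measure \<mu> C) * ((s * measure \<mu> C) ^ k /\<^sub>R fact k)" for k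
  proof -
    have "(\<integral>\<omega>. ?f k \<omega> \<partial>M) = s ^ k * prob {\<omega>\<in>space M. K \<omega> = k}"
      by (subst integral_mult_right_zero) (simp add: Int_absorb2 del: Collect_mem_eq)
    then show ?thesis
      using poisson_point_processD(5)[OF ppp C, of k] by (simp add: K_def power_mult_distrib field_simps)
  qed
  have ex: "(\<lambda>k. exp (- measure \<mu> C) * ((s * measure \<mu> C) ^ k /\<^sub>R fact k)) sums (exp (- measure \<mu> C) * exp (s * measure \<mu> C))"
    by (intro sums_mult exp_converges)
  have nf: "norm (?f k \<omega>) = ?f k \<omega>" for k \<omega> using s by (simp add: indicator_def)
  have "(\<integral>\<omega>. (\<Sum>k. ?f k \<omega>) \<partial>M) = (\<Sum>k. \<integral>\<omega>. ?f k \<omega> \<partial>M)"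
  proof (rule integral_suminf)
    show "integrable M (?f k)" for k
      by (intro integrable_mult_right integrable_real_indicator) (auto simp: emeasure_eq_measure)
    show "AE \<omega> in M. summable (\<lambda>k. norm (?f k \<omega>))"
      unfolding nf using sing by (auto simp: sums_iff)
    show "summable (\<lambda>k. \<integral>\<omega>. norm (?f k \<omega>) \<partial>M)"
      unfolding nf int using ex by (auto simp: sums_iff)
  qed
  also have "(\<Sum>k. \<integral>\<omega>. ?f k \<omega> \<partial>M) = exp (- measure \<mu> C) * exp (s * measure \<mu> C)"
    unfolding int using ex by (simp add: sums_iff)
  also have "\<dots> = exp (- (measure \<mu> C * (1 - s)))"
    by (simp add: exp_add[symmetric] algebra_simps)
  also have "(\<integral>\<omega>. (\<Sum>k. ?f k \<omega>) \<partial>M) = (\<integral>\<omega>. s ^ K \<omega> \<partial>M)"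
    by (intro Bochner_Integration.integral_cong refl) (use sing in \<open>simp add: sums_iff\<close>)
  finally show ?thesis by (simp add: K_def)
qed

text \<open>For a function with finitely many values the product splits over its level sets, whose
  counts are independent, and each factor is a Poisson generating function. The general case follows
  by dominated convergence on both sides.\<close>

lemma poisson_generating_functional:
  fixes h :: "'b::euclidean_space \<Rightarrow> real"
  assumes ppp: "poisson_point_process M \<mu> \<Phi>" and \<mu>: "sets \<mu> = sets borel"
    and B: "B \<in> sets borel" "bounded B"
    and h [measurable]: "h \<in> borel_measurable borel" and h01: "\<And>x. 0 \<le> h x" "\<And>x. h x \<le> 1"
  shows "(\<integral>\<omega>. (\<Prod>x\<in>\<Phi> \<omega> \<inter> B. 1 - h x) \<partial>M) = exp (- (\<integral>x. indicator B x * h x \<partial>\<mu>))"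
    and "(\<lambda>\<omega>. \<Prod>x\<in>\<Phi> \<omega> \<inter> B. 1 - h x) \<in> borel_measurable M"
proof -
  interpret prob_space M by (rule poisson_point_processD(1)[OF ppp])
  note B(1)[measurable]
  note fin\<mu> = poisson_point_processD(3)[OF ppp]
  have finB: "finite (\<Phi> \<omega> \<inter> B)" if "\<omega> \<in> space M" for \<omega>
    using locally_finite_Int[OF poisson_point_processD(2)[OF ppp that] B(2)] .
  define hn where "hn n x = of_int \<lfloor>2 ^ n * h x\<rfloor> / (2::real) ^ n" for n :: nat and x
  have hn_m [measurable]: "hn n \<in> borel_measurable borel" for n unfolding hn_def by measurable
  have hn01: "0 \<le> hn n x" "hn n x \<le> h x" for n x
    using h01(1)[of x] of_int_floor_le[of "2 ^ n * h x"] by (auto simp: hn_def field_simps)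
  have hn_lim: "(\<lambda>n. hn n x) \<longlonglongrightarrow> h x" for x
  proof (rule tendsto_sandwich)
    show "\<forall>\<^sub>F n in sequentially. h x - (1/2) ^ n \<le> hn n x"
    proof (intro always_eventually allI)
      fix n :: nat
      have "2 ^ n * h x - 1 \<le> of_int \<lfloor>2 ^ n * h x\<rfloor>" by linarith
      then have "(2 ^ n * h x - 1) / 2 ^ n \<le> hn n x" unfolding hn_def by (intro divide_right_mono) auto
      then show "h x - (1/2) ^ n \<le> hn n x" by (simp add: diff_divide_distrib power_one_over)
    qed
    show "\<forall>\<^sub>F n in sequentially. hn n x \<le> h x" using hn01 by auto
    show "(\<lambda>n. h x - (1/2) ^ n) \<longlonglongrightarrow> h x"
      using tendsto_diff[OF tendsto_const[of "h x"] LIMSEQ_realpow_zero[of "1/2"]] by simp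
  qed simp
  have step: "(\<lambda>\<omega>. \<Prod>x\<in>\<Phi> \<omega> \<inter> B. 1 - hn n x) \<in> borel_measurable M \<and>
      (\<integral>\<omega>. (\<Prod>x\<in>\<Phi> \<omega> \<inter> B. 1 - hn n x) \<partial>M) = exp (- (\<integral>x. indicator B x * hn n x \<partial>\<mu>))" for n
  proof -
    define V where "V = (\<lambda>j. of_int j / (2::real) ^ n) ` {0..2 ^ n}"
    have hnV: "hn n x \<in> V" for x
    proof -
      have "2 ^ n * h x \<le> 2 ^ n * 1" by (intro mult_left_mono h01) auto
      then have "\<lfloor>2 ^ n * h x\<rfloor> \<le> \<lfloor>2 ^ n :: real\<rfloor>" by (intro floor_mono) simp
      moreover have "\<lfloor>2 ^ n :: real\<rfloor> = 2 ^ n" using floor_of_int[of "2 ^ n", where ?'a = real] by simp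
      ultimately have "\<lfloor>2 ^ n * h x\<rfloor> \<le> 2 ^ n" by simp
      moreover have "0 \<le> \<lfloor>2 ^ n * h x\<rfloor>" using h01(1)[of x] by simp
      ultimately show ?thesis by (auto simp: V_def hn_def)
    qed
    define \<B> where "\<B> = (\<lambda>v. {x\<in>B. hn n x = v}) ` V"
    have fin\<B>: "finite \<B>" by (simp add: \<B>_def V_def)
    have \<B>: "C \<in> sets borel" "bounded C" if CB: "C \<in> \<B>" for C
    proof -
      obtain v where v: "C = {x\<in>B. hn n x = v}" using CB unfolding \<B>_def by (rule imageE)
      have "C = B \<inter> (hn n -` {v} \<inter> space borel)" by (auto simp: v)
      then show "C \<in> sets borel" by simp
      show "bounded C" using B(2) by (rule bounded_subset) (auto simp: v)
    qed
    have dis: "C \<inter> C' = {}" if "C \<in> \<B>" "C' \<in> \<B>" "C \<noteq> C'" for C C'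
      using that by (auto simp: \<B>_def)
    then have disj: "disjoint \<B>" by (auto simp: disjoint_def)
    have cover: "\<Union>\<B> = B" using hnV by (auto simp: \<B>_def)
    \<comment> \<open>The partition is indexed by level sets and not by values, because independence
      is available for a family of sets. Several values may share the empty level set, whose value
      is immaterial.\<close>
    define val where "val C = (if C = {} then 0 else hn n (SOME x. x \<in> C))" for C
    have val: "val C = hn n x" if "C \<in> \<B>" "x \<in> C" for C x
    proof -
      have "(SOME x. x \<in> C) \<in> C" using that(2) by (rule someI)
      then show ?thesis using that by (auto simp: \<B>_def val_def)
    qed
    have val01: "0 \<le> val C" "val C \<le> 1" for C
      using hn01(1)[of n] order_trans[OF hn01(2)[of n] h01(2)] by (auto simp: val_def)
    have prod_eq: "(\<Prod>x\<in>\<Phi> \<omega> \<inter> B. 1 - hn n x) = (\<Prod>C\<in>\<B>. (1 - val C) ^ card (\<Phi> \<omega> \<inter> C))" if "\<omega> \<in> space M" for \<omega>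
    proof -
      have "\<Phi> \<omega> \<inter> B = (\<Union>C\<in>\<B>. \<Phi> \<omega> \<inter> C)" using cover by blast
      also have "(\<Prod>x\<in>(\<Union>C\<in>\<B>. \<Phi> \<omega> \<inter> C). 1 - hn n x) = (\<Prod>C\<in>\<B>. \<Prod>x\<in>\<Phi> \<omega> \<inter> C. 1 - hn n x)"
        by (rule prod.UNION_disjoint)
          (use fin\<B> dis locally_finite_Int[OF poisson_point_processD(2)[OF ppp that] \<B>(2)] in \<open>auto\<close>)
      also have "\<dots> = (\<Prod>C\<in>\<B>. \<Prod>x\<in>\<Phi> \<omega> \<inter> C. 1 - val C)"
        by (intro prod.cong refl) (auto simp: val)
      finally show ?thesis by simp
    qed
    have cm: "(\<lambda>\<omega>. card (\<Phi> \<omega> \<inter> C)) \<in> measurable M (count_space UNIV)" if "C \<in> \<B>" for C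
      using poisson_point_processD(4)[OF ppp \<B>[OF that]] .
    have pm: "(\<lambda>\<omega>. (1 - val C) ^ card (\<Phi> \<omega> \<inter> C)) \<in> borel_measurable M" if "C \<in> \<B>" for C
      using cm[OF that] by measurable
    have meas: "(\<lambda>\<omega>. \<Prod>C\<in>\<B>. (1 - val C) ^ card (\<Phi> \<omega> \<inter> C)) \<in> borel_measurable M"
      by (intro borel_measurable_prod pm)
    have ind: "indep_vars (\<lambda>_. borel) (\<lambda>C \<omega>. (1 - val C) ^ card (\<Phi> \<omega> \<inter> C)) \<B>"
      by (rule indep_vars_compose2[OF poisson_point_processD(6)[OF ppp fin\<B> disj \<B>]]) auto
    have inte: "integrable M (\<lambda>\<omega>. (1 - val C) ^ card (\<Phi> \<omega> \<inter> C))" if "C \<in> \<B>" for C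
      by (rule integrable_const_bound[of _ 1])
        (use pm[OF that] val01[of C] in \<open>auto intro!: AE_I2 power_le_one simp: power_abs\<close>)
    have "(\<integral>\<omega>. (\<Prod>x\<in>\<Phi> \<omega> \<inter> B. 1 - hn n x) \<partial>M) = (\<integral>\<omega>. (\<Prod>C\<in>\<B>. (1 - val C) ^ card (\<Phi> \<omega> \<inter> C)) \<partial>M)"
      by (intro Bochner_Integration.integral_cong refl prod_eq)
    also have "\<dots> = (\<Prod>C\<in>\<B>. \<integral>\<omega>. (1 - val C) ^ card (\<Phi> \<omega> \<inter> C) \<partial>M)"
      by (rule indep_vars_lebesgue_integral[OF fin\<B> ind inte])
    also have "\<dots> = (\<Prod>C\<in>\<B>. exp (- (measure \<mu> C * val C)))"
    proof (intro prod.cong refl)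
      fix C assume "C \<in> \<B>"
      then show "(\<integral>\<omega>. (1 - val C) ^ card (\<Phi> \<omega> \<inter> C) \<partial>M) = exp (- (measure \<mu> C * val C))"
        using poisson_pgf[OF ppp \<B>, of C "1 - val C"] val01[of C] by simp
    qed
    also have "\<dots> = exp (- (\<Sum>C\<in>\<B>. measure \<mu> C * val C))"
      by (simp add: exp_sum[OF fin\<B>] sum_negf[symmetric])
    also have "(\<Sum>C\<in>\<B>. measure \<mu> C * val C) = (\<integral>x. indicator B x * hn n x \<partial>\<mu>)"
    proof -
      have "indicator B x * hn n x = (\<Sum>C\<in>\<B>. indicator C x * val C)" for x
      proof (cases "x \<in> B")
        case True
        then obtain C0 where C0: "C0 \<in> \<B>" "x \<in> C0" using cover by blast
        have "(\<Sum>C\<in>\<B>. indicator C x * val C) = (\<Sum>C\<in>{C0}. indicator C x * val C)"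
          by (rule sum.mono_neutral_right) (use fin\<B> C0 dis in \<open>auto simp: indicator_def\<close>)
        then show ?thesis using C0 val True by simp
      next
        case False
        then show ?thesis using cover by (intro trans[OF _ sum.neutral[symmetric]]) (auto simp: indicator_def)
      qed
      then have "(\<integral>x. indicator B x * hn n x \<partial>\<mu>) = (\<integral>x. (\<Sum>C\<in>\<B>. indicator C x * val C) \<partial>\<mu>)" by simp
      also have "\<dots> = (\<Sum>C\<in>\<B>. \<integral>x. indicator C x * val C \<partial>\<mu>)"
        by (rule Bochner_Integration.integral_sum)
          (use \<B> fin\<mu> \<mu> in \<open>auto intro!: integrable_mult_left integrable_real_indicator\<close>)
      also have "\<dots> = (\<Sum>C\<in>\<B>. measure \<mu> C * val C)"
        by (intro sum.cong refl) (use \<B> \<mu> sets_eq_imp_space_eq[OF \<mu>] in auto)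
      finally show ?thesis by simp
    qed
    finally have "(\<integral>\<omega>. (\<Prod>x\<in>\<Phi> \<omega> \<inter> B. 1 - hn n x) \<partial>M) = exp (- (\<integral>x. indicator B x * hn n x \<partial>\<mu>))" .
    moreover have "(\<lambda>\<omega>. \<Prod>x\<in>\<Phi> \<omega> \<inter> B. 1 - hn n x) \<in> borel_measurable M"
      using meas by (subst measurable_cong[OF prod_eq])
    ultimately show ?thesis by blast
  qed
  have plim: "(\<lambda>n. \<Prod>x\<in>\<Phi> \<omega> \<inter> B. 1 - hn n x) \<longlonglongrightarrow> (\<Prod>x\<in>\<Phi> \<omega> \<inter> B. 1 - h x)" for \<omega>
    by (intro tendsto_intros hn_lim)
  show pm: "(\<lambda>\<omega>. \<Prod>x\<in>\<Phi> \<omega> \<inter> B. 1 - h x) \<in> borel_measurable M"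
    by (rule borel_measurable_LIMSEQ_real[OF plim]) (use step in blast)
  have l1: "(\<lambda>n. \<integral>\<omega>. (\<Prod>x\<in>\<Phi> \<omega> \<inter> B. 1 - hn n x) \<partial>M) \<longlonglongrightarrow> (\<integral>\<omega>. (\<Prod>x\<in>\<Phi> \<omega> \<inter> B. 1 - h x) \<partial>M)"
  proof (rule integral_dominated_convergence[where w="\<lambda>_. 1"])
    show "AE \<omega> in M. norm (\<Prod>x\<in>\<Phi> \<omega> \<inter> B. 1 - hn n x) \<le> 1" for n
    proof (intro AE_I2)
      fix \<omega>
      have "0 \<le> 1 - hn n x \<and> 1 - hn n x \<le> 1" for x using hn01[of n x] h01(2)[of x] by simp
      then show "norm (\<Prod>x\<in>\<Phi> \<omega> \<inter> B. 1 - hn n x) \<le> 1"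
        by (simp add: abs_prod) (intro prod_le_1, auto)
    qed
  qed (use pm step plim in auto)
  have mc: "borel_measurable \<mu> = borel_measurable borel" by (rule measurable_cong_sets[OF \<mu> refl])
  have "(\<lambda>n. \<integral>x. indicator B x * hn n x \<partial>\<mu>) \<longlonglongrightarrow> (\<integral>x. indicator B x * h x \<partial>\<mu>)"
  proof (rule integral_dominated_convergence[where w="indicator B"])
    show "integrable \<mu> (indicator B :: _ \<Rightarrow> real)"
      by (intro integrable_real_indicator) (use B fin\<mu> \<mu> in auto)
    show "AE x in \<mu>. norm (indicator B x * hn n x) \<le> indicator B x" for n
    proof (intro AE_I2)
      fix x show "norm (indicator B x * hn n x) \<le> indicator B x"
        using hn01[of n x] h01(2)[of x] by (simp add: indicator_def)
    qed
    show "AE x in \<mu>. (\<lambda>n. indicator B x * hn n x) \<longlonglongrightarrow> indicator B x * h x"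
      by (intro AE_I2 tendsto_intros hn_lim)
  qed (auto simp: mc)
  then have "(\<lambda>n. exp (- (\<integral>x. indicator B x * hn n x \<partial>\<mu>))) \<longlonglongrightarrow> exp (- (\<integral>x. indicator B x * h x \<partial>\<mu>))"
    by (intro tendsto_intros)
  then show "(\<integral>\<omega>. (\<Prod>x\<in>\<Phi> \<omega> \<inter> B. 1 - h x) \<partial>M) = exp (- (\<integral>x. indicator B x * h x \<partial>\<mu>))"
    using l1 step by (simp add: LIMSEQ_unique)
qed

section \<open>Trajectories\<close>

definition leg :: "(nat \<Rightarrow> 'a::real_normed_vector) \<Rightarrow> real \<Rightarrow> nat" where
  "leg v t = (LEAST j. t < arrival0 v (Suc j))"

definition leg_sum :: "nat \<Rightarrow> (nat \<Rightarrow> 'a::real_normed_vector) \<Rightarrow> nat \<Rightarrow> 'a" where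
  "leg_sum p v j = (\<Sum>i<j. if i mod 2 = p then v i else 0)"

text \<open>\<open>p = 0\<close> collects the slow legs, \<open>p = 1\<close> the fast ones, before the scaling by \<open>T\<close>.\<close>

definition phase_disp :: "nat \<Rightarrow> (nat \<Rightarrow> 'a::real_normed_vector) \<Rightarrow> real \<Rightarrow> 'a" where
  "phase_disp p v t = leg_sum p v (leg v t) +
     (if leg v t mod 2 = p then ((t - arrival0 v (leg v t)) / norm (v (leg v t))) *\<^sub>R v (leg v t) else 0)"

lemma leg_sum_Suc: "leg_sum p v (Suc j) = leg_sum p v j + (if j mod 2 = p then v j else 0)"
  by (simp add: leg_sum_def)

lemma waypoint_leg_sum: "waypoint T x v j = x + leg_sum 0 v j + T *\<^sub>R leg_sum 1 v j"
  by (induction j) (auto simp: leg_sum_def algebra_simps mod_2_eq_odd)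

text \<open>At time \<open>t * T\<close> the factor \<open>T\<close> cancels in the choice of the
  leg and in the interpolation ratio. It survives only through the exponent \<open>j mod 2\<close>
  of the fast increments.\<close>

lemma position_phase_disp:
  assumes T: "T > 0"
  shows "position T x v (t * T) = x + phase_disp 0 v t + T *\<^sub>R phase_disp 1 v t"
proof -
  have j: "(LEAST j. t * T < arrival T v (Suc j)) = leg v t"
    using T by (simp add: leg_def arrival_def mult.commute[of t])
  have f: "(t * T - arrival T v j) / (arrival T v (Suc j) - arrival T v j) = (t - arrival0 v j) / norm (v j)" for j
    using T by (simp add: arrival_def mult.commute[of t T] flip: right_diff_distrib)
  show ?thesis
    unfolding position_def j Let_def f waypoint.simps(2) waypoint_leg_sum phase_disp_def
    by (cases "even (leg v t)") (auto simp: algebra_simps mod_2_eq_odd leg_sum_Suc)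
qed

lemma arrival0_mono: "j \<le> k \<Longrightarrow> arrival0 v j \<le> arrival0 v k"
  by (rule lift_Suc_mono_le[of "arrival0 v"]) auto

lemma arrival0_sum: "arrival0 v n = (\<Sum>i<n. norm (v i))"
  by (induction n) auto

text \<open>The almost sure properties of a path on which the deterministic arguments rest.
  \<open>separated\<close> says that a slow leg is identified by the fast displacement during it; so
  different slow legs of one path are at a distance of order \<open>T\<close>.\<close>

locale regular_path =
  fixes v :: "nat \<Rightarrow> 'a::real_normed_vector"
  assumes nonzero: "\<And>j. v j \<noteq> 0"
    and unbounded: "\<And>C. \<exists>j. C < arrival0 v j"
    and separated: "\<And>j k. even j \<Longrightarrow> even k \<Longrightarrow> j < k \<Longrightarrow> leg_sum 1 v j \<noteq> leg_sum 1 v k"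
begin

lemma leg_bounds:
  assumes "t \<ge> 0"
  shows "arrival0 v (leg v t) \<le> t" "t < arrival0 v (Suc (leg v t))"
proof -
  obtain k where "t < arrival0 v k" using unbounded by blast
  then have k: "t < arrival0 v (Suc k)" by (rule order.strict_trans2) (simp add: arrival0_mono del: arrival0.simps)
  show "t < arrival0 v (Suc (leg v t))" unfolding leg_def using k by (rule LeastI)
  show "arrival0 v (leg v t) \<le> t"
  proof (cases "leg v t")
    case (Suc j)
    then have "\<not> t < arrival0 v (Suc j)" unfolding leg_def by (metis lessI not_less_Least)
    then show ?thesis using Suc by simp
  qed (use assms in simp)
qed

lemma leg_eqI:
  assumes "arrival0 v j \<le> t" "t < arrival0 v (Suc j)"
  shows "leg v t = j"
proof -
  have t: "t \<ge> 0" using assms(1) arrival0_mono[of 0 j v] by simp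
  note b = leg_bounds[OF t]
  have "\<not> leg v t < j" using assms(1) b(2) arrival0_mono[of "Suc (leg v t)" j v] by force
  moreover have "\<not> j < leg v t" using assms(2) b(1) arrival0_mono[of "Suc j" "leg v t" v] by force
  ultimately show ?thesis by simp
qed

text \<open>In rescaled time a leg lasts as long as its increment is long, so the lengths of all
  legs up to time \<open>t\<close> add up to \<open>t\<close>, and the legs of one phase contribute
  at most that.\<close>

lemma norm_phase_disp:
  assumes t: "t \<ge> 0" shows "norm (phase_disp p v t) \<le> t"
proof -
  let ?j = "leg v t"
  note b = leg_bounds[OF t]
  have "norm (leg_sum p v ?j) \<le> arrival0 v ?j"
    unfolding leg_sum_def arrival0_sum by (rule order_trans[OF norm_sum]) (intro sum_mono; simp)
  moreover have "norm (if ?j mod 2 = p then ((t - arrival0 v ?j) / norm (v ?j)) *\<^sub>R v ?j else 0) \<le> t - arrival0 v ?j"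
    using b(1) nonzero[of ?j] by simp
  ultimately show ?thesis
    unfolding phase_disp_def using norm_triangle_ineq order_trans by (smt (verit))
qed

lemma phase_disp_slow_leg:
  assumes "even (leg v t)"
  shows "phase_disp 1 v t = leg_sum 1 v (leg v t)"
    and "phase_disp 0 v t = leg_sum 0 v (leg v t) + ((t - arrival0 v (leg v t)) / norm (v (leg v t))) *\<^sub>R v (leg v t)"
  using assms by (auto simp: phase_disp_def mod_2_eq_odd)

text \<open>Along one fast leg the displacement is injective in time, so each leg contributes at
  most one time.\<close>

lemma countable_fast_coincidence:
  "countable {t. odd (leg v t) \<and> phase_disp 1 v t = w}"
proof (rule countableI'[of "leg v"])
  show "inj_on (leg v) {t. odd (leg v t) \<and> phase_disp 1 v t = w}"
  proof (rule inj_onI)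
    fix s t assume *: "s \<in> {t. odd (leg v t) \<and> phase_disp 1 v t = w}" "t \<in> {t. odd (leg v t) \<and> phase_disp 1 v t = w}" "leg v s = leg v t"
    let ?j = "leg v t"
    have "phase_disp 1 v s = phase_disp 1 v t" using * by simp
    then have "((s - arrival0 v ?j) / norm (v ?j)) *\<^sub>R v ?j = ((t - arrival0 v ?j) / norm (v ?j)) *\<^sub>R v ?j"
      using * by (auto simp: phase_disp_def mod_2_eq_odd)
    then show "s = t" using nonzero[of ?j] by simp
  qed
qed

text \<open>The limit objects use closed leg intervals, while \<open>leg\<close> uses half-open
  ones; the two conventions agree away from the arrival times. The index \<open>Suc j\<close> leaves
  time 0 admissible, where no earlier leg competes.\<close>

lemma slow_interval_iff:
  assumes "t \<ge> 0" and "\<And>j. t \<noteq> arrival0 v (Suc j)"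
  shows "arrival0 v j \<le> t \<and> t \<le> arrival0 v (Suc j) \<longleftrightarrow> leg v t = j"
  using leg_bounds[OF assms(1)] leg_eqI[of j t] assms(2)[of j] by fastforce

lemma fast_times_iff:
  assumes "t \<ge> 0" and "\<And>j. t \<noteq> arrival0 v (Suc j)"
  shows "t \<in> fast_times v \<longleftrightarrow> odd (leg v t)"
proof -
  have "t \<in> fast_times v \<longleftrightarrow> (\<exists>j. leg v t = 2 * j + 1)"
    unfolding fast_times_def using slow_interval_iff[OF assms, of "2 * j + 1" for j] by (simp add: numeral_2_eq_2)
  then show ?thesis by (auto elim: oddE)
qed

end

lemma arrival0_measurable [measurable]:
  assumes [measurable]: "\<And>j. v j \<in> borel_measurable M"
  shows "(\<lambda>\<omega>. arrival0 (\<lambda>j. v j \<omega>) n) \<in> borel_measurable M"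
  by (induction n) simp_all

lemma leg_measurable [measurable]:
  assumes [measurable]: "\<And>j. v j \<in> borel_measurable M" "s \<in> borel_measurable M"
  shows "(\<lambda>\<omega>. leg (\<lambda>j. v j \<omega>) (s \<omega>)) \<in> measurable M (count_space UNIV)"
  unfolding leg_def by measurable

lemma leg_sum_measurable [measurable]:
  fixes v :: "nat \<Rightarrow> 'w \<Rightarrow> 'a::euclidean_space"
  assumes [measurable]: "\<And>j. v j \<in> borel_measurable M"
  shows "(\<lambda>\<omega>. leg_sum p (\<lambda>j. v j \<omega>) n) \<in> borel_measurable M"
  unfolding leg_sum_def by (intro borel_measurable_sum) simp

lemma phase_disp_measurable [measurable]:
  fixes v :: "nat \<Rightarrow> 'w \<Rightarrow> 'a::euclidean_space"
  assumes [measurable]: "\<And>j. v j \<in> borel_measurable M" "s \<in> borel_measurable M"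
  shows "(\<lambda>\<omega>. phase_disp p (\<lambda>j. v j \<omega>) (s \<omega>)) \<in> borel_measurable M"
proof -
  have [measurable]: "(\<lambda>\<omega>. leg (\<lambda>j. v j \<omega>) (s \<omega>)) \<in> measurable M (count_space UNIV)"
    by (rule leg_measurable) auto
  have "(\<lambda>\<omega>. leg_sum p (\<lambda>j. v j \<omega>) n +
     (if n mod 2 = p then ((s \<omega> - arrival0 (\<lambda>j. v j \<omega>) n) / norm (v n \<omega>)) *\<^sub>R v n \<omega> else 0)) \<in> borel_measurable M" for n
    by (cases "n mod 2 = p") simp_all
  then show ?thesis
    unfolding phase_disp_def by (rule measurable_compose_countable) measurable
qed

section \<open>Almost sure regularity of a path with i.i.d. atomless increments\<close>

locale iid_increments = prob_space M for M :: "'w measure" +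
  fixes \<kappa> :: "'a::euclidean_space measure" and v :: "nat \<Rightarrow> 'w \<Rightarrow> 'a"
  assumes v_indep: "indep_vars (\<lambda>_. borel) v UNIV"
    and v_law: "\<And>j. distr M borel (v j) = \<kappa>"
    and atomless: "\<And>x. emeasure \<kappa> {x} = 0"
begin

lemma v_measurable [measurable]: "v j \<in> borel_measurable M"
  using v_indep by (simp add: indep_vars_def)

abbreviation path :: "'w \<Rightarrow> nat \<Rightarrow> 'a" where "path \<omega> \<equiv> (\<lambda>j. v j \<omega>)"

lemma sets_\<kappa> [measurable_cong, simp]: "sets \<kappa> = sets borel"
  using v_law[of 0] by (metis sets_distr)

lemma prob_space_\<kappa>: "prob_space \<kappa>"
  using prob_space_distr[OF v_measurable[of 0]] v_law by simp

lemma v_indep_of: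
  assumes n: "n \<notin> J" and f: "f \<in> measurable (PiM J (\<lambda>_. borel)) N"
  shows "indep_var borel (v n) N (\<lambda>\<omega>. f (restrict (path \<omega>) J))"
proof -
  have "indep_var borel ((\<lambda>g. g n) \<circ> (\<lambda>\<omega>. restrict (path \<omega>) {n})) N (f \<circ> (\<lambda>\<omega>. restrict (path \<omega>) J))"
    by (rule indep_var_compose[OF indep_var_restrict[OF v_indep, of "{n}" J]]) (use n f in auto)
  then show ?thesis by (simp add: comp_def)
qed

lemma AE_nonzero: "AE \<omega> in M. v j \<omega> \<noteq> 0"
proof -
  have "AE x in distr M borel (v j). x \<noteq> 0"
    unfolding v_law by (rule AE_I[of _ _ "{0}"]) (auto simp: atomless)
  then show ?thesis by (simp add: AE_distr_iff)
qed

text \<open>The Laplace transform at 1 of the duration of a leg. It is below 1 because the duration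
  is almost surely positive; the resulting geometric decay of \<open>E exp (- arrival0)\<close>
  controls how many legs start before a given time.\<close>

definition lap :: real where "lap = (\<integral>x. exp (- norm x) \<partial>\<kappa>)"

lemma lap_bounds: "0 \<le> lap" "lap < 1"
proof -
  interpret K: prob_space \<kappa> by (rule prob_space_\<kappa>)
  have i: "integrable \<kappa> (\<lambda>x. exp (- norm x))"
    by (rule K.integrable_const_bound[of _ 1]) (auto intro!: measurable_compose[OF _ borel_measurable_exp])
  show "0 \<le> lap" unfolding lap_def by (intro Bochner_Integration.integral_nonneg) simp
  have "AE x in \<kappa>. x \<noteq> 0" by (rule AE_I[of _ _ "{0}"]) (auto simp: atomless)
  then have "AE x in \<kappa>. exp (- norm x) < 1" by eventually_elim simp
  then have "lap < (\<integral>x. 1 \<partial>\<kappa>)"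
    unfolding lap_def by (intro K.integral_less_AE_space i) (auto simp: K.emeasure_space_1)
  then show "lap < 1" by (simp add: K.prob_space)
qed

lemma expectation_exp_arrival0: "(\<integral>\<omega>. exp (- arrival0 (path \<omega>) n) \<partial>M) = lap ^ n"
  and integrable_exp_arrival0: "integrable M (\<lambda>\<omega>. exp (- arrival0 (path \<omega>) n))"
proof -
  have m: "(\<lambda>x::'a. exp (- norm x)) \<in> borel_measurable borel" by measurable
  have ind: "indep_vars (\<lambda>_. borel) (\<lambda>i \<omega>. exp (- norm (v i \<omega>))) {..<n}"
    by (rule indep_vars_subset[OF indep_vars_compose2[OF v_indep, of "\<lambda>_ x. exp (- norm x)"]]) auto
  have int: "integrable M (\<lambda>\<omega>. exp (- norm (v i \<omega>)))" for i
    by (rule integrable_const_bound[of _ 1]) auto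
  have e: "exp (- arrival0 (path \<omega>) n) = (\<Prod>i<n. exp (- norm (v i \<omega>)))" for \<omega>
    by (simp add: arrival0_sum exp_sum[symmetric] sum_negf)
  have "(\<integral>\<omega>. exp (- norm (v i \<omega>)) \<partial>M) = lap" for i
    unfolding lap_def using integral_distr[OF v_measurable[of i] m] by (simp add: v_law)
  then show "(\<integral>\<omega>. exp (- arrival0 (path \<omega>) n) \<partial>M) = lap ^ n"
    unfolding e by (subst indep_vars_lebesgue_integral[OF _ ind int]) auto
  show "integrable M (\<lambda>\<omega>. exp (- arrival0 (path \<omega>) n))"
    unfolding e by (rule indep_vars_integrable[OF _ ind int]) auto
qed

text \<open>A Chernoff bound: if all arrivals stayed below \<open>n\<close> with positive
  probability \<open>p\<close>, then \<open>p * exp (- n) \<le> lap ^ j\<close> for every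
  \<open>j\<close>.\<close>

lemma AE_unbounded: "AE \<omega> in M. \<forall>C. \<exists>j. C < arrival0 (path \<omega>) j"
proof -
  have "AE \<omega> in M. (\<exists>j. real n < arrival0 (path \<omega>) j)" for n :: nat
  proof -
    let ?A = "{\<omega>\<in>space M. \<forall>j. arrival0 (path \<omega>) j \<le> real n}"
    have A [measurable]: "?A \<in> sets M" by measurable
    have le: "prob ?A * exp (- real n) \<le> lap ^ j" for j
    proof -
      have "prob ?A * exp (- real n) = (\<integral>\<omega>. indicator ?A \<omega> * exp (- real n) \<partial>M)"
        using A by (simp add: Int_absorb2 del: Collect_mem_eq)
      also have "\<dots> \<le> (\<integral>\<omega>. exp (- arrival0 (path \<omega>) j) \<partial>M)"
        by (intro integral_mono integrable_exp_arrival0 integrable_mult_left integrable_real_indicator A)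
          (auto simp: indicator_def emeasure_eq_measure)
      finally show ?thesis by (simp add: expectation_exp_arrival0)
    qed
    have "(\<lambda>j. lap ^ j) \<longlonglongrightarrow> 0" using lap_bounds by (intro LIMSEQ_realpow_zero) auto
    then have "prob ?A * exp (- real n) \<le> 0"
      by (rule LIMSEQ_le_const) (use le in auto)
    then have "prob ?A = 0" by (simp add: mult_le_0_iff not_le[symmetric] measure_le_0_iff)
    then show ?thesis
      by (intro AE_I[OF _ _ A]) (auto simp: not_less emeasure_eq_measure)
  qed
  then have "AE \<omega> in M. \<forall>n::nat. \<exists>j. real n < arrival0 (path \<omega>) j" by (simp add: AE_all_countable)
  then show ?thesis
  proof eventually_elim
    case (elim \<omega>)
    show ?case
    proof
      fix C :: real
      obtain n :: nat where "C \<le> n" using real_arch_simple by blast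
      then show "\<exists>j. C < arrival0 (path \<omega>) j" using elim by (meson order.strict_trans1)
    qed
  qed
qed

text \<open>The difference of the two sums contains the fast increment \<open>v (Suc j)\<close>,
  which is independent of the remaining terms and has no atoms. By Fubini it almost surely does not
  cancel them.\<close>

lemma AE_separated:
  assumes jk: "even j" "j < k" "even k"
  shows "AE \<omega> in M. leg_sum 1 (path \<omega>) j \<noteq> leg_sum 1 (path \<omega>) k"
proof -
  \<comment> \<open>The indices after the isolated increment \<open>Suc j\<close>; index
    \<open>j\<close> itself is even and contributes nothing to the fast sum.\<close>
  define J where "J = {Suc (Suc j)..<k}"
  define f where "f g = (\<Sum>i\<in>J. if i mod 2 = 1 then g i else 0)" for g :: "nat \<Rightarrow> 'a"
  have fm [measurable]: "f \<in> measurable (PiM J (\<lambda>_. borel)) borel"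
    unfolding f_def by (intro borel_measurable_sum) (auto simp: J_def)
  have nJ: "Suc j \<notin> J" by (auto simp: J_def)
  have diff: "leg_sum 1 (path \<omega>) k - leg_sum 1 (path \<omega>) j = v (Suc j) \<omega> + f (restrict (path \<omega>) J)" for \<omega>
  proof -
    let ?g = "\<lambda>i. if i mod 2 = 1 then v i \<omega> else 0"
    have "Suc j < k" using jk by (metis Suc_lessI even_Suc)
    have "leg_sum 1 (path \<omega>) k = sum ?g {..<j} + sum ?g {j..<k}"
      unfolding leg_sum_def using jk by (subst sum.union_disjoint[symmetric]) (auto intro: sum.cong)
    also have "sum ?g {j..<k} = ?g j + (?g (Suc j) + sum ?g J)"
      unfolding J_def using \<open>Suc j < k\<close> by (simp add: sum.atLeast_Suc_lessThan)
    also have "sum ?g J = f (restrict (path \<omega>) J)" unfolding f_def by (intro sum.cong) auto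
    finally show ?thesis using jk by (simp add: leg_sum_def mod_2_eq_odd)
  qed
  have "indep_var borel (v (Suc j)) borel (\<lambda>\<omega>. f (restrict (path \<omega>) J))"
    by (rule v_indep_of[OF nJ fm])
  then have d: "distr M (borel \<Otimes>\<^sub>M borel) (\<lambda>\<omega>. (v (Suc j) \<omega>, f (restrict (path \<omega>) J))) =
      \<kappa> \<Otimes>\<^sub>M distr M borel (\<lambda>\<omega>. f (restrict (path \<omega>) J))"
    and rv [measurable]: "(\<lambda>\<omega>. f (restrict (path \<omega>) J)) \<in> borel_measurable M"
    unfolding indep_var_distribution_eq v_law by auto
  interpret K: prob_space \<kappa> by (rule prob_space_\<kappa>)
  interpret D: prob_space "distr M borel (\<lambda>\<omega>. f (restrict (path \<omega>) J))" by (rule prob_space_distr[OF rv])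
  interpret P: pair_sigma_finite \<kappa> "distr M borel (\<lambda>\<omega>. f (restrict (path \<omega>) J))" ..
  have ms: "{p \<in> space (\<kappa> \<Otimes>\<^sub>M distr M borel (\<lambda>\<omega>. f (restrict (path \<omega>) J))). fst p + snd p \<noteq> 0}
      \<in> sets (\<kappa> \<Otimes>\<^sub>M distr M borel (\<lambda>\<omega>. f (restrict (path \<omega>) J)))"
    by measurable
  have "AE y in distr M borel (\<lambda>\<omega>. f (restrict (path \<omega>) J)). AE x in \<kappa>. x + y \<noteq> 0"
  proof (rule AE_I2)
    fix y :: 'a
    show "AE x in \<kappa>. x + y \<noteq> 0"
      by (rule AE_I[of _ _ "{- y}"]) (auto simp: atomless eq_neg_iff_add_eq_0)
  qed
  then have "AE x in \<kappa>. AE y in distr M borel (\<lambda>\<omega>. f (restrict (path \<omega>) J)). x + y \<noteq> 0"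
    using P.AE_commute[of "\<lambda>x y. x + y \<noteq> 0"] ms by blast
  then have "AE p in distr M (borel \<Otimes>\<^sub>M borel) (\<lambda>\<omega>. (v (Suc j) \<omega>, f (restrict (path \<omega>) J))). fst p + snd p \<noteq> 0"
    unfolding d by (intro P.AE_pair_measure ms) simp
  then have "AE \<omega> in M. v (Suc j) \<omega> + f (restrict (path \<omega>) J) \<noteq> 0"
    by (subst (asm) AE_distr_iff) simp_all
  then show ?thesis
  proof eventually_elim
    case (elim \<omega>)
    then show ?case using diff[of \<omega>] by auto
  qed
qed

lemma AE_regular: "AE \<omega> in M. regular_path (path \<omega>)"
proof -
  have 1: "AE \<omega> in M. \<forall>j. v j \<omega> \<noteq> 0" using AE_nonzero by (simp add: AE_all_countable)
  have "AE \<omega> in M. even j \<longrightarrow> even k \<longrightarrow> j < k \<longrightarrow> leg_sum 1 (path \<omega>) j \<noteq> leg_sum 1 (path \<omega>) k" for j k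
    using AE_separated[of j k] by (cases "even j \<and> even k \<and> j < k") auto
  then have 3: "AE \<omega> in M. \<forall>j k. even j \<longrightarrow> even k \<longrightarrow> j < k \<longrightarrow> leg_sum 1 (path \<omega>) j \<noteq> leg_sum 1 (path \<omega>) k"
    by (simp add: AE_all_countable)
  show ?thesis
    using 1 AE_unbounded 3 by eventually_elim (unfold_locales, blast+)
qed

end

section \<open>Void probabilities of the mobility model\<close>

lemma emeasure_lborel_translation:
  fixes d :: "'a::euclidean_space"
  assumes A: "A \<in> sets borel"
  shows "emeasure lborel {x. x + d \<in> A} = emeasure lborel A"
proof -
  have "emeasure lborel A = emeasure (distr lborel borel ((+) d)) A" by (simp add: lborel_distr_plus)
  also have "\<dots> = emeasure lborel ((+) d -` A \<inter> space lborel)" by (rule emeasure_distr) (use A in auto)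
  also have "(+) d -` A \<inter> space lborel = {x. x + d \<in> A}" by (auto simp: add.commute)
  finally show ?thesis by simp
qed

lemma (in prob_space) distr_pair_indep_set:
  assumes X: "X \<in> measurable M S" and Y: "Y \<in> measurable M S'"
    and ind: "indep_set (sets (vimage_algebra (space M) X S)) (sets (vimage_algebra (space M) Y S'))"
  shows "distr M (S \<Otimes>\<^sub>M S') (\<lambda>\<omega>. (X \<omega>, Y \<omega>)) = distr M S X \<Otimes>\<^sub>M distr M S' Y"
proof (rule pair_measure_eqI[symmetric])
  show "sigma_finite_measure (distr M S X)" "sigma_finite_measure (distr M S' Y)"
    using prob_space_distr[OF X] prob_space_distr[OF Y] by (auto simp: prob_space_imp_sigma_finite)
  fix A B assume "A \<in> sets (distr M S X)" "B \<in> sets (distr M S' Y)"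
  then have A: "A \<in> sets S" and B: "B \<in> sets S'" by auto
  have "prob ((X -` A \<inter> space M) \<inter> (Y -` B \<inter> space M)) = prob (X -` A \<inter> space M) * prob (Y -` B \<inter> space M)"
    using A B by (intro indep_setD[OF ind] in_vimage_algebra)
  moreover have "(\<lambda>\<omega>. (X \<omega>, Y \<omega>)) -` (A \<times> B) \<inter> space M = (X -` A \<inter> space M) \<inter> (Y -` B \<inter> space M)" by auto
  ultimately show "emeasure (distr M S X) A * emeasure (distr M S' Y) B = emeasure (distr M (S \<Otimes>\<^sub>M S') (\<lambda>\<omega>. (X \<omega>, Y \<omega>))) (A \<times> B)"
    using A B X Y by (simp add: emeasure_distr emeasure_eq_measure ennreal_mult)
next
  show "sets (distr M S X \<Otimes>\<^sub>M distr M S' Y) = sets (distr M (S \<Otimes>\<^sub>M S') (\<lambda>\<omega>. (X \<omega>, Y \<omega>)))"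
    unfolding sets_distr by (rule sets_pair_measure_cong) (rule sets_distr)+
qed

section \<open>The nodes as a Poisson process marked by increments\<close>

locale mobility = prob_space M for M :: "'w measure" +
  fixes lam :: real and \<kappa> :: "'a::euclidean_space measure"
    and X :: "nat \<Rightarrow> 'w \<Rightarrow> 'a" and V :: "nat \<Rightarrow> nat \<Rightarrow> 'w \<Rightarrow> 'a"
  assumes lam_pos: "lam > 0"
    and X_measurable [measurable]: "\<And>i. i \<ge> 1 \<Longrightarrow> X i \<in> borel_measurable M"
    and X_distinct: "\<And>\<omega>. \<omega> \<in> space M \<Longrightarrow> inj_on (\<lambda>i. X i \<omega>) {1..}"
    and X_poisson: "homogeneous_poisson M lam (\<lambda>\<omega>. (\<lambda>i. X i \<omega>) ` {1..})"
    and V_indep: "indep_vars (\<lambda>_. borel) (\<lambda>(i, j). V i j) UNIV"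
    and V_law: "\<And>i j. distr M borel (V i j) = \<kappa>"
    and X_V_indep: "indep_set
          (sets (vimage_algebra (space M) (\<lambda>\<omega>. \<lambda>i\<in>{1..}. X i \<omega>) (\<Pi>\<^sub>M i\<in>{1..}. borel)))
          (sets (vimage_algebra (space M) (\<lambda>\<omega> (i, j). V i j \<omega>) (\<Pi>\<^sub>M p\<in>UNIV. borel)))"
    and atomless: "\<And>x. emeasure \<kappa> {x} = 0"
begin

lemma V_measurable [measurable]: "V i j \<in> borel_measurable M"
  using V_indep by (auto simp: indep_vars_def)

abbreviation row :: "nat \<Rightarrow> 'w \<Rightarrow> nat \<Rightarrow> 'a" where "row i \<omega> \<equiv> (\<lambda>j. V i j \<omega>)"

abbreviation rows :: "(nat \<Rightarrow> 'a) measure" where "rows \<equiv> \<Pi>\<^sub>M j\<in>UNIV. borel"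

lemma row_measurable [measurable]: "row i \<in> measurable M rows"
  by (rule measurable_PiM_single') (auto simp: space_PiM)

lemma rows_indep: "indep_vars (\<lambda>_. rows) row UNIV"
proof -
  have 1: "indep_vars (\<lambda>i::nat. \<Pi>\<^sub>M p\<in>{i} \<times> UNIV. borel) (\<lambda>i \<omega>. restrict (\<lambda>p. (case p of (i, j) \<Rightarrow> V i j) \<omega>) ({i} \<times> UNIV)) UNIV"
    by (rule indep_vars_restrict[OF V_indep]) (auto simp: disjoint_family_on_def)
  have "indep_vars (\<lambda>_. rows) (\<lambda>i \<omega>. (\<lambda>g j. g (i, j)) (restrict (\<lambda>p. (case p of (i, j) \<Rightarrow> V i j) \<omega>) ({i} \<times> UNIV))) UNIV"
    by (rule indep_vars_compose2[OF 1]) (rule measurable_PiM_single'; auto simp: space_PiM)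
  then show ?thesis by simp
qed

lemma row_indep_vars: "indep_vars (\<lambda>_. borel) (V i) UNIV"
proof -
  have 1: "indep_vars (\<lambda>j::nat. \<Pi>\<^sub>M p\<in>{(i, j)}. borel) (\<lambda>j \<omega>. restrict (\<lambda>p. (case p of (i, j) \<Rightarrow> V i j) \<omega>) {(i, j)}) UNIV"
    by (rule indep_vars_restrict[OF V_indep]) (auto simp: disjoint_family_on_def)
  have "indep_vars (\<lambda>_. borel) (\<lambda>j \<omega>. (\<lambda>g. g (i, j)) (restrict (\<lambda>p. (case p of (i, j) \<Rightarrow> V i j) \<omega>) {(i, j)})) UNIV"
    by (rule indep_vars_compose2[OF 1]) auto
  then show ?thesis by simp
qed

text \<open>Row 0 belongs to no node. It serves as the reference copy of a single path, over which
  the expectations in the void probabilities are taken.\<close>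

sublocale iid_increments M \<kappa> "V 0"
  by unfold_locales (use row_indep_vars V_law atomless in auto)

lemma row_law: "distr M rows (row i) = distr M rows (row 0)"
proof -
  have "distr M rows (row i) = (\<Pi>\<^sub>M j\<in>UNIV. \<kappa>)" for i
    using row_indep_vars[of i] indep_vars_iff_distr_eq_PiM'[of UNIV "V i" "\<lambda>_. borel"]
    by (simp add: V_law restrict_UNIV)
  then show ?thesis by simp
qed

abbreviation starts :: "(nat \<Rightarrow> 'a) measure" where "starts \<equiv> \<Pi>\<^sub>M i\<in>{1..}. borel"
abbreviation arrays :: "(nat \<times> nat \<Rightarrow> 'a) measure" where "arrays \<equiv> \<Pi>\<^sub>M p\<in>UNIV. borel"
abbreviation XX :: "'w \<Rightarrow> nat \<Rightarrow> 'a" where "XX \<omega> \<equiv> (\<lambda>i\<in>{1..}. X i \<omega>)"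
abbreviation VV :: "'w \<Rightarrow> nat \<times> nat \<Rightarrow> 'a" where "VV \<omega> \<equiv> (\<lambda>(i, j). V i j \<omega>)"

lemma XX_measurable [measurable]: "XX \<in> measurable M starts"
  by (rule measurable_restrict) simp

lemma VV_measurable [measurable]: "VV \<in> measurable M arrays"
  by (rule measurable_PiM_single') (auto simp: space_PiM)

lemma distr_XX_VV: "distr M (starts \<Otimes>\<^sub>M arrays) (\<lambda>\<omega>. (XX \<omega>, VV \<omega>)) = distr M starts XX \<Otimes>\<^sub>M distr M arrays VV"
  by (rule distr_pair_indep_set[OF XX_measurable VV_measurable X_V_indep])

text \<open>The marking theorem for void events. Given the starting points, the marks are i.i.d. and
  avoidance has probability \<open>\<Prod> (1 - h (X i))\<close>, where \<open>h x\<close> is the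
  probability that a mark at \<open>x\<close> falls into \<open>G\<close>. The generating functional
  evaluates the mean of this product, and Fubini turns the integral of \<open>h\<close> into a mean
  volume.\<close>

lemma marked_void:
  assumes G [measurable]: "G \<in> sets (borel \<Otimes>\<^sub>M rows)" and B: "B \<in> sets borel" "bounded B"
    and GB: "AE \<omega> in M. \<forall>x. (x, row 0 \<omega>) \<in> G \<longrightarrow> x \<in> B"
  shows "prob {\<omega>\<in>space M. \<forall>i\<ge>1. (X i \<omega>, row i \<omega>) \<notin> G} =
    exp (- (lam * (\<integral>\<omega>. measure lborel {x. (x, row 0 \<omega>) \<in> G} \<partial>M)))"
proof -
  note B(1)[measurable]
  define h :: "'a \<Rightarrow> real" where "h x = (\<integral>\<omega>. indicator G (x, row 0 \<omega>) \<partial>M)" for x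
  have pm: "(\<lambda>p. (fst p, row 0 (snd p))) \<in> measurable (borel \<Otimes>\<^sub>M M) (borel \<Otimes>\<^sub>M rows)"
    by (intro measurable_Pair measurable_fst measurable_compose[OF measurable_snd row_measurable])
  have iG: "(\<lambda>w. indicator G (x, w) :: real) \<in> borel_measurable rows" for x
    by (rule measurable_compose[OF measurable_Pair1' borel_measurable_indicator[OF G]]) simp
  have Gx [measurable]: "(\<lambda>\<omega>. indicator G (x, row i \<omega>) :: real) \<in> borel_measurable M" for x i
    by (rule measurable_compose[OF row_measurable iG])
  have h_meas [measurable]: "h \<in> borel_measurable borel"
    unfolding h_def
    by (rule borel_measurable_lebesgue_integral)
      (use measurable_compose[OF pm borel_measurable_indicator[OF G]] in \<open>simp add: split_beta'\<close>)
  have int: "integrable M (\<lambda>\<omega>. indicator G (x, row i \<omega>) :: real)" for x i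
    by (rule integrable_const_bound[of _ 1]) (auto simp: indicator_def)
  have h_row: "(\<integral>\<omega>. indicator G (x, row i \<omega>) \<partial>M) = h x" for x i
  proof -
    have "(\<integral>\<omega>. indicator G (x, row i \<omega>) \<partial>M) = (\<integral>w. (indicator G (x, w) :: real) \<partial>distr M rows (row i))"
      by (rule integral_distr[OF row_measurable iG, symmetric])
    also have "\<dots> = h x" unfolding row_law[of i] h_def by (rule integral_distr[OF row_measurable iG])
    finally show ?thesis .
  qed
  have h01: "0 \<le> h x" "h x \<le> 1" for x
  proof -
    show "0 \<le> h x" unfolding h_def by (intro Bochner_Integration.integral_nonneg) simp
    have "h x \<le> (\<integral>\<omega>. 1 \<partial>M)" unfolding h_def by (intro integral_mono int) (auto simp: indicator_def)
    then show "h x \<le> 1" by (simp add: prob_space)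
  qed
  have hB: "h x = 0" if "x \<notin> B" for x
  proof -
    have "AE \<omega> in M. indicator G (x, row 0 \<omega>) = (0::real)"
      using GB by eventually_elim (use that in \<open>auto simp: indicator_def\<close>)
    then have "h x = (\<integral>\<omega>. 0 \<partial>M)" unfolding h_def by (intro integral_cong_AE) auto
    then show ?thesis by simp
  qed
  let ?E = "\<lambda>n. {\<omega>\<in>space M. \<forall>i\<in>{1..n}. (X i \<omega>, row i \<omega>) \<notin> G}"
  have Em [measurable]: "?E n \<in> sets M" for n
  proof -
    have "Measurable.pred M (\<lambda>\<omega>. (X i \<omega>, row i \<omega>) \<notin> G)" if "i \<in> {1..n}" for i
    proof -
      have "(\<lambda>\<omega>. (X i \<omega>, row i \<omega>)) \<in> measurable M (borel \<Otimes>\<^sub>M rows)"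
        using that by (intro measurable_Pair X_measurable row_measurable) auto
      from measurable_compose[OF this pred_sets2[OF G measurable_ident]] show ?thesis by (simp add: pred_def)
    qed
    then show ?thesis by (intro sets.sets_Collect_finite_All) (auto simp: pred_def)
  qed
  \<comment> \<open>For finitely many nodes: the joint law of starts and marks is a product measure,
    so the marks can be integrated out under fixed starts by independence of the rows.\<close>
  have fin_n: "prob (?E n) = (\<integral>\<omega>'. (\<Prod>i\<in>{1..n}. 1 - h (X i \<omega>')) \<partial>M)" for n
  proof -
    define F where "F p = (\<Prod>i\<in>{1..n}. 1 - indicator G (fst p i, (\<lambda>j. snd p (i, j))) :: real)"
      for p :: "(nat \<Rightarrow> 'a) \<times> (nat \<times> nat \<Rightarrow> 'a)"
    have F [measurable]: "F \<in> borel_measurable (starts \<Otimes>\<^sub>M arrays)"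
      unfolding F_def
    proof (intro borel_measurable_prod borel_measurable_diff borel_measurable_const)
      fix i assume i: "i \<in> {1..n}"
      have [measurable]: "(\<lambda>p. (\<lambda>j. snd p (i, j))) \<in> measurable (starts \<Otimes>\<^sub>M arrays) rows"
        by (rule measurable_PiM_single') (auto simp: space_PiM)
      have [measurable]: "(\<lambda>p. fst p i) \<in> measurable (starts \<Otimes>\<^sub>M arrays) borel"
        using i by (intro measurable_compose[OF measurable_fst measurable_component_singleton]) auto
      show "(\<lambda>p. indicator G (fst p i, (\<lambda>j. snd p (i, j))) :: real) \<in> borel_measurable (starts \<Otimes>\<^sub>M arrays)"
        by measurable
    qed
    have F01: "0 \<le> F p" "F p \<le> 1" for p
      unfolding F_def by (auto intro!: prod_nonneg prod_le_1 simp: indicator_def)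
    interpret DX: prob_space "distr M starts XX" by (rule prob_space_distr) simp
    interpret DV: prob_space "distr M arrays VV" by (rule prob_space_distr) simp
    interpret P: pair_prob_space "distr M starts XX" "distr M arrays VV" ..
    have Fint: "integrable (distr M starts XX \<Otimes>\<^sub>M distr M arrays VV) F"
    proof (rule P.integrable_const_bound[of _ 1])
      show "F \<in> borel_measurable (distr M starts XX \<Otimes>\<^sub>M distr M arrays VV)"
        using F by (subst measurable_cong_sets[OF sets_pair_measure_cong[OF sets_distr sets_distr] refl])
    qed (use F01 in auto)
    have inner: "(\<integral>\<omega>. F (XX \<omega>', VV \<omega>) \<partial>M) = (\<Prod>i\<in>{1..n}. 1 - h (X i \<omega>'))" for \<omega>'
    proof -
      have "(\<integral>\<omega>. F (XX \<omega>', VV \<omega>) \<partial>M) = (\<integral>\<omega>. (\<Prod>i\<in>{1..n}. 1 - indicator G (X i \<omega>', row i \<omega>)) \<partial>M)"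
        by (intro Bochner_Integration.integral_cong refl) (auto simp: F_def intro!: prod.cong)
      also have "\<dots> = (\<Prod>i\<in>{1..n}. \<integral>\<omega>. 1 - indicator G (X i \<omega>', row i \<omega>) \<partial>M)"
      proof (rule indep_vars_lebesgue_integral)
        have "indep_vars (\<lambda>_. borel) (\<lambda>i \<omega>. 1 - indicator G (X i \<omega>', row i \<omega>) :: real) UNIV"
          by (rule indep_vars_compose2[OF rows_indep, of "\<lambda>i w. 1 - indicator G (X i \<omega>', w)"]) measurable
        then show "indep_vars (\<lambda>_. borel) (\<lambda>i \<omega>. 1 - indicator G (X i \<omega>', row i \<omega>) :: real) {1..n}"
          by (rule indep_vars_subset) simp
      qed (use int in auto)
      also have "\<dots> = (\<Prod>i\<in>{1..n}. 1 - h (X i \<omega>'))"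
        using int by (intro prod.cong refl) (simp add: h_row prob_space)
      finally show ?thesis .
    qed
    have "prob (?E n) = (\<integral>\<omega>. indicator (?E n) \<omega> \<partial>M)" by (simp add: Int_absorb2 del: Collect_mem_eq)
    also have "\<dots> = (\<integral>\<omega>. F (XX \<omega>, VV \<omega>) \<partial>M)"
    proof (intro Bochner_Integration.integral_cong refl)
      fix \<omega> assume "\<omega> \<in> space M"
      then show "indicator (?E n) \<omega> = F (XX \<omega>, VV \<omega>)"
        by (auto simp: F_def indicator_def intro!: prod.neutral[symmetric] prod_zero[symmetric])
    qed
    also have "\<dots> = (\<integral>p. F p \<partial>distr M (starts \<Otimes>\<^sub>M arrays) (\<lambda>\<omega>. (XX \<omega>, VV \<omega>)))"
      by (rule integral_distr[OF measurable_Pair[OF XX_measurable VV_measurable] F, symmetric])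
    also have "\<dots> = (\<integral>x. (\<integral>v. F (x, v) \<partial>distr M arrays VV) \<partial>distr M starts XX)"
      unfolding distr_XX_VV by (rule P.integral_fst'[OF Fint, symmetric])
    also have "\<dots> = (\<integral>\<omega>'. (\<integral>v. F (XX \<omega>', v) \<partial>distr M arrays VV) \<partial>M)"
    proof (subst integral_distr)
      have "(\<lambda>x. \<integral>v. F (x, v) \<partial>distr M arrays VV) \<in> borel_measurable (distr M starts XX)"
        using P.integrable_fst'[OF Fint] by (rule borel_measurable_integrable)
      then show "(\<lambda>x. \<integral>v. F (x, v) \<partial>distr M arrays VV) \<in> borel_measurable starts" by simp
    qed auto
    also have "\<dots> = (\<integral>\<omega>'. (\<integral>\<omega>. F (XX \<omega>', VV \<omega>) \<partial>M) \<partial>M)"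
    proof (intro Bochner_Integration.integral_cong refl)
      fix \<omega>' assume "\<omega>' \<in> space M"
      then have "XX \<omega>' \<in> space starts" using measurable_space[OF XX_measurable] by blast
      then have "(\<lambda>v. F (XX \<omega>', v)) \<in> borel_measurable arrays"
        by (rule measurable_compose[OF measurable_Pair1' F])
      then show "(\<integral>v. F (XX \<omega>', v) \<partial>distr M arrays VV) = (\<integral>\<omega>. F (XX \<omega>', VV \<omega>) \<partial>M)"
        by (subst integral_distr) auto
    qed
    finally show ?thesis unfolding inner .
  qed
  note ppp = X_poisson[unfolded homogeneous_poisson_def]
  have lf: "finite ((\<lambda>i. X i \<omega>) ` {1..} \<inter> B)" if "\<omega> \<in> space M" for \<omega>
    using locally_finite_Int[OF poisson_point_processD(2)[OF ppp that] B(2)] .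
  have lim1: "(\<lambda>n. prob (?E n)) \<longlonglongrightarrow> prob {\<omega>\<in>space M. \<forall>i\<ge>1. (X i \<omega>, row i \<omega>) \<notin> G}"
  proof -
    have "(\<lambda>n. prob (?E n)) \<longlonglongrightarrow> prob (\<Inter>n. ?E n)"
      by (rule finite_Lim_measure_decseq) (auto simp: decseq_def)
    also have "(\<Inter>n. ?E n) = {\<omega>\<in>space M. \<forall>i\<ge>1. (X i \<omega>, row i \<omega>) \<notin> G}"
    proof (intro equalityI subsetI)
      fix \<omega> assume *: "\<omega> \<in> (\<Inter>n. ?E n)"
      have "(X i \<omega>, row i \<omega>) \<notin> G" if "i \<ge> 1" for i
        using INT_D[OF *, of i] that by simp
      then show "\<omega> \<in> {\<omega>\<in>space M. \<forall>i\<ge>1. (X i \<omega>, row i \<omega>) \<notin> G}" using * by blast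
    qed auto
    finally show ?thesis .
  qed
  \<comment> \<open>Since \<open>h\<close> vanishes off \<open>B\<close>, only finitely many factors
    differ from 1. Distinctness of the starting points converts the product over indices into one
    over points.\<close>
  have prodlim: "(\<lambda>n. \<Prod>i\<in>{1..n}. 1 - h (X i \<omega>)) \<longlonglongrightarrow> (\<Prod>x\<in>(\<lambda>i. X i \<omega>) ` {1..} \<inter> B. 1 - h x)"
    if \<omega>: "\<omega> \<in> space M" for \<omega>
  proof -
    define J where "J = {i. i \<ge> 1 \<and> X i \<omega> \<in> B}"
    have injJ: "inj_on (\<lambda>i. X i \<omega>) J" using X_distinct[OF \<omega>] by (rule inj_on_subset) (auto simp: J_def)
    have imJ: "(\<lambda>i. X i \<omega>) ` J = (\<lambda>i. X i \<omega>) ` {1..} \<inter> B" by (auto simp: J_def)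
    have finJ: "finite J" using lf[OF \<omega>] imJ injJ finite_image_iff by metis
    have "(\<Prod>i\<in>{1..n}. 1 - h (X i \<omega>)) = (\<Prod>x\<in>(\<lambda>i. X i \<omega>) ` {1..} \<inter> B. 1 - h x)" if n: "n \<ge> Max (insert 1 J)" for n
    proof -
      have "J \<subseteq> {1..n}" using n finJ by (auto simp: J_def)
      then have "(\<Prod>i\<in>{1..n}. 1 - h (X i \<omega>)) = (\<Prod>i\<in>J. 1 - h (X i \<omega>))"
        by (intro prod.mono_neutral_right) (auto simp: J_def hB)
      also have "\<dots> = (\<Prod>x\<in>(\<lambda>i. X i \<omega>) ` J. 1 - h x)" using injJ by (simp add: prod.reindex)
      finally show ?thesis unfolding imJ .
    qed
    then show ?thesis
      by (intro tendsto_eventually) (auto simp: eventually_sequentially)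
  qed
  have lim2: "(\<lambda>n. \<integral>\<omega>. (\<Prod>i\<in>{1..n}. 1 - h (X i \<omega>)) \<partial>M) \<longlonglongrightarrow> (\<integral>\<omega>. (\<Prod>x\<in>(\<lambda>i. X i \<omega>) ` {1..} \<inter> B. 1 - h x) \<partial>M)"
  proof (rule integral_dominated_convergence[where w="\<lambda>_. 1"])
    show "(\<lambda>\<omega>. \<Prod>x\<in>(\<lambda>i. X i \<omega>) ` {1..} \<inter> B. 1 - h x) \<in> borel_measurable M"
      by (rule poisson_generating_functional(2)[OF ppp _ B h_meas h01]) simp
    show "(\<lambda>\<omega>. \<Prod>i\<in>{1..n}. 1 - h (X i \<omega>)) \<in> borel_measurable M" for n
      by (intro borel_measurable_prod) (auto intro!: measurable_compose[OF X_measurable h_meas])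
    show "AE \<omega> in M. norm (\<Prod>i\<in>{1..n}. 1 - h (X i \<omega>)) \<le> 1" for n
      using h01 by (intro AE_I2) (auto simp: abs_prod intro!: prod_le_1)
  qed (use prodlim in auto)
  have gf: "(\<integral>\<omega>. (\<Prod>x\<in>(\<lambda>i. X i \<omega>) ` {1..} \<inter> B. 1 - h x) \<partial>M) = exp (- (\<integral>x. indicator B x * h x \<partial>scale_measure (ennreal lam) lborel))"
    by (rule poisson_generating_functional(1)[OF ppp _ B h_meas h01]) simp
  have "(\<integral>x. indicator B x * h x \<partial>scale_measure (ennreal lam) lborel) = lam * (\<integral>\<omega>. measure lborel {x. (x, row 0 \<omega>) \<in> G} \<partial>M)"
  proof -
    interpret Q: pair_sigma_finite lborel M ..
    define G' where "G' = {p\<in>space (lborel \<Otimes>\<^sub>M M). (fst p, row 0 (snd p)) \<in> G}"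
    have G' [measurable]: "G' \<in> sets (lborel \<Otimes>\<^sub>M M)" unfolding G'_def by measurable
    have s1: "Pair x -` G' = {\<omega>\<in>space M. (x, row 0 \<omega>) \<in> G}" for x
      by (auto simp: G'_def space_pair_measure)
    have s2: "(\<lambda>x. (x, \<omega>)) -` G' = {x. (x, row 0 \<omega>) \<in> G}" if "\<omega> \<in> space M" for \<omega>
      using that by (auto simp: G'_def space_pair_measure)
    have hm: "ennreal (indicator B x * h x) = emeasure M (Pair x -` G')" for x
    proof -
      have [measurable]: "{\<omega>\<in>space M. (x, row 0 \<omega>) \<in> G} \<in> sets M" by measurable
      have "h x = (\<integral>\<omega>. indicator {\<omega>\<in>space M. (x, row 0 \<omega>) \<in> G} \<omega> \<partial>M)"
        unfolding h_def by (intro Bochner_Integration.integral_cong refl) (auto simp: indicator_def)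
      also have "\<dots> = prob {\<omega>\<in>space M. (x, row 0 \<omega>) \<in> G}" by (simp add: Int_absorb2 del: Collect_mem_eq)
      finally have "h x = prob {\<omega>\<in>space M. (x, row 0 \<omega>) \<in> G}" .
      then show ?thesis unfolding s1 emeasure_eq_measure using hB[of x] by (cases "x \<in> B") auto
    qed
    have "(\<integral>x. indicator B x * h x \<partial>scale_measure (ennreal lam) lborel) =
        enn2real (\<integral>\<^sup>+x. ennreal (indicator B x * h x) \<partial>scale_measure (ennreal lam) lborel)"
      by (rule integral_eq_nn_integral) (use h01 in auto)
    also have "(\<integral>\<^sup>+x. ennreal (indicator B x * h x) \<partial>scale_measure (ennreal lam) lborel) =
        ennreal lam * (\<integral>\<^sup>+x. emeasure M (Pair x -` G') \<partial>lborel)"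
      unfolding hm by (rule nn_integral_scale_measure) (rule measurable_emeasure_Pair[OF G'])
    also have "(\<integral>\<^sup>+x. emeasure M (Pair x -` G') \<partial>lborel) = emeasure (lborel \<Otimes>\<^sub>M M) G'"
      by (rule emeasure_pair_measure_alt[OF G', symmetric])
    also have "\<dots> = (\<integral>\<^sup>+\<omega>. emeasure lborel ((\<lambda>x. (x, \<omega>)) -` G') \<partial>M)"
      by (rule Q.emeasure_pair_measure_alt2[OF G'])
    also have "\<dots> = (\<integral>\<^sup>+\<omega>. ennreal (measure lborel {x. (x, row 0 \<omega>) \<in> G}) \<partial>M)"
    proof (rule nn_integral_cong_AE)
      show "AE \<omega> in M. emeasure lborel ((\<lambda>x. (x, \<omega>)) -` G') = ennreal (measure lborel {x. (x, row 0 \<omega>) \<in> G})"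
        using GB AE_space
      proof eventually_elim
        case (elim \<omega>)
        have "emeasure lborel {x. (x, row 0 \<omega>) \<in> G} \<le> emeasure lborel B"
          by (rule emeasure_mono) (use elim B in auto)
        also have "\<dots> < \<infinity>" using B by (intro emeasure_bounded_finite)
        finally show ?case using s2[OF elim(2)] by (simp add: emeasure_eq_ennreal_measure)
      qed
    qed
    also have "enn2real (ennreal lam * (\<integral>\<^sup>+\<omega>. ennreal (measure lborel {x. (x, row 0 \<omega>) \<in> G}) \<partial>M)) =
        lam * (\<integral>\<omega>. measure lborel {x. (x, row 0 \<omega>) \<in> G} \<partial>M)"
    proof -
      have "(\<lambda>\<omega>. measure lborel ((\<lambda>x. (x, \<omega>)) -` G')) \<in> borel_measurable M"
        using Q.measurable_emeasure_Pair2[OF G'] unfolding measure_def by measurable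
      then have "(\<lambda>\<omega>. measure lborel {x. (x, row 0 \<omega>) \<in> G}) \<in> borel_measurable M"
        by (subst measurable_cong[of M]) (use s2 in auto)
      then have "(\<integral>\<omega>. measure lborel {x. (x, row 0 \<omega>) \<in> G} \<partial>M) = enn2real (\<integral>\<^sup>+\<omega>. ennreal (measure lborel {x. (x, row 0 \<omega>) \<in> G}) \<partial>M)"
        by (intro integral_eq_nn_integral) auto
      then show ?thesis using lam_pos by (simp add: enn2real_mult)
    qed
    finally show ?thesis .
  qed
  then show ?thesis
    using LIMSEQ_unique[OF lim1[unfolded fin_n] lim2] gf by simp
qed

text \<open>The starting points from which a node with increments \<open>w\<close> hits some \<open>A k\<close> at the time \<open>t k * T\<close>.\<close>

definition swept :: "real \<Rightarrow> 'i set \<Rightarrow> ('i \<Rightarrow> real) \<Rightarrow> ('i \<Rightarrow> 'a set) \<Rightarrow> (nat \<Rightarrow> 'a) \<Rightarrow> 'a set" where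
  "swept T I t A w = {x. \<exists>k\<in>I. x + phase_disp 0 w (t k) + T *\<^sub>R phase_disp 1 w (t k) \<in> A k}"

lemma swept_measurable:
  assumes I: "finite I" and A: "\<And>k. k \<in> I \<Longrightarrow> A k \<in> sets borel"
  shows "{p. fst p \<in> swept T I t A (snd p)} \<in> sets (borel \<Otimes>\<^sub>M rows)"
proof -
  have [measurable]: "(\<lambda>p. phase_disp q (snd p) s) \<in> borel_measurable (borel \<Otimes>\<^sub>M rows)" for q s
    using phase_disp_measurable[of "\<lambda>j p. snd p j" "borel \<Otimes>\<^sub>M rows" "\<lambda>_. s" q] by simp
  have "Measurable.pred (borel \<Otimes>\<^sub>M rows) (\<lambda>p. \<exists>k\<in>I. fst p + phase_disp 0 (snd p) (t k) + T *\<^sub>R phase_disp 1 (snd p) (t k) \<in> A k)"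
  proof (intro pred_intros_finite I)
    fix k assume "k \<in> I"
    then have [measurable]: "A k \<in> sets borel" by (rule A)
    show "Measurable.pred (borel \<Otimes>\<^sub>M rows) (\<lambda>p. fst p + phase_disp 0 (snd p) (t k) + T *\<^sub>R phase_disp 1 (snd p) (t k) \<in> A k)"
      by measurable
  qed
  moreover have "space (borel \<Otimes>\<^sub>M rows) = (UNIV :: ('a \<times> (nat \<Rightarrow> 'a)) set)" by (simp add: space_pair_measure space_PiM)
  ultimately show ?thesis unfolding pred_def swept_def by (simp only: mem_Collect_eq UNIV_I simp_thms)
qed

text \<open>Avoiding all \<open>A k\<close> at the prescribed times is a single void event for the
  marked process, with the swept set as the forbidden region of starting points.\<close>

lemma node_void:
  assumes T: "T > 0" and I: "finite I" and A: "\<And>k. k \<in> I \<Longrightarrow> A k \<in> sets borel" "\<And>k. k \<in> I \<Longrightarrow> bounded (A k)"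
    and t: "\<And>k. k \<in> I \<Longrightarrow> t k \<in> {0..1}"
  shows "prob {\<omega>\<in>space M. \<forall>k\<in>I. nodes X V T (t k * T) \<omega> \<inter> A k = {}} =
      exp (- (lam * (\<integral>\<omega>. measure lborel (swept T I t A (row 0 \<omega>)) \<partial>M)))"
proof -
  have "bounded (\<Union>k\<in>I. A k)" using I A by (intro bounded_UN) auto
  then obtain R where R: "\<And>k x. k \<in> I \<Longrightarrow> x \<in> A k \<Longrightarrow> norm x \<le> R"
    by (auto simp: bounded_iff)
  let ?G = "{p. fst p \<in> swept T I t A (snd p)}"
  \<comment> \<open>Up to rescaled time 1 the slow part moves a node by at most 1 and the scaled
    fast part by at most \<open>T\<close>.\<close>
  have "AE \<omega> in M. \<forall>x. (x, row 0 \<omega>) \<in> ?G \<longrightarrow> x \<in> cball 0 (R + 1 + T)"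
    using AE_regular
  proof eventually_elim
    case (elim \<omega>)
    show ?case
    proof (intro allI impI)
      fix x assume "(x, row 0 \<omega>) \<in> ?G"
      then obtain k where k: "k \<in> I" "x + phase_disp 0 (row 0 \<omega>) (t k) + T *\<^sub>R phase_disp 1 (row 0 \<omega>) (t k) \<in> A k"
        by (auto simp: swept_def)
      let ?a = "phase_disp 0 (row 0 \<omega>) (t k)" and ?b = "T *\<^sub>R phase_disp 1 (row 0 \<omega>) (t k)"
      have tk: "0 \<le> t k" "t k \<le> 1" using t[OF k(1)] by auto
      have "norm ?a \<le> 1" using regular_path.norm_phase_disp[OF elim tk(1), of 0] tk by simp
      moreover have "norm ?b \<le> T * 1"
        using regular_path.norm_phase_disp[OF elim tk(1), of 1] tk T by (simp del: mult_1_right)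
      moreover have "norm (x + ?a + ?b) \<le> R" using R[OF k] .
      moreover have "norm x \<le> norm (x + ?a + ?b) + norm ?a + norm ?b"
      proof -
        have "x = (x + ?a + ?b) - (?a + ?b)" by simp
        then have "norm x \<le> norm (x + ?a + ?b) + norm (?a + ?b)" by (metis norm_triangle_ineq4)
        then show ?thesis using norm_triangle_ineq[of ?a ?b] by linarith
      qed
      ultimately show "x \<in> cball 0 (R + 1 + T)" by simp
    qed
  qed
  from marked_void[OF swept_measurable[OF I A(1)] _ _ this]
  have "prob {\<omega>\<in>space M. \<forall>i\<ge>1. (X i \<omega>, row i \<omega>) \<notin> ?G} = exp (- (lam * (\<integral>\<omega>. measure lborel (swept T I t A (row 0 \<omega>)) \<partial>M)))"
    by simp
  also have "{\<omega>\<in>space M. \<forall>i\<ge>1. (X i \<omega>, row i \<omega>) \<notin> ?G} = {\<omega>\<in>space M. \<forall>k\<in>I. nodes X V T (t k * T) \<omega> \<inter> A k = {}}"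
    by (auto simp: nodes_def position_phase_disp[OF T] swept_def)
  finally show ?thesis .
qed

text \<open>For one time the swept set is a translate of \<open>A k\<close>. Hence the one-time void
  probabilities of the nodes are those of intensity \<open>lam\<close> for every
  \<open>T\<close>.\<close>

lemma swept_single:
  assumes "A k \<in> sets borel"
  shows "measure lborel (swept T {k} t A w) = measure lborel (A k)"
  using emeasure_lborel_translation[OF assms, of "phase_disp 0 w (t k) + T *\<^sub>R phase_disp 1 w (t k)"]
  by (simp add: swept_def add.assoc measure_def)

end

abbreviation (input) unit_lborel :: "real measure" where
  "unit_lborel \<equiv> restrict_space lborel {0..1}"

lemma prob_space_unit_lborel: "prob_space unit_lborel"
  by (rule prob_space_restrict_space) auto

lemma sets_unit_lborel: "sets unit_lborel = sets (restrict_space borel {0..1})"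
  by (intro sets_restrict_space_cong) simp

lemma space_unit_lborel [simp]: "space unit_lborel = {0..1}"
  by (simp add: space_restrict_space)

section \<open>Asymptotics of the swept volumes\<close>

text \<open>Coincidences are excluded only if one of the two times is fast: during a slow leg the
  fast displacement is constant, so two times of the same slow leg always share it, and different
  slow legs are already covered by \<open>separated\<close>.\<close>

definition generic_times :: "'i set \<Rightarrow> ('i \<Rightarrow> real) \<Rightarrow> (nat \<Rightarrow> 'a::real_normed_vector) \<Rightarrow> bool" where
  "generic_times I t v \<longleftrightarrow> regular_path v \<and> (\<forall>k\<in>I. \<forall>j. t k \<noteq> arrival0 v (Suc j)) \<and>
     (\<forall>k\<in>I. \<forall>l\<in>I. k \<noteq> l \<longrightarrow> odd (leg v (t k)) \<longrightarrow> phase_disp 1 v (t k) \<noteq> phase_disp 1 v (t l))"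

text \<open>The analogue of the swept set for a slow leg that starts at time \<open>\<sigma>\<close> and has the increment \<open>u\<close>.\<close>

definition leg_shadow :: "'i set \<Rightarrow> ('i \<Rightarrow> real) \<Rightarrow> ('i \<Rightarrow> 'a::real_normed_vector set) \<Rightarrow> real \<Rightarrow> 'a \<Rightarrow> 'a set" where
  "leg_shadow I t A \<sigma> u = {x. \<exists>k\<in>I. \<sigma> \<le> t k \<and> t k \<le> \<sigma> + norm u \<and> x + ((t k - \<sigma>) / norm u) *\<^sub>R u \<in> A k}"

lemma leg_shadow_Union:
  "leg_shadow I t A \<sigma> u = (\<Union>k\<in>{k\<in>I. \<sigma> \<le> t k \<and> t k \<le> \<sigma> + norm u}. {x. x + ((t k - \<sigma>) / norm u) *\<^sub>R u \<in> A k})"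
  by (auto simp: leg_shadow_def)

lemma translate_borel [measurable]:
  fixes A :: "'a::euclidean_space set"
  shows "A \<in> sets borel \<Longrightarrow> {x. x + d \<in> A} \<in> sets borel"
  by (rule measurable_sets_borel[of "\<lambda>x. x + d", unfolded vimage_def]) auto

lemma generic_times_same_fast:
  assumes g: "generic_times I t v" and k: "k \<in> I" "l \<in> I" "k \<noteq> l"
    and eq: "phase_disp 1 v (t k) = phase_disp 1 v (t l)"
  shows "even (leg v (t k)) \<and> leg v (t k) = leg v (t l)"
proof -
  interpret regular_path v using g by (simp add: generic_times_def)
  have ev: "even (leg v (t k))" "even (leg v (t l))"
    using g k eq unfolding generic_times_def by metis+
  then have "leg_sum 1 v (leg v (t k)) = leg_sum 1 v (leg v (t l))"
    using eq[unfolded phase_disp_slow_leg(1)[OF ev(1)] phase_disp_slow_leg(1)[OF ev(2)]] by simp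
  then show ?thesis using ev separated by (metis linorder_neqE_nat)
qed

text \<open>Times of the same slow leg share their fast displacement, so their translates move
  together; all other pairs have distinct fast displacements and drift apart linearly in
  \<open>T\<close>. Once the groups are disjoint, translation invariance removes \<open>T\<close>,
  so the volume equals its limit from some \<open>T\<close> on.\<close>

lemma emeasure_swept_eventually:
  fixes v :: "nat \<Rightarrow> 'a::euclidean_space"
  assumes g: "generic_times I t v" and I: "finite I"
    and A: "\<And>k. k \<in> I \<Longrightarrow> A k \<in> sets borel" "\<And>k. k \<in> I \<Longrightarrow> bounded (A k)"
    and t: "\<And>k. k \<in> I \<Longrightarrow> t k \<in> {0..1}"
  shows "\<forall>\<^sub>F T in at_top. emeasure lborel {x. \<exists>k\<in>I. x + phase_disp 0 v (t k) + T *\<^sub>R phase_disp 1 v (t k) \<in> A k} =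
     (\<Sum>l. emeasure lborel (leg_shadow I t A (arrival0 v (2 * l)) (v (2 * l)))) +
     (\<Sum>k\<in>I. indicator (fast_times v) (t k) * emeasure lborel (A k))"
proof -
  interpret regular_path v using g by (simp add: generic_times_def)
  \<comment> \<open>Groups of times: a slow time is labelled by its leg, a fast time forms a group
    of its own.\<close>
  define key where "key k = (if even (leg v (t k)) then Inl (leg v (t k)) else Inr k)" for k
  define U where "U T c = {x. \<exists>k\<in>I. key k = c \<and> x + phase_disp 0 v (t k) + T *\<^sub>R phase_disp 1 v (t k) \<in> A k}" for T c
  let ?S = "\<lambda>T. {x. \<exists>k\<in>I. x + phase_disp 0 v (t k) + T *\<^sub>R phase_disp 1 v (t k) \<in> A k}"
  have Ub: "U T c \<in> sets borel" for T c
  proof -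
    have "U T c = (\<Union>k\<in>{k\<in>I. key k = c}. {x. x + (phase_disp 0 v (t k) + T *\<^sub>R phase_disp 1 v (t k)) \<in> A k})"
      by (auto simp: U_def add.assoc)
    then show ?thesis using I by (auto intro!: sets.finite_UN translate_borel A)
  qed
  have tt: "0 \<le> t k" "\<And>j. t k \<noteq> arrival0 v (Suc j)" if "k \<in> I" for k
    using t[OF that] g that by (auto simp: generic_times_def)
  have "bounded (\<Union>k\<in>I. A k)" using I A by (intro bounded_UN) auto
  then obtain R where R: "\<And>k x. k \<in> I \<Longrightarrow> x \<in> A k \<Longrightarrow> norm x \<le> R"
    by (auto simp: bounded_iff)
  have apart: "\<forall>\<^sub>F T in at_top. key k \<noteq> key l \<longrightarrow>
      {x. x + phase_disp 0 v (t k) + T *\<^sub>R phase_disp 1 v (t k) \<in> A k} \<inter>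
      {x. x + phase_disp 0 v (t l) + T *\<^sub>R phase_disp 1 v (t l) \<in> A l} = {}" if kl: "k \<in> I" "l \<in> I" for k l
  proof (cases "key k = key l")
    case False
    define w where "w = phase_disp 1 v (t k) - phase_disp 1 v (t l)"
    have "w \<noteq> 0"
    proof
      assume "w = 0"
      then have "phase_disp 1 v (t k) = phase_disp 1 v (t l)" by (simp only: w_def right_minus_eq)
      moreover have "k \<noteq> l" using False by blast
      ultimately have "even (leg v (t k)) \<and> leg v (t k) = leg v (t l)"
        by (intro generic_times_same_fast[OF g kl])
      then have "even (leg v (t k))" "even (leg v (t l))" "leg v (t k) = leg v (t l)" by metis+
      then have "key k = key l" unfolding key_def by (simp only: if_True)
      then show False using False by simp
    qed
    \<comment> \<open>A common starting point would give two positions in the ball of radius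
      \<open>R\<close> whose slow parts have norm at most 1, hence
      \<open>T * norm w \<le> 2 * R + 2\<close>.\<close>
    have "\<forall>\<^sub>F T in at_top. T > (2 * R + 2) / norm w" by (rule eventually_gt_at_top)
    moreover have "\<forall>\<^sub>F T in at_top. T > (0::real)" by (rule eventually_gt_at_top)
    ultimately show ?thesis
    proof eventually_elim
      case (elim T)
      have False if "x + phase_disp 0 v (t k) + T *\<^sub>R phase_disp 1 v (t k) \<in> A k"
        "x + phase_disp 0 v (t l) + T *\<^sub>R phase_disp 1 v (t l) \<in> A l" for x
      proof -
        let ?a = "x + phase_disp 0 v (t k) + T *\<^sub>R phase_disp 1 v (t k)"
        let ?b = "x + phase_disp 0 v (t l) + T *\<^sub>R phase_disp 1 v (t l)"
        have "T *\<^sub>R w = (?a - ?b) - (phase_disp 0 v (t k) - phase_disp 0 v (t l))"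
          by (simp add: w_def algebra_simps)
        then have "norm (T *\<^sub>R w) \<le> norm (?a - ?b) + norm (phase_disp 0 v (t k) - phase_disp 0 v (t l))"
          by (simp only: norm_triangle_ineq4)
        also have "\<dots> \<le> (norm ?a + norm ?b) + (norm (phase_disp 0 v (t k)) + norm (phase_disp 0 v (t l)))"
          by (intro add_mono norm_triangle_ineq4)
        also have "\<dots> \<le> (R + R) + (1 + 1)"
          using R[OF kl(1) that(1)] R[OF kl(2) that(2)] norm_phase_disp[of "t k" 0] norm_phase_disp[of "t l" 0]
            t[OF kl(1)] t[OF kl(2)] by (intro add_mono) auto
        finally have "T * norm w \<le> 2 * R + 2" using elim(2) by simp
        then show False using elim(1) \<open>w \<noteq> 0\<close> by (simp add: field_simps)
      qed
      then show ?case by blast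
    qed
  qed simp
  have "\<forall>\<^sub>F T in at_top. \<forall>k\<in>I. \<forall>l\<in>I. key k \<noteq> key l \<longrightarrow>
      {x. x + phase_disp 0 v (t k) + T *\<^sub>R phase_disp 1 v (t k) \<in> A k} \<inter>
      {x. x + phase_disp 0 v (t l) + T *\<^sub>R phase_disp 1 v (t l) \<in> A l} = {}"
    by (intro eventually_ball_finite[OF I] ballI apart)
  then show ?thesis
  proof eventually_elim
    case (elim T)
    have disj: "disjoint_family_on (U T) (key ` I)"
      unfolding disjoint_family_on_def
    proof (intro ballI impI equals0I)
      fix c c' x assume "c \<noteq> c'" "x \<in> U T c \<inter> U T c'"
      then obtain k l where kl: "k \<in> I" "l \<in> I" "key k \<noteq> key l"
        and x: "x + phase_disp 0 v (t k) + T *\<^sub>R phase_disp 1 v (t k) \<in> A k"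
          "x + phase_disp 0 v (t l) + T *\<^sub>R phase_disp 1 v (t l) \<in> A l"
        unfolding U_def by blast
      from elim kl have "{x. x + phase_disp 0 v (t k) + T *\<^sub>R phase_disp 1 v (t k) \<in> A k} \<inter>
          {x. x + phase_disp 0 v (t l) + T *\<^sub>R phase_disp 1 v (t l) \<in> A l} = {}" by blast
      with x show False by blast
    qed
    define L where "L = {l. \<exists>k\<in>I. leg v (t k) = 2 * l}"
    define Od where "Od = {k\<in>I. odd (leg v (t k))}"
    have LI: "L \<subseteq> (\<lambda>k. leg v (t k) div 2) ` I"
    proof
      fix l assume "l \<in> L"
      then obtain k where "k \<in> I" "leg v (t k) = 2 * l" by (auto simp: L_def)
      then show "l \<in> (\<lambda>k. leg v (t k) div 2) ` I" by (intro image_eqI[of _ _ k]) auto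
    qed
    have fin: "finite L" "finite Od" using I LI finite_subset by (auto simp: Od_def)
    have keyI: "key ` I = (\<lambda>l. Inl (2 * l)) ` L \<union> Inr ` Od"
    proof (intro equalityI subsetI)
      fix c assume "c \<in> key ` I"
      then obtain k where k: "k \<in> I" "c = key k" by blast
      show "c \<in> (\<lambda>l. Inl (2 * l)) ` L \<union> Inr ` Od"
      proof (cases "even (leg v (t k))")
        case True
        then have "leg v (t k) = 2 * (leg v (t k) div 2)" by simp
        then have "leg v (t k) div 2 \<in> L" using k(1) unfolding L_def by blast
        then show ?thesis using k True by (intro UnI1 image_eqI[of _ _ "leg v (t k) div 2"]) (auto simp: key_def)
      qed (use k in \<open>auto simp: key_def Od_def\<close>)
    next
      fix c assume "c \<in> (\<lambda>l. Inl (2 * l)) ` L \<union> Inr ` Od"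
      then consider l k where "c = Inl (2 * l)" "k \<in> I" "leg v (t k) = 2 * l"
        | k where "c = Inr k" "k \<in> I" "odd (leg v (t k))"
        by (auto simp: L_def Od_def)
      then show "c \<in> key ` I"
      proof cases
        case (1 l k)
        then show ?thesis by (intro image_eqI[of _ _ k]) (auto simp: key_def)
      next
        case (2 k)
        then show ?thesis by (intro image_eqI[of _ _ k]) (auto simp: key_def)
      qed
    qed
    have slow: "emeasure lborel (U T (Inl (2 * l))) = emeasure lborel (leg_shadow I t A (arrival0 v (2 * l)) (v (2 * l)))" for l
    proof -
      have kl: "key k = Inl (2 * l) \<longleftrightarrow> leg v (t k) = 2 * l" for k by (auto simp: key_def)
      have iv: "arrival0 v (2 * l) \<le> t k \<and> t k \<le> arrival0 v (2 * l) + norm (v (2 * l)) \<longleftrightarrow> leg v (t k) = 2 * l" if "k \<in> I" for k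
        using slow_interval_iff[OF tt[OF that], of "2 * l"] by simp
      \<comment> \<open>Displacement at the start of the slow leg, common to all its times; shifting
        by \<open>d\<close> turns the group into the shadow of the leg.\<close>
      define d where "d = leg_sum 0 v (2 * l) + T *\<^sub>R leg_sum 1 v (2 * l)"
      have "x + phase_disp 0 v (t k) + T *\<^sub>R phase_disp 1 v (t k) =
          (x + d) + ((t k - arrival0 v (2 * l)) / norm (v (2 * l))) *\<^sub>R v (2 * l)" if "leg v (t k) = 2 * l" for x k
        using phase_disp_slow_leg[of "t k"] that by (simp add: d_def algebra_simps)
      then have "key k = Inl (2 * l) \<and> x + phase_disp 0 v (t k) + T *\<^sub>R phase_disp 1 v (t k) \<in> A k \<longleftrightarrow>
          arrival0 v (2 * l) \<le> t k \<and> t k \<le> arrival0 v (2 * l) + norm (v (2 * l)) \<and>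
          (x + d) + ((t k - arrival0 v (2 * l)) / norm (v (2 * l))) *\<^sub>R v (2 * l) \<in> A k" if "k \<in> I" for x k
        unfolding kl iv[OF that, symmetric] conj_assoc[symmetric] using iv[OF that] by (metis (no_types))
      then have eq: "U T (Inl (2 * l)) = {x. x + d \<in> leg_shadow I t A (arrival0 v (2 * l)) (v (2 * l))}"
        unfolding U_def leg_shadow_def by (simp cong: bex_cong)
      have "leg_shadow I t A \<sigma> u \<in> sets borel" for \<sigma> u
        unfolding leg_shadow_Union using I by (auto intro!: sets.finite_UN translate_borel A)
      then show ?thesis unfolding eq by (rule emeasure_lborel_translation)
    qed
    have fast: "emeasure lborel (U T (Inr k)) = emeasure lborel (A k)" if k: "k \<in> Od" for k
    proof -
      have "key l = Inr k \<longleftrightarrow> l = k" for l using k by (auto simp: key_def Od_def)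
      then have "U T (Inr k) = {x. x + (phase_disp 0 v (t k) + T *\<^sub>R phase_disp 1 v (t k)) \<in> A k}"
        using k by (auto simp: U_def Od_def add.assoc)
      then show ?thesis using emeasure_lborel_translation[OF A(1)] k by (simp add: Od_def)
    qed
    \<comment> \<open>Legs that contain none of the times cast no shadow, so the series over all
      slow legs is a finite sum.\<close>
    have empty: "leg_shadow I t A (arrival0 v (2 * l)) (v (2 * l)) = {}" if "l \<notin> L" for l
    proof -
      have "\<not> (arrival0 v (2 * l) \<le> t k \<and> t k \<le> arrival0 v (2 * l) + norm (v (2 * l)))" if "k \<in> I" for k
        using slow_interval_iff[OF tt[OF that], of "2 * l"] \<open>l \<notin> L\<close> that by (auto simp: L_def)
      then show ?thesis unfolding leg_shadow_def by blast
    qed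
    have "?S T = (\<Union>c\<in>key ` I. U T c)" unfolding U_def by blast
    then have "emeasure lborel (?S T) = (\<Sum>c\<in>key ` I. emeasure lborel (U T c))"
      using sum_emeasure[of "U T" "key ` I" lborel] disj Ub I by (simp add: image_subset_iff)
    also have "\<dots> = (\<Sum>c\<in>(\<lambda>l. Inl (2 * l)) ` L. emeasure lborel (U T c)) + (\<Sum>c\<in>Inr ` Od. emeasure lborel (U T c))"
      unfolding keyI using fin by (intro sum.union_disjoint) auto
    also have "(\<Sum>c\<in>(\<lambda>l. Inl (2 * l)) ` L. emeasure lborel (U T c)) = (\<Sum>l\<in>L. emeasure lborel (leg_shadow I t A (arrival0 v (2 * l)) (v (2 * l))))"
      by (subst sum.reindex) (auto simp: inj_on_def slow)
    also have "\<dots> = (\<Sum>l. emeasure lborel (leg_shadow I t A (arrival0 v (2 * l)) (v (2 * l))))"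
      by (rule suminf_finite[symmetric]) (use fin empty in auto)
    also have "(\<Sum>c\<in>Inr ` Od. emeasure lborel (U T c)) = (\<Sum>k\<in>Od. emeasure lborel (A k))"
      by (subst sum.reindex) (auto simp: inj_on_def fast)
    also have "\<dots> = (\<Sum>k\<in>I. indicator (fast_times v) (t k) * emeasure lborel (A k))"
      by (rule sum.mono_neutral_cong_left)
        (use I fast_times_iff[OF tt] in \<open>auto simp: Od_def indicator_def\<close>)
    finally show ?case .
  qed
qed

section \<open>Almost all tuples of times are generic\<close>

lemma AE_unit_lborel_countable:
  assumes "countable S" shows "AE t in unit_lborel. t \<notin> S"
proof -
  have "AE t in lborel. t \<notin> S"
    by (rule AE_not_in) (rule countable_imp_null_set_lborel[OF assms])
  then show ?thesis by (subst AE_restrict_space_iff) (auto elim: eventually_mono)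
qed

context mobility begin

text \<open>Fubini: for a fixed regular path and fixed \<open>s\<close>, the exceptional
  \<open>t\<close> form a countable set.\<close>

lemma nn_integral_fast_coincidence:
  "(\<integral>\<^sup>+t. emeasure M {\<omega>\<in>space M. odd (leg (row 0 \<omega>) t) \<and> phase_disp 1 (row 0 \<omega>) t = phase_disp 1 (row 0 \<omega>) s} \<partial>unit_lborel) = 0"
proof -
  interpret U: prob_space unit_lborel by (rule prob_space_unit_lborel)
  interpret Q: pair_sigma_finite unit_lborel M ..
  define D where "D = {p\<in>space (unit_lborel \<Otimes>\<^sub>M M). odd (leg (row 0 (snd p)) (fst p)) \<and>
      phase_disp 1 (row 0 (snd p)) (fst p) = phase_disp 1 (row 0 (snd p)) s}"
  have [measurable]: "fst \<in> borel_measurable (unit_lborel \<Otimes>\<^sub>M M)"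
    by (rule measurable_compose[OF measurable_fst]) (rule measurable_restrict_space1, simp)
  have D: "D \<in> sets (unit_lborel \<Otimes>\<^sub>M M)" unfolding D_def by measurable
  have "(\<integral>\<^sup>+t. emeasure M {\<omega>\<in>space M. odd (leg (row 0 \<omega>) t) \<and> phase_disp 1 (row 0 \<omega>) t = phase_disp 1 (row 0 \<omega>) s} \<partial>unit_lborel) =
     (\<integral>\<^sup>+t. emeasure M (Pair t -` D) \<partial>unit_lborel)"
    by (intro nn_integral_cong arg_cong[where f="emeasure M"]) (auto simp: D_def space_pair_measure)
  also have "\<dots> = emeasure (unit_lborel \<Otimes>\<^sub>M M) D" by (rule emeasure_pair_measure_alt[OF D, symmetric])
  also have "\<dots> = (\<integral>\<^sup>+\<omega>. emeasure unit_lborel ((\<lambda>t. (t, \<omega>)) -` D) \<partial>M)" by (rule Q.emeasure_pair_measure_alt2[OF D])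
  also have "\<dots> = (\<integral>\<^sup>+\<omega>. 0 \<partial>M)"
  proof (rule nn_integral_cong_AE)
    show "AE \<omega> in M. emeasure unit_lborel ((\<lambda>t. (t, \<omega>)) -` D) = 0"
      using AE_regular
    proof eventually_elim
      case (elim \<omega>)
      interpret regular_path "row 0 \<omega>" by (rule elim)
      have "AE t in unit_lborel. t \<notin> {t. odd (leg (row 0 \<omega>) t) \<and> phase_disp 1 (row 0 \<omega>) t = phase_disp 1 (row 0 \<omega>) s}"
        by (rule AE_unit_lborel_countable[OF countable_fast_coincidence])
      then have "AE t in unit_lborel. t \<notin> (\<lambda>t. (t, \<omega>)) -` D"
        by eventually_elim (auto simp: D_def)
      then have "emeasure unit_lborel {t \<in> space unit_lborel. t \<in> (\<lambda>t. (t, \<omega>)) -` D} = 0"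
        by (rule emeasure_eq_0_AE)
      moreover have "(\<lambda>t. (t, \<omega>)) -` D \<subseteq> space unit_lborel" by (rule sets.sets_into_space[OF sets_Pair2[OF D]])
      then have "{t \<in> space unit_lborel. t \<in> (\<lambda>t. (t, \<omega>)) -` D} = (\<lambda>t. (t, \<omega>)) -` D" by blast
      ultimately show ?case by (simp only:)
    qed
  qed
  finally show ?thesis by simp
qed

lemma AE_not_arrival:
  "AE t in unit_lborel. AE \<omega> in M. \<forall>j. t \<noteq> arrival0 (row 0 \<omega>) (Suc j)"
proof -
  interpret U: prob_space unit_lborel by (rule prob_space_unit_lborel)
  interpret Q: pair_sigma_finite unit_lborel M ..
  have [measurable]: "fst \<in> borel_measurable (unit_lborel \<Otimes>\<^sub>M M)"
    by (rule measurable_compose[OF measurable_fst]) (rule measurable_restrict_space1, simp)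
  have [measurable]: "(\<lambda>p. arrival0 (row 0 (snd p)) n) \<in> borel_measurable (unit_lborel \<Otimes>\<^sub>M M)" for n
    by (rule arrival0_measurable) (auto intro: measurable_compose[OF measurable_snd V_measurable])
  have "AE \<omega> in M. AE t in unit_lborel. \<forall>j. t \<noteq> arrival0 (row 0 \<omega>) (Suc j)"
  proof (rule AE_I2)
    fix \<omega>
    have "AE t in unit_lborel. t \<notin> range (\<lambda>j. arrival0 (row 0 \<omega>) (Suc j))"
      by (rule AE_unit_lborel_countable) simp
    then show "AE t in unit_lborel. \<forall>j. t \<noteq> arrival0 (row 0 \<omega>) (Suc j)" by eventually_elim auto
  qed
  moreover have "{p\<in>space (unit_lborel \<Otimes>\<^sub>M M). fst p \<noteq> arrival0 (row 0 (snd p)) n} \<in> sets (unit_lborel \<Otimes>\<^sub>M M)" for n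
    by measurable
  then have "{p\<in>space (unit_lborel \<Otimes>\<^sub>M M). \<forall>j. fst p \<noteq> arrival0 (row 0 (snd p)) (Suc j)} \<in> sets (unit_lborel \<Otimes>\<^sub>M M)"
    by (intro sets.sets_Collect_countable_All)
  ultimately show ?thesis
    using Q.AE_commute[of "\<lambda>t \<omega>. \<forall>j. t \<noteq> arrival0 (row 0 \<omega>) (Suc j)"] by blast
qed

text \<open>Finitely many conditions on single times and on pairs. The quantifiers stay in the order
  times first, path second, because the limit theorem is applied at fixed times.\<close>

lemma AE_generic_times:
  assumes I: "finite I"
  shows "AE t in PiM I (\<lambda>_. unit_lborel). AE \<omega> in M. generic_times I t (row 0 \<omega>)"
proof -
  interpret U: prob_space unit_lborel by (rule prob_space_unit_lborel)
  interpret PS: product_prob_space "\<lambda>_. unit_lborel" I ..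
  let ?P = "PiM I (\<lambda>_. unit_lborel)"
  have comp [measurable]: "(\<lambda>t. t k) \<in> borel_measurable ?P" if "k \<in> I" for k
    by (rule measurable_compose[OF measurable_component_singleton[OF that]]) (rule measurable_restrict_space1, simp)
  have 1: "AE t in ?P. AE \<omega> in M. \<forall>j. t k \<noteq> arrival0 (row 0 \<omega>) (Suc j)" if "k \<in> I" for k
    by (rule AE_PiM_component[OF _ that AE_not_arrival]) (rule prob_space_unit_lborel)
  have 2: "AE t in ?P. AE \<omega> in M. odd (leg (row 0 \<omega>) (t k)) \<longrightarrow> phase_disp 1 (row 0 \<omega>) (t k) \<noteq> phase_disp 1 (row 0 \<omega>) (t l)"
    if kl: "k \<in> I" "l \<in> I" "k \<noteq> l" for k l
  proof -
    define f where "f t = emeasure M {\<omega>\<in>space M. odd (leg (row 0 \<omega>) (t k)) \<and> phase_disp 1 (row 0 \<omega>) (t k) = phase_disp 1 (row 0 \<omega>) (t l)}" for t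
    have f [measurable]: "f \<in> borel_measurable ?P"
    proof -
      define D where "D = {p\<in>space (?P \<Otimes>\<^sub>M M). odd (leg (row 0 (snd p)) (fst p k)) \<and>
          phase_disp 1 (row 0 (snd p)) (fst p k) = phase_disp 1 (row 0 (snd p)) (fst p l)}"
      have [measurable]: "(\<lambda>p. fst p k) \<in> borel_measurable (?P \<Otimes>\<^sub>M M)" "(\<lambda>p. fst p l) \<in> borel_measurable (?P \<Otimes>\<^sub>M M)"
        using kl by (auto intro!: measurable_compose[OF measurable_fst comp])
      have D: "D \<in> sets (?P \<Otimes>\<^sub>M M)" unfolding D_def by measurable
      have "f t = emeasure M (Pair t -` D)" if "t \<in> space ?P" for t
        unfolding f_def using that by (intro arg_cong[where f="emeasure M"]) (auto simp: D_def space_pair_measure)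
      then show ?thesis using measurable_emeasure_Pair[OF D] by (subst measurable_cong) auto
    qed
    have "(\<integral>\<^sup>+t. f t \<partial>?P) = (\<integral>\<^sup>+t. f t \<partial>PiM (insert k (I - {k})) (\<lambda>_. unit_lborel))"
      using kl by (simp add: insert_absorb)
    \<comment> \<open>Only coordinate \<open>k\<close> is integrated in the inner integral;
      \<open>t l\<close> is fixed there and plays the part of \<open>s\<close>.\<close>
    also have "\<dots> = (\<integral>\<^sup>+x. (\<integral>\<^sup>+y. f (x(k := y)) \<partial>unit_lborel) \<partial>PiM (I - {k}) (\<lambda>_. unit_lborel))"
      by (rule PS.product_nn_integral_insert) (use I kl f in \<open>auto simp: insert_absorb\<close>)
    also have "\<dots> = (\<integral>\<^sup>+x. 0 \<partial>PiM (I - {k}) (\<lambda>_. unit_lborel))"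
      using kl nn_integral_fast_coincidence by (intro nn_integral_cong) (simp add: f_def)
    finally have "(\<integral>\<^sup>+t. f t \<partial>?P) = 0" by simp
    then have "AE t in ?P. f t = 0" by (subst (asm) nn_integral_0_iff_AE) auto
    then show ?thesis
      using AE_space
    proof eventually_elim
      case (elim t)
      have "{\<omega>\<in>space M. odd (leg (row 0 \<omega>) (t k)) \<and> phase_disp 1 (row 0 \<omega>) (t k) = phase_disp 1 (row 0 \<omega>) (t l)} \<in> sets M"
        by measurable
      then show ?case using elim(1) by (intro AE_I[OF _ elim(1)[unfolded f_def]]) auto
    qed
  qed
  have "AE t in ?P. \<forall>k\<in>I. AE \<omega> in M. \<forall>j. t k \<noteq> arrival0 (row 0 \<omega>) (Suc j)"
    using 1 I by (subst AE_ball_countable) (auto intro: countable_finite)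
  moreover have "AE t in ?P. \<forall>k\<in>I. \<forall>l\<in>I - {k}. AE \<omega> in M. odd (leg (row 0 \<omega>) (t k)) \<longrightarrow> phase_disp 1 (row 0 \<omega>) (t k) \<noteq> phase_disp 1 (row 0 \<omega>) (t l)"
    using 2 I by (intro AE_ball_countable[THEN iffD2] ballI countable_finite) auto
  ultimately show ?thesis
  proof eventually_elim
    case (elim t)
    have "AE \<omega> in M. \<forall>k\<in>I. \<forall>j. t k \<noteq> arrival0 (row 0 \<omega>) (Suc j)"
      using elim(1) I by (subst AE_ball_countable) (auto intro: countable_finite)
    moreover have "AE \<omega> in M. \<forall>k\<in>I. \<forall>l\<in>I - {k}. odd (leg (row 0 \<omega>) (t k)) \<longrightarrow> phase_disp 1 (row 0 \<omega>) (t k) \<noteq> phase_disp 1 (row 0 \<omega>) (t l)"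
      using elim(2) I by (intro AE_ball_countable[THEN iffD2] ballI countable_finite) auto
    ultimately show ?case using AE_regular
      by eventually_elim (auto simp: generic_times_def)
  qed
qed

end

section \<open>The birth-and-death process\<close>

lemma sets_slow_start_measure [simp, measurable_cong]: "sets (slow_start_measure M v) = sets borel"
  unfolding slow_start_measure_def using sets.sigma_sets_eq[of borel] by simp

lemma space_slow_start_measure [simp]: "space (slow_start_measure M v) = UNIV"
  using sets_eq_imp_space_eq[OF sets_slow_start_measure] by simp

lemma leg_shadow_pair_borel:
  fixes A :: "'i \<Rightarrow> 'a::euclidean_space set"
  assumes I: "finite I" and A: "\<And>k. k \<in> I \<Longrightarrow> A k \<in> sets borel"
  shows "{p. fst p \<in> leg_shadow I t A (fst (snd p)) (snd (snd p))} \<in> sets borel"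
proof -
  have "Measurable.pred (borel \<Otimes>\<^sub>M (borel \<Otimes>\<^sub>M borel)) (\<lambda>p::'a \<times> real \<times> 'a. \<exists>k\<in>I. fst (snd p) \<le> t k \<and>
      t k \<le> fst (snd p) + norm (snd (snd p)) \<and>
      fst p + ((t k - fst (snd p)) / norm (snd (snd p))) *\<^sub>R snd (snd p) \<in> A k)"
  proof (intro pred_intros_finite I)
    fix k assume "k \<in> I"
    then have [measurable]: "A k \<in> sets borel" by (rule A)
    show "Measurable.pred (borel \<Otimes>\<^sub>M (borel \<Otimes>\<^sub>M borel)) (\<lambda>p::'a \<times> real \<times> 'a. fst (snd p) \<le> t k \<and>
      t k \<le> fst (snd p) + norm (snd (snd p)) \<and>
      fst p + ((t k - fst (snd p)) / norm (snd (snd p))) *\<^sub>R snd (snd p) \<in> A k)"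
      by measurable
  qed
  then show ?thesis by (simp add: pred_def leg_shadow_def borel_prod)
qed

context mobility begin

abbreviation \<nu> :: "real measure" where "\<nu> \<equiv> slow_start_measure M (V 0)"

abbreviation arr :: "nat \<Rightarrow> 'w \<Rightarrow> real" where "arr n \<omega> \<equiv> arrival0 (row 0 \<omega>) n"

lemma arr_measurable [measurable]: "arr n \<in> borel_measurable M"
  by (rule arrival0_measurable) simp

text \<open>Campbell's formula: \<nu> is the image of counting measure times \<open>M\<close> under
  the map to the start of the slow leg with the given number.\<close>

lemma nn_integral_slow_start_measure:
  assumes f [measurable]: "f \<in> borel_measurable borel"
  shows "(\<integral>\<^sup>+\<sigma>. f \<sigma> \<partial>\<nu>) = (\<Sum>j. \<integral>\<^sup>+\<omega>. f (arr (2 * j) \<omega>) \<partial>M)"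
proof -
  interpret C: sigma_finite_measure "count_space (UNIV :: nat set)"
    by (rule sigma_finite_measure_count_space)
  let ?C = "count_space (UNIV :: nat set) \<Otimes>\<^sub>M M"
  have [measurable]: "(\<lambda>p. arr (2 * fst p) (snd p)) \<in> measurable ?C borel"
    by (rule measurable_pair_measure_countable1) auto
  have eq: "\<nu> = distr ?C borel (\<lambda>p. arr (2 * fst p) (snd p))"
  proof (rule measure_eqI)
    fix A assume "A \<in> sets \<nu>"
    then have A [measurable]: "A \<in> sets borel" by simp
    have "emeasure (distr ?C borel (\<lambda>p. arr (2 * fst p) (snd p))) A = (\<integral>\<^sup>+p. indicator A p \<partial>distr ?C borel (\<lambda>p. arr (2 * fst p) (snd p)))"
      by simp
    also have "\<dots> = (\<integral>\<^sup>+p. indicator A (arr (2 * fst p) (snd p)) \<partial>?C)"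
      by (rule nn_integral_distr) auto
    also have "\<dots> = (\<integral>\<^sup>+j. \<integral>\<^sup>+\<omega>. indicator A (arr (2 * j) \<omega>) \<partial>M \<partial>count_space UNIV)"
      by (subst nn_integral_fst[symmetric]) auto
    also have "\<dots> = (\<Sum>j. \<integral>\<^sup>+\<omega>. indicator A (arr (2 * j) \<omega>) \<partial>M)"
      by (rule nn_integral_count_space_nat)
    also have "\<dots> = (\<integral>\<^sup>+\<omega>. (\<Sum>j. indicator A (arr (2 * j) \<omega>)) \<partial>M)"
      by (rule nn_integral_suminf[symmetric]) measurable
    also have "\<dots> = emeasure \<nu> A"
      by (rule emeasure_slow_start_measure[symmetric]) auto
    finally show "emeasure \<nu> A = emeasure (distr ?C borel (\<lambda>p. arr (2 * fst p) (snd p))) A" by simp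
  qed simp
  have "(\<integral>\<^sup>+\<sigma>. f \<sigma> \<partial>\<nu>) = (\<integral>\<^sup>+p. f (arr (2 * fst p) (snd p)) \<partial>?C)"
    unfolding eq by (rule nn_integral_distr) auto
  also have "\<dots> = (\<integral>\<^sup>+j. \<integral>\<^sup>+\<omega>. f (arr (2 * j) \<omega>) \<partial>M \<partial>count_space UNIV)"
    by (subst nn_integral_fst[symmetric]) auto
  also have "\<dots> = (\<Sum>j. \<integral>\<^sup>+\<omega>. f (arr (2 * j) \<omega>) \<partial>M)"
    by (rule nn_integral_count_space_nat)
  finally show ?thesis .
qed

text \<open>The indicator of \<open>arr (2 * j) \<le> 1\<close> is at most
  \<open>exp 1 * exp (- arr (2 * j))\<close>, and the means of the latter form a geometric series of
  ratio \<open>lap\<close> squared.\<close>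

lemma sum_slow_starts_finite: "(\<Sum>j. emeasure M {\<omega>\<in>space M. arr (2 * j) \<omega> \<le> 1}) < \<infinity>"
proof -
  have le: "emeasure M {\<omega>\<in>space M. arr (2 * j) \<omega> \<le> 1} \<le> ennreal (exp 1 * (lap\<^sup>2) ^ j)" for j
  proof -
    have "prob {\<omega>\<in>space M. arr (2 * j) \<omega> \<le> 1} = (\<integral>\<omega>. indicator {\<omega>\<in>space M. arr (2 * j) \<omega> \<le> 1} \<omega> \<partial>M)"
      by (simp add: Int_absorb2 del: Collect_mem_eq)
    also have "\<dots> \<le> (\<integral>\<omega>. exp 1 * exp (- arr (2 * j) \<omega>) \<partial>M)"
    proof (rule integral_mono)
      show "integrable M (\<lambda>\<omega>. exp 1 * exp (- arr (2 * j) \<omega>))"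
        by (intro integrable_mult_right integrable_exp_arrival0)
      fix \<omega>
      show "indicator {\<omega>\<in>space M. arr (2 * j) \<omega> \<le> 1} \<omega> \<le> exp 1 * exp (- arr (2 * j) \<omega>)"
        by (auto simp: indicator_def exp_add[symmetric])
    qed (auto intro!: integrable_real_indicator simp: emeasure_eq_measure)
    also have "\<dots> = exp 1 * (lap\<^sup>2) ^ j"
      using expectation_exp_arrival0[of "2 * j"] by (simp add: power_mult)
    finally show ?thesis by (simp add: emeasure_eq_measure ennreal_leI)
  qed
  have "lap\<^sup>2 < 1" using lap_bounds by (simp add: abs_square_less_1)
  then have s: "summable (\<lambda>j. exp 1 * (lap\<^sup>2) ^ j)"
    by (intro summable_mult summable_geometric) simp
  have "(\<Sum>j. emeasure M {\<omega>\<in>space M. arr (2 * j) \<omega> \<le> 1}) \<le> (\<Sum>j. ennreal (exp 1 * (lap\<^sup>2) ^ j))"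
    by (intro suminf_le le) auto
  also have "\<dots> = ennreal (\<Sum>j. exp 1 * (lap\<^sup>2) ^ j)"
    by (rule suminf_ennreal2[OF _ s]) simp
  finally show ?thesis by (simp add: order_le_less_trans)
qed

lemma arr_nonneg: "0 \<le> arr n \<omega>"
  using arrival0_mono[of 0 n "row 0 \<omega>"] by simp

lemma emeasure_slow_start_unit: "emeasure (density \<nu> (indicator {0..1})) UNIV = (\<Sum>j. emeasure M {\<omega>\<in>space M. arr (2 * j) \<omega> \<le> 1})"
proof -
  have "emeasure (density \<nu> (indicator {0..1})) UNIV = (\<integral>\<^sup>+\<sigma>. indicator {0..1} \<sigma> * indicator UNIV \<sigma> \<partial>\<nu>)"
    by (rule emeasure_density) auto
  also have "\<dots> = (\<Sum>j. \<integral>\<^sup>+\<omega>. indicator {0..1} (arr (2 * j) \<omega>) \<partial>M)"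
    unfolding indicator_UNIV mult_1_right by (rule nn_integral_slow_start_measure) simp
  also have "\<dots> = (\<Sum>j. emeasure M {\<omega>\<in>space M. arr (2 * j) \<omega> \<le> 1})"
  proof (intro suminf_cong)
    fix j
    have "(\<integral>\<^sup>+\<omega>. indicator {0..1} (arr (2 * j) \<omega>) \<partial>M) = (\<integral>\<^sup>+\<omega>. indicator {\<omega>\<in>space M. arr (2 * j) \<omega> \<le> 1} \<omega> \<partial>M)"
      by (intro nn_integral_cong) (auto simp: indicator_def arr_nonneg)
    then show "(\<integral>\<^sup>+\<omega>. indicator {0..1} (arr (2 * j) \<omega>) \<partial>M) = emeasure M {\<omega>\<in>space M. arr (2 * j) \<omega> \<le> 1}" by simp
  qed
  finally show ?thesis .
qed

text \<open>The start of leg \<open>n\<close> is a function of the earlier increments, hence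
  independent of the increment of the leg. This is why the birth intensity is the product of \<nu>
  and \<kappa>.\<close>

lemma distr_arr_V: "distr M (borel \<Otimes>\<^sub>M borel) (\<lambda>\<omega>. (arr n \<omega>, V 0 n \<omega>)) = distr M borel (arr n) \<Otimes>\<^sub>M \<kappa>"
proof -
  define f where "f g = (\<Sum>i<n. norm (g i :: 'a))" for g
  have f: "f \<in> borel_measurable (PiM {..<n} (\<lambda>_. borel))"
    unfolding f_def by (intro borel_measurable_sum) auto
  have i: "indep_var (PiM {..<n} (\<lambda>_. borel)) (\<lambda>\<omega>. restrict (row 0 \<omega>) {..<n}) (PiM {n} (\<lambda>_. borel)) (\<lambda>\<omega>. restrict (row 0 \<omega>) {n})"
    by (rule indep_var_restrict[OF row_indep_vars]) auto
  have eq1: "arr n \<omega> = f (restrict (row 0 \<omega>) {..<n})" for \<omega>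
    by (simp add: arrival0_sum f_def)
  have K: "prob_space \<kappa>" by (rule prob_space_\<kappa>)
  show ?thesis
  proof (rule pair_measure_eqI[symmetric])
    show "sigma_finite_measure (distr M borel (arr n))" "sigma_finite_measure \<kappa>"
      using prob_space_distr[OF arr_measurable] K by (auto simp: prob_space_imp_sigma_finite)
    show "sets (distr M borel (arr n) \<Otimes>\<^sub>M \<kappa>) = sets (distr M (borel \<Otimes>\<^sub>M borel) (\<lambda>\<omega>. (arr n \<omega>, V 0 n \<omega>)))"
      unfolding sets_distr by (rule sets_pair_measure_cong) (rule sets_distr sets_\<kappa>)+
    fix A :: "real set" and B :: "'a set" assume "A \<in> sets (distr M borel (arr n))" "B \<in> sets \<kappa>"
    then have A: "A \<in> sets borel" and B: "B \<in> sets borel" by auto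
    let ?A = "f -` A \<inter> space (PiM {..<n} (\<lambda>_. borel :: 'a measure))"
    let ?B = "(\<lambda>g. g n) -` B \<inter> space (PiM {n} (\<lambda>_. borel :: 'a measure))"
    have sA: "?A \<in> sets (PiM {..<n} (\<lambda>_. borel))" using f A by (rule measurable_sets)
    have sB: "?B \<in> sets (PiM {n} (\<lambda>_. borel))"
      by (rule measurable_sets[OF measurable_component_singleton]) (use B in auto)
    have pA: "(\<lambda>\<omega>. restrict (row 0 \<omega>) {..<n}) -` ?A \<inter> space M = arr n -` A \<inter> space M"
      unfolding eq1 by (auto simp: space_PiM)
    have pB: "(\<lambda>\<omega>. restrict (row 0 \<omega>) {n}) -` ?B \<inter> space M = V 0 n -` B \<inter> space M"
      by (auto simp: space_PiM)
    have "(\<lambda>\<omega>. (restrict (row 0 \<omega>) {..<n}, restrict (row 0 \<omega>) {n})) -` (?A \<times> ?B) \<inter> space M =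
        ((\<lambda>\<omega>. restrict (row 0 \<omega>) {..<n}) -` ?A \<inter> space M) \<inter> ((\<lambda>\<omega>. restrict (row 0 \<omega>) {n}) -` ?B \<inter> space M)" by blast
    then have pAB: "(\<lambda>\<omega>. (restrict (row 0 \<omega>) {..<n}, restrict (row 0 \<omega>) {n})) -` (?A \<times> ?B) \<inter> space M =
        (\<lambda>\<omega>. (arr n \<omega>, V 0 n \<omega>)) -` (A \<times> B) \<inter> space M"
      unfolding pA pB by blast
    have "prob ((\<lambda>\<omega>. (arr n \<omega>, V 0 n \<omega>)) -` (A \<times> B) \<inter> space M) = prob (arr n -` A \<inter> space M) * prob (V 0 n -` B \<inter> space M)"
      using indep_varD[OF i sA sB] unfolding pA pB pAB .
    moreover have "emeasure \<kappa> B = prob (V 0 n -` B \<inter> space M)"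
      using B V_law[of 0 n, symmetric] by (simp add: emeasure_distr emeasure_eq_measure)
    ultimately show "emeasure (distr M borel (arr n)) A * emeasure \<kappa> B = emeasure (distr M (borel \<Otimes>\<^sub>M borel) (\<lambda>\<omega>. (arr n \<omega>, V 0 n \<omega>))) (A \<times> B)"
      using A B by (simp add: emeasure_distr emeasure_eq_measure ennreal_mult)
  qed
qed

lemma sigma_finite_scaled_lborel: "sigma_finite_measure (scale_measure (ennreal lam) (lborel :: 'a measure))"
proof
  show "\<exists>A::'a set set. countable A \<and> A \<subseteq> sets (scale_measure (ennreal lam) lborel) \<and>
      \<Union>A = space (scale_measure (ennreal lam) lborel) \<and> (\<forall>a\<in>A. emeasure (scale_measure (ennreal lam) lborel) a \<noteq> \<infinity>)"
  proof (intro exI conjI)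
    show "countable (range (\<lambda>n::nat. cball (0::'a) n))" by simp
    show "\<Union> (range (\<lambda>n::nat. cball (0::'a) n)) = space (scale_measure (ennreal lam) lborel)"
      using real_arch_simple by (auto simp: space_scale_measure)
    show "\<forall>a\<in>range (\<lambda>n::nat. cball (0::'a) n). emeasure (scale_measure (ennreal lam) lborel) a \<noteq> \<infinity>"
      using emeasure_lborel_cball_finite by (auto simp: ennreal_mult_eq_top_iff less_top)
  qed auto
qed

lemma sets_birth_death_intensity: "sets (birth_death_intensity lam \<nu> \<kappa>) = sets borel"
proof -
  have "sets (birth_death_intensity lam \<nu> \<kappa>) = sets (borel \<Otimes>\<^sub>M (borel \<Otimes>\<^sub>M borel))"
    unfolding birth_death_intensity_def by (intro sets_pair_measure_cong) auto
  then show ?thesis by (simp only: borel_prod)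
qed

text \<open>Rewrites the intensity as a sum over the slow legs of a single random path, the form in
  which swept volumes appear. It combines Campbell's formula with the independence of start and
  increment.\<close>

lemma emeasure_birth_death_intensity:
  assumes C: "C \<in> sets borel"
  shows "emeasure (birth_death_intensity lam \<nu> \<kappa>) C = ennreal lam *
    (\<Sum>l. \<integral>\<^sup>+\<omega>. indicator {0..1} (arr (2 * l) \<omega>) * emeasure lborel {x. (x, arr (2 * l) \<omega>, V 0 (2 * l) \<omega>) \<in> C} \<partial>M)"
proof -
  let ?\<nu>1 = "density \<nu> (indicator {0..1})"
  let ?L = "scale_measure (ennreal lam) (lborel :: 'a measure)"
  interpret K: prob_space \<kappa> by (rule prob_space_\<kappa>)
  interpret F: finite_measure ?\<nu>1
    by (rule finite_measureI) (use sum_slow_starts_finite emeasure_slow_start_unit in auto)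
  interpret L: sigma_finite_measure ?L by (rule sigma_finite_scaled_lborel)
  interpret FK: pair_sigma_finite ?\<nu>1 \<kappa> ..
  interpret P: pair_sigma_finite ?L "?\<nu>1 \<Otimes>\<^sub>M \<kappa>" ..
  define e where "e q = emeasure lborel {x. (x, q) \<in> C}" for q
  have C3: "C \<in> sets (?L \<Otimes>\<^sub>M (?\<nu>1 \<Otimes>\<^sub>M \<kappa>))"
    using C sets_birth_death_intensity unfolding birth_death_intensity_def by simp
  have em [measurable]: "e \<in> borel_measurable (borel \<Otimes>\<^sub>M borel)"
  proof -
    have [measurable]: "C \<in> sets (borel \<Otimes>\<^sub>M (borel \<Otimes>\<^sub>M borel))" using C by (simp only: borel_prod)
    have "{p\<in>space ((borel \<Otimes>\<^sub>M borel) \<Otimes>\<^sub>M lborel). (snd p, fst p) \<in> C} \<in> sets ((borel \<Otimes>\<^sub>M borel) \<Otimes>\<^sub>M (lborel :: 'a measure))"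
      by measurable
    from lborel.measurable_emeasure_Pair[OF this]
    show ?thesis unfolding e_def by (simp add: space_pair_measure vimage_def)
  qed
  have "emeasure (birth_death_intensity lam \<nu> \<kappa>) C = (\<integral>\<^sup>+q. emeasure ?L ((\<lambda>x. (x, q)) -` C) \<partial>(?\<nu>1 \<Otimes>\<^sub>M \<kappa>))"
    unfolding birth_death_intensity_def by (rule P.emeasure_pair_measure_alt2[OF C3])
  also have "\<dots> = (\<integral>\<^sup>+q. ennreal lam * e q \<partial>(?\<nu>1 \<Otimes>\<^sub>M \<kappa>))"
    by (simp add: e_def vimage_def)
  also have "\<dots> = (\<integral>\<^sup>+\<sigma>. \<integral>\<^sup>+u. ennreal lam * e (\<sigma>, u) \<partial>\<kappa> \<partial>?\<nu>1)"
  proof (rule K.nn_integral_fst[symmetric])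
    show "(\<lambda>q. ennreal lam * e q) \<in> borel_measurable (?\<nu>1 \<Otimes>\<^sub>M \<kappa>)"
      using em by (subst measurable_cong_sets[OF sets_pair_measure_cong[of _ borel _ borel] refl]) auto
  qed
  also have "\<dots> = (\<integral>\<^sup>+\<sigma>. indicator {0..1} \<sigma> * (\<integral>\<^sup>+u. ennreal lam * e (\<sigma>, u) \<partial>\<kappa>) \<partial>\<nu>)"
  proof (rule nn_integral_density)
    have "(\<lambda>\<sigma>. \<integral>\<^sup>+u. ennreal lam * e (\<sigma>, u) \<partial>\<kappa>) \<in> borel_measurable borel"
      by measurable
    then show "(\<lambda>\<sigma>. \<integral>\<^sup>+u. ennreal lam * e (\<sigma>, u) \<partial>\<kappa>) \<in> borel_measurable \<nu>" by simp
  qed simp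
  also have "\<dots> = (\<Sum>l. \<integral>\<^sup>+\<omega>. indicator {0..1} (arr (2 * l) \<omega>) * (\<integral>\<^sup>+u. ennreal lam * e (arr (2 * l) \<omega>, u) \<partial>\<kappa>) \<partial>M)"
    by (rule nn_integral_slow_start_measure) measurable
  also have "\<dots> = (\<Sum>l. ennreal lam * (\<integral>\<^sup>+\<omega>. indicator {0..1} (arr (2 * l) \<omega>) * e (arr (2 * l) \<omega>, V 0 (2 * l) \<omega>) \<partial>M))"
  proof (intro suminf_cong)
    fix l :: nat
    let ?n = "2 * l"
    let ?D = "distr M borel (arr ?n)"
    have [measurable]: "(\<lambda>p. indicator {0..1} (fst p) * (ennreal lam * e p)) \<in> borel_measurable (borel \<Otimes>\<^sub>M borel)"
      by measurable
    have "(\<integral>\<^sup>+\<omega>. indicator {0..1} (arr ?n \<omega>) * (\<integral>\<^sup>+u. ennreal lam * e (arr ?n \<omega>, u) \<partial>\<kappa>) \<partial>M) =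
        (\<integral>\<^sup>+\<sigma>. indicator {0..1} \<sigma> * (\<integral>\<^sup>+u. ennreal lam * e (\<sigma>, u) \<partial>\<kappa>) \<partial>?D)"
      by (rule nn_integral_distr[symmetric]) measurable
    also have "\<dots> = (\<integral>\<^sup>+\<sigma>. \<integral>\<^sup>+u. indicator {0..1} \<sigma> * (ennreal lam * e (\<sigma>, u)) \<partial>\<kappa> \<partial>?D)"
      by (intro nn_integral_cong nn_integral_cmult[symmetric]) measurable
    also have "\<dots> = (\<integral>\<^sup>+p. indicator {0..1} (fst p) * (ennreal lam * e p) \<partial>(?D \<Otimes>\<^sub>M \<kappa>))"
    proof -
      have "(\<lambda>p. indicator {0..1} (fst p) * (ennreal lam * e p)) \<in> borel_measurable (?D \<Otimes>\<^sub>M \<kappa>)"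
        by (subst measurable_cong_sets[OF sets_pair_measure_cong[of _ borel _ borel] refl]) auto
      from K.nn_integral_fst[OF this] show ?thesis by simp
    qed
    also have "\<dots> = (\<integral>\<^sup>+\<omega>. indicator {0..1} (arr ?n \<omega>) * (ennreal lam * e (arr ?n \<omega>, V 0 ?n \<omega>)) \<partial>M)"
      unfolding distr_arr_V[symmetric] by (subst nn_integral_distr) auto
    also have "\<dots> = (\<integral>\<^sup>+\<omega>. ennreal lam * (indicator {0..1} (arr ?n \<omega>) * e (arr ?n \<omega>, V 0 ?n \<omega>)) \<partial>M)"
      by (simp add: mult.left_commute)
    also have "\<dots> = ennreal lam * (\<integral>\<^sup>+\<omega>. indicator {0..1} (arr ?n \<omega>) * e (arr ?n \<omega>, V 0 ?n \<omega>) \<partial>M)"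
      by (rule nn_integral_cmult) measurable
    finally show "(\<integral>\<^sup>+\<omega>. indicator {0..1} (arr ?n \<omega>) * (\<integral>\<^sup>+u. ennreal lam * e (arr ?n \<omega>, u) \<partial>\<kappa>) \<partial>M) =
        ennreal lam * (\<integral>\<^sup>+\<omega>. indicator {0..1} (arr ?n \<omega>) * e (arr ?n \<omega>, V 0 ?n \<omega>) \<partial>M)" .
  qed
  also have "\<dots> = ennreal lam * (\<Sum>l. \<integral>\<^sup>+\<omega>. indicator {0..1} (arr (2 * l) \<omega>) * e (arr (2 * l) \<omega>, V 0 (2 * l) \<omega>) \<partial>M)"
    by (rule ennreal_suminf_cmult)
  finally show ?thesis by (simp add: e_def)
qed

end

text \<open>By Lindelof the union of all open null sets is a union of countably many of
  them.\<close>

lemma emeasure_outside_support: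
  fixes \<mu> :: "'a::second_countable_topology measure"
  assumes "sets \<mu> = sets borel"
  shows "emeasure \<mu> (- measure_support \<mu>) = 0"
proof -
  define \<U> where "\<U> = {U. open U \<and> emeasure \<mu> U = 0}"
  have eq: "- measure_support \<mu> = \<Union>\<U>"
    by (auto simp: measure_support_def \<U>_def zero_less_iff_neq_zero)
  obtain \<V> where V: "\<V> \<subseteq> \<U>" "countable \<V>" "\<Union>\<V> = \<Union>\<U>"
    using Lindelof[of \<U>] by (auto simp: \<U>_def)
  have "(\<Union>U\<in>\<V>. U) \<in> null_sets \<mu>"
    by (rule null_sets_UN'[OF V(2)]) (use V(1) assms in \<open>auto simp: \<U>_def null_sets_def\<close>)
  then show ?thesis using eq V(3) by (simp add: null_sets_def)
qed

section \<open>Void probabilities of the slow nodes and their role as limits\<close>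

locale mobility_limit = mobility M lam \<kappa> X V
  for M :: "'w measure" and lam and \<kappa> :: "'a::euclidean_space measure" and X V +
  fixes N :: "'v measure" and r :: real and Xbd :: "'v \<Rightarrow> ('a \<times> real \<times> 'a) set" and X' :: "real \<Rightarrow> 'v \<Rightarrow> 'a set"
  assumes r_pos: "r > 0"
    and kappa_bounded: "bounded (measure_support \<kappa>)"
    and N_prob: "prob_space N"
    and Xbd_poisson: "poisson_point_process N (birth_death_intensity lam \<nu> \<kappa>) Xbd"
    and X'_poisson: "\<And>t. t \<in> {0..1} \<Longrightarrow> homogeneous_poisson N (fast_intensity lam M (V 0) t) (X' t)"
    and X'_indep: "\<And>t. t \<in> {0..1} \<Longrightarrow> prob_space.indep_set N
          (sets (generated_algebra N (slow_nodes Xbd t))) (sets (generated_algebra N (X' t)))"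
begin

sublocale N: prob_space N by (rule N_prob)

lemma shadow_measurable [measurable]:
  assumes I: "finite I" and A: "\<And>k. k \<in> I \<Longrightarrow> A k \<in> sets borel"
  shows "(\<lambda>\<omega>. emeasure lborel (leg_shadow I t A (arr n \<omega>) (V 0 n \<omega>))) \<in> borel_measurable M"
proof -
  have [measurable]: "{p. fst p \<in> leg_shadow I t A (fst (snd p)) (snd (snd p))} \<in> sets (borel \<Otimes>\<^sub>M (borel \<Otimes>\<^sub>M borel))"
    unfolding borel_prod by (rule leg_shadow_pair_borel[OF I A])
  have "{p\<in>space (M \<Otimes>\<^sub>M lborel). (snd p, arr n (fst p), V 0 n (fst p)) \<in> {p. fst p \<in> leg_shadow I t A (fst (snd p)) (snd (snd p))}} \<in> sets (M \<Otimes>\<^sub>M (lborel :: 'a measure))"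
    by measurable
  from lborel.measurable_emeasure_Pair[OF this]
  have "(\<lambda>\<omega>. emeasure lborel (Pair \<omega> -` {p\<in>space (M \<Otimes>\<^sub>M lborel). (snd p, arr n (fst p), V 0 n (fst p)) \<in> {p. fst p \<in> leg_shadow I t A (fst (snd p)) (snd (snd p))}})) \<in> borel_measurable M" .
  then show ?thesis
    by (rule measurable_cong[THEN iffD1, rotated]) (auto simp: space_pair_measure intro!: arg_cong[where f="emeasure lborel"])
qed

text \<open>The slow nodes at all times are read off one birth process, so a condition at several
  times is a single void event for it.\<close>

lemma slow_nodes_avoid_iff:
  "(\<forall>k\<in>I. slow_nodes Xbd (t k) \<omega> \<inter> A k = {}) \<longleftrightarrow>
   Xbd \<omega> \<inter> {p. fst p \<in> leg_shadow I t A (fst (snd p)) (snd (snd p))} = {}"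
  unfolding slow_nodes_def leg_shadow_def by (auto simp: set_eq_iff) metis+

text \<open>A shadow has at most the total volume of the sets \<open>A k\<close> and is empty for a
  leg that starts after time 1.\<close>

lemma shadow_sum_finite:
  assumes I: "finite I" and A: "\<And>k. k \<in> I \<Longrightarrow> A k \<in> sets borel" "\<And>k. k \<in> I \<Longrightarrow> bounded (A k)"
    and t: "\<And>k. k \<in> I \<Longrightarrow> t k \<in> {0..1}"
  shows "(\<Sum>l. \<integral>\<^sup>+\<omega>. emeasure lborel (leg_shadow I t A (arr (2 * l) \<omega>) (V 0 (2 * l) \<omega>)) \<partial>M) < \<infinity>"
proof -
  define c where "c = (\<Sum>k\<in>I. emeasure lborel (A k))"
  have c: "c < \<infinity>" unfolding c_def using I emeasure_bounded_finite[OF A(2)] by (auto simp: less_top[symmetric])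
  have le: "emeasure lborel (leg_shadow I t A \<sigma> u) \<le> c" for \<sigma> u
  proof -
    have "emeasure lborel (leg_shadow I t A \<sigma> u) \<le> emeasure lborel (\<Union>k\<in>I. {x. x + ((t k - \<sigma>) / norm u) *\<^sub>R u \<in> A k})"
      by (rule emeasure_mono) (use I A in \<open>auto simp: leg_shadow_def intro!: sets.finite_UN translate_borel\<close>)
    also have "\<dots> \<le> (\<Sum>k\<in>I. emeasure lborel {x. x + ((t k - \<sigma>) / norm u) *\<^sub>R u \<in> A k})"
      by (rule emeasure_subadditive_finite[OF I]) (use A in \<open>auto intro!: translate_borel\<close>)
    also have "\<dots> = c" unfolding c_def by (intro sum.cong refl emeasure_lborel_translation A)
    finally show ?thesis .
  qed
  have le2: "emeasure lborel (leg_shadow I t A (arr (2 * l) \<omega>) (V 0 (2 * l) \<omega>)) \<le> c * indicator {\<omega>\<in>space M. arr (2 * l) \<omega> \<le> 1} \<omega>"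
    if "\<omega> \<in> space M" for l \<omega>
  proof (cases "arr (2 * l) \<omega> \<le> 1")
    case False
    then have "leg_shadow I t A (arr (2 * l) \<omega>) (V 0 (2 * l) \<omega>) = {}" using t by (force simp: leg_shadow_def)
    then show ?thesis by simp
  qed (use le that in simp)
  have "(\<Sum>l. \<integral>\<^sup>+\<omega>. emeasure lborel (leg_shadow I t A (arr (2 * l) \<omega>) (V 0 (2 * l) \<omega>)) \<partial>M) \<le>
      (\<Sum>l. \<integral>\<^sup>+\<omega>. c * indicator {\<omega>\<in>space M. arr (2 * l) \<omega> \<le> 1} \<omega> \<partial>M)"
    by (intro suminf_le nn_integral_mono le2) auto
  also have "\<dots> = (\<Sum>l. c * emeasure M {\<omega>\<in>space M. arr (2 * l) \<omega> \<le> 1})"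
    by (intro suminf_cong) (simp add: nn_integral_cmult_indicator)
  also have "\<dots> = c * (\<Sum>l. emeasure M {\<omega>\<in>space M. arr (2 * l) \<omega> \<le> 1})" by (rule ennreal_suminf_cmult)
  also have "\<dots> < \<infinity>" using c sum_slow_starts_finite by (simp add: ennreal_mult_less_top)
  finally show ?thesis .
qed

lemma slow_void:
  assumes I: "finite I" and A: "\<And>k. k \<in> I \<Longrightarrow> A k \<in> sets borel" "\<And>k. k \<in> I \<Longrightarrow> bounded (A k)"
    and t: "\<And>k. k \<in> I \<Longrightarrow> t k \<in> {0..1}"
  shows "{\<omega>\<in>space N. \<forall>k\<in>I. slow_nodes Xbd (t k) \<omega> \<inter> A k = {}} \<in> sets N"
    and "N.prob {\<omega>\<in>space N. \<forall>k\<in>I. slow_nodes Xbd (t k) \<omega> \<inter> A k = {}} =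
      exp (- (lam * enn2real (\<Sum>l. \<integral>\<^sup>+\<omega>. emeasure lborel (leg_shadow I t A (arr (2 * l) \<omega>) (V 0 (2 * l) \<omega>)) \<partial>M)))"
proof -
  let ?C = "{p. fst p \<in> leg_shadow I t A (fst (snd p)) (snd (snd p))}"
  have C: "?C \<in> sets borel" by (rule leg_shadow_pair_borel[OF I A(1)])
  show "{\<omega>\<in>space N. \<forall>k\<in>I. slow_nodes Xbd (t k) \<omega> \<inter> A k = {}} \<in> sets N"
    unfolding slow_nodes_avoid_iff by (rule poisson_void(1)[OF Xbd_poisson sets_birth_death_intensity C])
  have "emeasure (birth_death_intensity lam \<nu> \<kappa>) ?C =
     ennreal lam * (\<Sum>l. \<integral>\<^sup>+\<omega>. emeasure lborel (leg_shadow I t A (arr (2 * l) \<omega>) (V 0 (2 * l) \<omega>)) \<partial>M)"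
    unfolding emeasure_birth_death_intensity[OF C]
  proof (intro arg_cong2[where f="(*)"] refl suminf_cong nn_integral_cong)
    fix l \<omega>
    \<comment> \<open>The restriction of births to the unit interval changes nothing, because all
      the times \<open>t k\<close> lie in it.\<close>
    have "leg_shadow I t A (arr (2 * l) \<omega>) (V 0 (2 * l) \<omega>) = {}" if "arr (2 * l) \<omega> \<notin> {0..1}"
      using t that arr_nonneg[where n="2 * l" and \<omega>=\<omega>] by (force simp: leg_shadow_def)
    then show "indicator {0..1} (arr (2 * l) \<omega>) * emeasure lborel {x. (x, arr (2 * l) \<omega>, V 0 (2 * l) \<omega>) \<in> ?C} =
        emeasure lborel (leg_shadow I t A (arr (2 * l) \<omega>) (V 0 (2 * l) \<omega>))"
      by (cases "arr (2 * l) \<omega> \<in> {0..1}") auto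
  qed
  moreover have "ennreal lam * (\<Sum>l. \<integral>\<^sup>+\<omega>. emeasure lborel (leg_shadow I t A (arr (2 * l) \<omega>) (V 0 (2 * l) \<omega>)) \<partial>M) < \<infinity>"
    using shadow_sum_finite[OF I A t] by (simp add: ennreal_mult_less_top)
  ultimately show "N.prob {\<omega>\<in>space N. \<forall>k\<in>I. slow_nodes Xbd (t k) \<omega> \<inter> A k = {}} =
      exp (- (lam * enn2real (\<Sum>l. \<integral>\<^sup>+\<omega>. emeasure lborel (leg_shadow I t A (arr (2 * l) \<omega>) (V 0 (2 * l) \<omega>)) \<partial>M)))"
    unfolding slow_nodes_avoid_iff
    using poisson_void(2)[OF Xbd_poisson sets_birth_death_intensity C] lam_pos
    by (simp add: measure_def enn2real_mult)
qed

text \<open>Births with \<sigma> outside the unit interval or a velocity beyond the support of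
  \<kappa> have intensity zero. The remaining births that reach a bounded set by time
  \<open>t\<close> lie in a bounded region of the product space, where the birth process is
  finite.\<close>

lemma slow_nodes_locally_finite:
  assumes t: "t \<in> {0..1}"
  shows "AE \<omega> in N. locally_finite_set (slow_nodes Xbd t \<omega>)"
proof -
  obtain K where K: "\<And>u. u \<in> measure_support \<kappa> \<Longrightarrow> norm u \<le> K"
    using kappa_bounded by (auto simp: bounded_iff)
  have AEV: "AE \<omega> in M. norm (V 0 n \<omega>) \<le> K" for n
  proof -
    have cl: "- measure_support \<kappa> \<in> sets borel"
    proof -
      have "- measure_support \<kappa> = \<Union>{U. open U \<and> emeasure \<kappa> U = 0}"
        by (auto simp: measure_support_def zero_less_iff_neq_zero)
      then have "open (- measure_support \<kappa>)" by (simp add: open_Union)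
      then show ?thesis by simp
    qed
    have "AE u in \<kappa>. u \<notin> - measure_support \<kappa>"
      by (rule AE_not_in) (use emeasure_outside_support[OF sets_\<kappa>] cl in auto)
    then have "AE u in distr M borel (V 0 n). norm u \<le> K"
      unfolding V_law by eventually_elim (use K in auto)
    then show ?thesis by (subst (asm) AE_distr_iff) auto
  qed
  let ?C = "{p :: 'a \<times> real \<times> 'a. fst (snd p) \<notin> {0..1} \<or> norm (snd (snd p)) > K}"
  have C: "?C \<in> sets borel"
  proof -
    have "Measurable.pred (borel \<Otimes>\<^sub>M (borel \<Otimes>\<^sub>M borel)) (\<lambda>p :: 'a \<times> real \<times> 'a. fst (snd p) \<notin> {0..1} \<or> norm (snd (snd p)) > K)"
      by measurable
    then show ?thesis by (simp add: pred_def borel_prod)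
  qed
  \<comment> \<open>The exceptional births form an unbounded set, but one of measure zero, so their
    almost sure absence is a void probability equal to 1.\<close>
  have "emeasure (birth_death_intensity lam \<nu> \<kappa>) ?C = ennreal lam * (\<Sum>l. \<integral>\<^sup>+\<omega>. 0 \<partial>M)"
    unfolding emeasure_birth_death_intensity[OF C]
  proof (intro arg_cong2[where f="(*)"] refl suminf_cong nn_integral_cong_AE)
    fix l
    show "AE \<omega> in M. indicator {0..1} (arr (2 * l) \<omega>) * emeasure lborel {x. (x, arr (2 * l) \<omega>, V 0 (2 * l) \<omega>) \<in> ?C} = 0"
      using AEV[of "2 * l"] by eventually_elim (auto simp: indicator_def)
  qed
  then have "emeasure (birth_death_intensity lam \<nu> \<kappa>) ?C = 0" by simp
  then have "N.prob {\<omega>\<in>space N. Xbd \<omega> \<inter> ?C = {}} = 1"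
    using poisson_void(2)[OF Xbd_poisson sets_birth_death_intensity C] by (simp add: measure_def)
  then have "AE \<omega> in N. \<omega> \<in> {\<omega>\<in>space N. Xbd \<omega> \<inter> ?C = {}}"
    by (rule N.AE_prob_1)
  then show ?thesis
  proof eventually_elim
    case (elim \<omega>)
    have lf: "locally_finite_set (Xbd \<omega>)" using poisson_point_processD(2)[OF Xbd_poisson] elim by blast
    have in_C: "\<sigma> \<in> {0..1} \<and> norm v \<le> K" if "(x, \<sigma>, v) \<in> Xbd \<omega>" for x \<sigma> v
      using elim that by (auto simp: disjoint_iff not_less)
    show ?case
      unfolding locally_finite_set_def
    proof (intro allI impI)
      fix B :: "'a set" assume "bounded B"
      then obtain R where R: "\<And>x. x \<in> B \<Longrightarrow> norm x \<le> R" by (auto simp: bounded_iff)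
      let ?D = "cball 0 (R + 1) \<times> {0..1} \<times> cball 0 K :: ('a \<times> real \<times> 'a) set"
      have bd: "bounded ?D" by (intro bounded_Times) auto
      have "slow_nodes Xbd t \<omega> \<inter> B \<subseteq> (\<lambda>(x, \<sigma>, v). x + ((t - \<sigma>) / norm v) *\<^sub>R v) ` (Xbd \<omega> \<inter> ?D)"
      proof
        fix y assume y: "y \<in> slow_nodes Xbd t \<omega> \<inter> B"
        then obtain x \<sigma> v where p: "(x, \<sigma>, v) \<in> Xbd \<omega>" "\<sigma> \<le> t" "t \<le> \<sigma> + norm v" "y = x + ((t - \<sigma>) / norm v) *\<^sub>R v"
          unfolding slow_nodes_def by blast
        have "norm (((t - \<sigma>) / norm v) *\<^sub>R v) \<le> 1"
          using in_C[OF p(1)] p(2) t by (cases "v = 0") auto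
        then have "norm x \<le> R + 1"
          using R[of y] y norm_triangle_ineq4[of y "((t - \<sigma>) / norm v) *\<^sub>R v"] p(4) by simp
        then have "(x, \<sigma>, v) \<in> Xbd \<omega> \<inter> ?D" using in_C[OF p(1)] p(1) by simp
        then show "y \<in> (\<lambda>(x, \<sigma>, v). x + ((t - \<sigma>) / norm v) *\<^sub>R v) ` (Xbd \<omega> \<inter> ?D)"
          using p(4) by (intro image_eqI[of _ _ "(x, \<sigma>, v)"]) auto
      qed
      then show "finite (slow_nodes Xbd t \<omega> \<inter> B)"
        using locally_finite_Int[OF lf bd] by (rule finite_subset[OF _ finite_imageI])
    qed
  qed
qed

lemma fast_times_pair_measurable [measurable]:
  assumes [measurable]: "s \<in> borel_measurable Q" "w \<in> measurable Q M"
  shows "Measurable.pred Q (\<lambda>x. s x \<in> fast_times (row 0 (w x)))"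
proof -
  have [measurable]: "(\<lambda>x. arr n (w x)) \<in> borel_measurable Q" for n
    by (rule measurable_compose[OF assms(2) arr_measurable])
  have "Measurable.pred Q (\<lambda>x. \<exists>j. arr (2 * j + 1) (w x) \<le> s x \<and> s x \<le> arr (2 * j + 2) (w x))"
    by (intro pred_intros_countable) (simp del: arrival0.simps add: )
  then show ?thesis by (simp add: fast_times_def del: arrival0.simps)
qed

text \<open>The swept volume of a generic path is eventually the sum of its leg shadows and of the
  volumes at its fast times. Its mean converges, and the exponential of the limit factorizes: the
  shadows give the void probability of the slow nodes, the fast times give one independent Poisson
  factor each.\<close>

lemma void_limit:
  assumes I: "finite I" and A: "\<And>k. k \<in> I \<Longrightarrow> A k \<in> sets borel" "\<And>k. k \<in> I \<Longrightarrow> bounded (A k)"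
    and t: "\<And>k. k \<in> I \<Longrightarrow> t k \<in> {0..1}"
    and gen: "AE \<omega> in M. generic_times I t (row 0 \<omega>)"
  shows "((\<lambda>T. prob {\<omega>\<in>space M. \<forall>k\<in>I. nodes X V T (t k * T) \<omega> \<inter> A k = {}}) \<longlongrightarrow>
     N.prob {\<omega>\<in>space N. \<forall>k\<in>I. slow_nodes Xbd (t k) \<omega> \<inter> A k = {}} *
       (\<Prod>k\<in>I. exp (- (fast_intensity lam M (V 0) (t k) * measure lborel (A k))))) at_top"
proof -
  let ?sh = "\<lambda>l \<omega>. emeasure lborel (leg_shadow I t A (arr (2 * l) \<omega>) (V 0 (2 * l) \<omega>))"
  define S where "S = (\<Sum>l. \<integral>\<^sup>+\<omega>. ?sh l \<omega> \<partial>M)"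
  define F where "F = (\<Sum>k\<in>I. emeasure M {\<omega>\<in>space M. t k \<in> fast_times (row 0 \<omega>)} * emeasure lborel (A k))"
  have S: "S < \<infinity>" unfolding S_def by (rule shadow_sum_finite[OF I A t])
  have Afin: "emeasure lborel (A k) < \<infinity>" if "k \<in> I" for k using A(2)[OF that] by (rule emeasure_bounded_finite)
  have F: "F < \<infinity>" unfolding F_def using I Afin
    by (auto simp: ennreal_mult_eq_top_iff emeasure_eq_measure less_top[symmetric])
  have fm [measurable]: "{\<omega>\<in>space M. t k \<in> fast_times (row 0 \<omega>)} \<in> sets M" for k
    using fast_times_pair_measurable[of "\<lambda>_. t k" M "\<lambda>\<omega>. \<omega>"] by (simp add: pred_def)
  have shm [measurable]: "?sh l \<in> borel_measurable M" for l
    by (rule shadow_measurable[OF I A(1)])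
  let ?lim = "\<lambda>\<omega>. (\<Sum>l. ?sh l \<omega>) + (\<Sum>k\<in>I. indicator {\<omega>\<in>space M. t k \<in> fast_times (row 0 \<omega>)} \<omega> * emeasure lborel (A k))"
  have limint: "(\<integral>\<^sup>+\<omega>. ?lim \<omega> \<partial>M) = S + F"
  proof -
    have "(\<integral>\<^sup>+\<omega>. ?lim \<omega> \<partial>M) = (\<integral>\<^sup>+\<omega>. (\<Sum>l. ?sh l \<omega>) \<partial>M) + (\<integral>\<^sup>+\<omega>. (\<Sum>k\<in>I. indicator {\<omega>\<in>space M. t k \<in> fast_times (row 0 \<omega>)} \<omega> * emeasure lborel (A k)) \<partial>M)"
      by (rule nn_integral_add) measurable
    also have "(\<integral>\<^sup>+\<omega>. (\<Sum>l. ?sh l \<omega>) \<partial>M) = S" unfolding S_def by (rule nn_integral_suminf) measurable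
    also have "(\<integral>\<^sup>+\<omega>. (\<Sum>k\<in>I. indicator {\<omega>\<in>space M. t k \<in> fast_times (row 0 \<omega>)} \<omega> * emeasure lborel (A k)) \<partial>M) = F"
      unfolding F_def by (subst nn_integral_sum) (auto simp: nn_integral_multc)
    finally show ?thesis .
  qed
  define sw where "sw T \<omega> = emeasure lborel (swept T I t A (row 0 \<omega>))" for T \<omega>
  define c where "c = (\<Sum>k\<in>I. emeasure lborel (A k))"
  have c: "c < \<infinity>" unfolding c_def using I Afin by (auto simp: ennreal_sum_less_top less_top[symmetric])
  have sw_le: "sw T \<omega> \<le> c" for T \<omega>
  proof -
    have "swept T I t A (row 0 \<omega>) = (\<Union>k\<in>I. {x. x + (phase_disp 0 (row 0 \<omega>) (t k) + T *\<^sub>R phase_disp 1 (row 0 \<omega>) (t k)) \<in> A k})"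
      by (auto simp: swept_def add.assoc)
    then have "sw T \<omega> \<le> (\<Sum>k\<in>I. emeasure lborel {x. x + (phase_disp 0 (row 0 \<omega>) (t k) + T *\<^sub>R phase_disp 1 (row 0 \<omega>) (t k)) \<in> A k})"
      unfolding sw_def by (simp only:) (rule emeasure_subadditive_finite[OF I], use A in \<open>auto intro!: translate_borel\<close>)
    also have "\<dots> = c" unfolding c_def by (intro sum.cong refl emeasure_lborel_translation A)
    finally show ?thesis .
  qed
  have sw_m [measurable]: "sw T \<in> borel_measurable M" for T
  proof -
    have [measurable]: "{p. fst p \<in> swept T I t A (snd p)} \<in> sets (borel \<Otimes>\<^sub>M rows)" by (rule swept_measurable[OF I A(1)])
    have [measurable]: "(\<lambda>p. (snd p, row 0 (fst p))) \<in> measurable (M \<Otimes>\<^sub>M lborel) (borel \<Otimes>\<^sub>M rows)"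
      by (intro measurable_Pair measurable_compose[OF measurable_fst row_measurable]) measurable
    have "{p\<in>space (M \<Otimes>\<^sub>M lborel). (snd p, row 0 (fst p)) \<in> {p. fst p \<in> swept T I t A (snd p)}} \<in> sets (M \<Otimes>\<^sub>M (lborel :: 'a measure))"
      by measurable
    from lborel.measurable_emeasure_Pair[OF this]
    show ?thesis
      unfolding sw_def
      by (rule measurable_cong[THEN iffD1, rotated]) (auto simp: space_pair_measure intro!: arg_cong[where f="emeasure lborel"])
  qed
  have lim1: "((\<lambda>T. \<integral>\<^sup>+\<omega>. sw T \<omega> \<partial>M) \<longlongrightarrow> S + F) at_top"
  proof (rule tendsto_at_topI_sequentially)
    fix Tn :: "nat \<Rightarrow> real" assume Tn: "filterlim Tn at_top sequentially"
    have "(\<lambda>n. \<integral>\<^sup>+\<omega>. sw (Tn n) \<omega> \<partial>M) \<longlonglongrightarrow> (\<integral>\<^sup>+\<omega>. ?lim \<omega> \<partial>M)"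
    \<comment> \<open>The swept set is a finite union of translates of the \<open>A k\<close>, so
      its volume never exceeds \<open>c\<close>, uniformly in \<open>T\<close>.\<close>
    proof (rule nn_integral_dominated_convergence[where w="\<lambda>_. c"])
      show "AE \<omega> in M. (\<lambda>n. sw (Tn n) \<omega>) \<longlonglongrightarrow> ?lim \<omega>"
        using gen AE_space
      proof eventually_elim
        case (elim \<omega>)
        have "\<forall>\<^sub>F T in at_top. sw T \<omega> = ?lim \<omega>"
          using emeasure_swept_eventually[OF elim(1) I A t] elim(2)
          unfolding sw_def swept_def by (auto simp: indicator_def elim!: eventually_mono)
        then have "\<forall>\<^sub>F n in sequentially. sw (Tn n) \<omega> = ?lim \<omega>"
          using Tn by (rule eventually_compose_filterlim)
        then show ?case by (rule tendsto_eventually)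
      qed
      show "(\<integral>\<^sup>+x. c \<partial>M) < \<infinity>" using c by (simp add: emeasure_space_1)
    qed (use sw_le in auto)
    then show "(\<lambda>n. \<integral>\<^sup>+\<omega>. sw (Tn n) \<omega> \<partial>M) \<longlonglongrightarrow> S + F" unfolding limint .
  qed
  have "S + F = ennreal (enn2real S + enn2real F)"
    using S F by (simp add: ennreal_plus less_top)
  then have lim2: "((\<lambda>T. enn2real (\<integral>\<^sup>+\<omega>. sw T \<omega> \<partial>M)) \<longlongrightarrow> enn2real S + enn2real F) at_top"
    using lim1 by (intro tendsto_enn2real) auto
  have int_eq: "(\<integral>\<omega>. measure lborel (swept T I t A (row 0 \<omega>)) \<partial>M) = enn2real (\<integral>\<^sup>+\<omega>. sw T \<omega> \<partial>M)" for T
  proof -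
    have m: "measure lborel (swept T I t A (row 0 \<omega>)) = enn2real (sw T \<omega>)" for \<omega> by (simp add: measure_def sw_def)
    have "(\<integral>\<omega>. enn2real (sw T \<omega>) \<partial>M) = enn2real (\<integral>\<^sup>+\<omega>. ennreal (enn2real (sw T \<omega>)) \<partial>M)"
      by (intro integral_eq_nn_integral) auto
    also have "(\<integral>\<^sup>+\<omega>. ennreal (enn2real (sw T \<omega>)) \<partial>M) = (\<integral>\<^sup>+\<omega>. sw T \<omega> \<partial>M)"
      using order_le_less_trans[OF sw_le c] by (intro nn_integral_cong) (simp add: less_top)
    finally show ?thesis unfolding m .
  qed
  have "((\<lambda>T. exp (- (lam * (\<integral>\<omega>. measure lborel (swept T I t A (row 0 \<omega>)) \<partial>M)))) \<longlongrightarrow>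
      exp (- (lam * (enn2real S + enn2real F)))) at_top"
    unfolding int_eq by (intro tendsto_intros lim2)
  moreover have "\<forall>\<^sub>F T in at_top. exp (- (lam * (\<integral>\<omega>. measure lborel (swept T I t A (row 0 \<omega>)) \<partial>M))) =
      prob {\<omega>\<in>space M. \<forall>k\<in>I. nodes X V T (t k * T) \<omega> \<inter> A k = {}}"
    using eventually_gt_at_top[of 0] by eventually_elim (rule node_void[OF _ I A t, symmetric])
  ultimately have "((\<lambda>T. prob {\<omega>\<in>space M. \<forall>k\<in>I. nodes X V T (t k * T) \<omega> \<inter> A k = {}}) \<longlongrightarrow>
      exp (- (lam * (enn2real S + enn2real F)))) at_top"
    by (rule Lim_transform_eventually)
  also have "exp (- (lam * (enn2real S + enn2real F))) = exp (- (lam * enn2real S)) * exp (- (lam * enn2real F))"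
    by (simp add: exp_add[symmetric] algebra_simps)
  also have "exp (- (lam * enn2real S)) = N.prob {\<omega>\<in>space N. \<forall>k\<in>I. slow_nodes Xbd (t k) \<omega> \<inter> A k = {}}"
    using slow_void(2)[OF I A t] by (simp add: S_def)
  also have "exp (- (lam * enn2real F)) = (\<Prod>k\<in>I. exp (- (fast_intensity lam M (V 0) (t k) * measure lborel (A k))))"
  proof -
    have "emeasure M {\<omega>\<in>space M. t k \<in> fast_times (row 0 \<omega>)} * emeasure lborel (A k) =
        ennreal (prob {\<omega>\<in>space M. t k \<in> fast_times (row 0 \<omega>)} * measure lborel (A k))" if "k \<in> I" for k
      using Afin[OF that] by (simp add: emeasure_eq_measure emeasure_eq_ennreal_measure less_top ennreal_mult)
    then have "F = (\<Sum>k\<in>I. ennreal (prob {\<omega>\<in>space M. t k \<in> fast_times (row 0 \<omega>)} * measure lborel (A k)))"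
      unfolding F_def by (rule sum.cong[OF refl])
    also have "\<dots> = ennreal (\<Sum>k\<in>I. prob {\<omega>\<in>space M. t k \<in> fast_times (row 0 \<omega>)} * measure lborel (A k))"
      by (rule sum_ennreal) simp
    finally have "enn2real F = (\<Sum>k\<in>I. prob {\<omega>\<in>space M. t k \<in> fast_times (row 0 \<omega>)} * measure lborel (A k))"
      by (simp add: sum_nonneg)
    then show ?thesis
      by (simp add: exp_sum[OF I, symmetric] sum_negf fast_intensity_def sum_distrib_left mult.assoc)
  qed
  finally show ?thesis .
qed

end

section \<open>Void expansions and conditional percolation probabilities\<close>

definition void_expansion :: "real \<Rightarrow> nat \<Rightarrow> 'a::euclidean_space set set \<times> ('a set \<Rightarrow> real) \<Rightarrow> bool" where
  "void_expansion r m p \<longleftrightarrow> finite (fst p) \<and> (\<forall>B\<in>fst p. B \<in> sets borel \<and> bounded B) \<and>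
     (\<forall>\<phi>. coarse_perc r m \<phi> = (\<Sum>B\<in>fst p. snd p B * of_bool (\<phi> \<inter> B = {})))"

text \<open>One expansion is fixed for each \<open>r\<close> and \<open>m\<close>, so that the nodes
  and the limit process are expanded into the same void events with the same coefficients.\<close>

definition void_sets :: "real \<Rightarrow> nat \<Rightarrow> 'a::euclidean_space set set" where
  "void_sets r m = fst (SOME p. void_expansion r m p)"

definition void_coeff :: "real \<Rightarrow> nat \<Rightarrow> 'a::euclidean_space set \<Rightarrow> real" where
  "void_coeff r m = snd (SOME p. void_expansion r m p)"

lemma void_expansion_some: "void_expansion r m (void_sets r m, void_coeff r m :: 'a::euclidean_space set \<Rightarrow> real)"
proof -
  obtain \<B> :: "'a set set" and c where "finite \<B>" "\<And>B. B \<in> \<B> \<Longrightarrow> B \<in> sets borel" "\<And>B. B \<in> \<B> \<Longrightarrow> bounded B"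
    "\<And>\<phi>. coarse_perc r m \<phi> = (\<Sum>B\<in>\<B>. c B * of_bool (\<phi> \<inter> B = {}))"
    by (rule coarse_perc_void_expansion[of r m]) blast
  then have "void_expansion r m (\<B>, c)" by (simp add: void_expansion_def)
  then show ?thesis unfolding void_sets_def void_coeff_def prod.collapse by (rule someI)
qed

lemma void_sets_finite [simp]: "finite (void_sets r m :: 'a::euclidean_space set set)"
  and void_sets_borel: "B \<in> void_sets r m \<Longrightarrow> (B :: 'a set) \<in> sets borel"
  and void_sets_bounded: "B \<in> void_sets r m \<Longrightarrow> bounded (B :: 'a set)"
  and coarse_perc_expand: "coarse_perc r m \<phi> = (\<Sum>B\<in>void_sets r m. void_coeff r m B * of_bool (\<phi> \<inter> B = ({} :: 'a set)))"
  using void_expansion_some[of r m, where ?'a='a] by (auto simp: void_expansion_def)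

lemma position_measurable:
  fixes v :: "nat \<Rightarrow> 'w \<Rightarrow> 'a::euclidean_space"
  assumes v [measurable]: "\<And>j. v j \<in> borel_measurable M" and x [measurable]: "x \<in> borel_measurable M"
    and s [measurable]: "s \<in> borel_measurable M"
  shows "(\<lambda>\<omega>. position T (x \<omega>) (\<lambda>j. v j \<omega>) (s \<omega>)) \<in> borel_measurable M"
proof -
  have [measurable]: "(\<lambda>\<omega>. arrival T (\<lambda>j. v j \<omega>) n) \<in> borel_measurable M" for n
    unfolding arrival_def by measurable
  have [measurable]: "(\<lambda>\<omega>. waypoint T (x \<omega>) (\<lambda>j. v j \<omega>) n) \<in> borel_measurable M" for n
    by (induction n) simp_all
  have [measurable]: "(\<lambda>\<omega>. LEAST j. s \<omega> < arrival T (\<lambda>j. v j \<omega>) (Suc j)) \<in> measurable M (count_space UNIV)"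
    by measurable
  have "(\<lambda>\<omega>. waypoint T (x \<omega>) (\<lambda>j. v j \<omega>) j
        + ((s \<omega> - arrival T (\<lambda>j. v j \<omega>) j) / (arrival T (\<lambda>j. v j \<omega>) (Suc j) - arrival T (\<lambda>j. v j \<omega>) j))
            *\<^sub>R (waypoint T (x \<omega>) (\<lambda>j. v j \<omega>) (Suc j) - waypoint T (x \<omega>) (\<lambda>j. v j \<omega>) j)) \<in> borel_measurable M" for j
    by (intro borel_measurable_add borel_measurable_scaleR borel_measurable_diff borel_measurable_divide)
      (auto simp del: waypoint.simps)
  then show ?thesis
    unfolding position_def Let_def by (rule measurable_compose_countable) measurable
qed

section \<open>The one-time law of the nodes\<close>

context mobility begin

lemma nodes_Suc: "nodes X V T s \<omega> = {position T (X (Suc i) \<omega>) (row (Suc i) \<omega>) s | i. True}"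
proof -
  have "{1..} = range Suc" by (auto simp: image_iff) (metis Suc_le_D)
  then show ?thesis unfolding nodes_def by auto
qed

text \<open>Time and sample point are both maps on a common space \<open>Q\<close>: a constant time
  gives sections, a product space gives joint measurability in time and sample point.\<close>

lemma node_measurable [measurable]:
  assumes [measurable]: "s \<in> borel_measurable Q" "w \<in> measurable Q M"
  shows "(\<lambda>x. position T (X (Suc i) (w x)) (row (Suc i) (w x)) (s x)) \<in> borel_measurable Q"
  by (rule position_measurable)
    (auto intro: measurable_compose[OF assms(2) V_measurable] measurable_compose[OF assms(2) X_measurable])

lemma nodes_perc_measurable:
  assumes [measurable]: "s \<in> borel_measurable Q" "w \<in> measurable Q M"
  shows "(\<lambda>x. perc r (nodes X V T (s x) (w x))) \<in> borel_measurable Q"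
  unfolding nodes_Suc by (rule perc_measurable) measurable

lemma nodes_void_measurable [measurable]:
  assumes B [measurable]: "B \<in> sets borel"
  shows "Measurable.pred M (\<lambda>\<omega>. nodes X V T s \<omega> \<inter> B = {})"
proof -
  have "Measurable.pred M (\<lambda>\<omega>. \<forall>i. position T (X (Suc i) \<omega>) (row (Suc i) \<omega>) s \<notin> B)"
    by measurable
  then show ?thesis unfolding nodes_Suc by (rule measurable_cong[THEN iffD1, rotated]) auto
qed

lemma nodes_coarse_measurable: "(\<lambda>\<omega>. coarse_perc r m (nodes X V T s \<omega>)) \<in> borel_measurable M"
  unfolding coarse_perc_expand
  by (intro borel_measurable_sum borel_measurable_times borel_measurable_const)
    (auto intro!: measurable_compose[OF nodes_void_measurable] void_sets_borel)

text \<open>The mean of \<open>coarse_perc\<close> under a Poisson process of intensity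
  \<open>lam\<close>, written through its void probabilities.\<close>

definition coarse_level :: "real \<Rightarrow> nat \<Rightarrow> real" where
  "coarse_level r m = (\<Sum>B\<in>void_sets r m. void_coeff r m B * exp (- (lam * measure lborel (B :: 'a set))))"

lemma node_void_single:
  assumes T: "T > 0" and t: "t \<in> {0..1}" and B: "B \<in> sets borel" "bounded B"
  shows "prob {\<omega>\<in>space M. nodes X V T (t * T) \<omega> \<inter> B = {}} = exp (- (lam * measure lborel B))"
  using node_void[OF T, of "{()}" "\<lambda>_. B" "\<lambda>_. t"] t B
  by (simp add: swept_single prob_space)

lemma expectation_coarse_nodes:
  assumes T: "T > 0" and t: "t \<in> {0..1}"
  shows "(\<integral>\<omega>. coarse_perc r m (nodes X V T (t * T) \<omega>) \<partial>M) = coarse_level r m"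
proof -
  have s: "{\<omega>\<in>space M. nodes X V T (t * T) \<omega> \<inter> B = {}} \<in> sets M" if "B \<in> void_sets r m" for B
    using nodes_void_measurable[OF void_sets_borel[OF that]] by (simp add: pred_def)
  have "(\<integral>\<omega>. coarse_perc r m (nodes X V T (t * T) \<omega>) \<partial>M) =
      (\<integral>\<omega>. (\<Sum>B\<in>void_sets r m. void_coeff r m B * indicator {\<omega>\<in>space M. nodes X V T (t * T) \<omega> \<inter> B = {}} \<omega>) \<partial>M)"
    by (intro Bochner_Integration.integral_cong refl) (auto simp: coarse_perc_expand indicator_def)
  also have "\<dots> = (\<Sum>B\<in>void_sets r m. \<integral>\<omega>. void_coeff r m B * indicator {\<omega>\<in>space M. nodes X V T (t * T) \<omega> \<inter> B = {}} \<omega> \<partial>M)"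
    by (intro Bochner_Integration.integral_sum integrable_mult_right integrable_real_indicator s) (auto simp: emeasure_eq_measure)
  also have "\<dots> = coarse_level r m"
    unfolding coarse_level_def
  proof (intro sum.cong refl)
    fix B :: "'a set" assume B: "B \<in> void_sets r m"
    then show "(\<integral>\<omega>. void_coeff r m B * indicator {\<omega>\<in>space M. nodes X V T (t * T) \<omega> \<inter> B = {}} \<omega> \<partial>M) = void_coeff r m B * exp (- (lam * measure lborel B))"
      using s[OF B] node_void_single[OF T t void_sets_borel[OF B] void_sets_bounded[OF B]]
      by (simp add: Int_absorb2 del: Collect_mem_eq)
  qed
  finally show ?thesis .
qed

text \<open>No node is displaced by more than \<open>1 + T\<close>, so the nodes in a bounded set
  start in a bounded set. This requires regularity of every row simultaneously, not only of row
  0.\<close>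

lemma nodes_locally_finite:
  assumes T: "T > 0" and t: "t \<in> {0..1}"
  shows "AE \<omega> in M. locally_finite_set (nodes X V T (t * T) \<omega>)"
proof -
  have reg: "AE \<omega> in M. regular_path (row i \<omega>)" for i
  proof -
    interpret R: iid_increments M \<kappa> "V i"
      by unfold_locales (use row_indep_vars V_law atomless in auto)
    show ?thesis by (rule R.AE_regular)
  qed
  then have "AE \<omega> in M. \<forall>i. regular_path (row i \<omega>)" by (simp add: AE_all_countable)
  then show ?thesis using AE_space
  proof eventually_elim
    case (elim \<omega>)
    have lf: "locally_finite_set ((\<lambda>i. X i \<omega>) ` {1..})"
      using poisson_point_processD(2)[OF X_poisson[unfolded homogeneous_poisson_def] elim(2)] .
    show ?case
      unfolding locally_finite_set_def
    proof (intro allI impI)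
      fix B :: "'a set" assume "bounded B"
      then obtain R where R: "\<And>x. x \<in> B \<Longrightarrow> norm x \<le> R" by (auto simp: bounded_iff)
      define J where "J = {i. i \<ge> 1 \<and> X i \<omega> \<in> cball 0 (R + 1 + T)}"
      have inj: "inj_on (\<lambda>i. X i \<omega>) J" using X_distinct[OF elim(2)] by (rule inj_on_subset) (auto simp: J_def)
      have "(\<lambda>i. X i \<omega>) ` J \<subseteq> (\<lambda>i. X i \<omega>) ` {1..} \<inter> cball 0 (R + 1 + T)" by (auto simp: J_def)
      then have "finite ((\<lambda>i. X i \<omega>) ` J)" using locally_finite_Int[OF lf bounded_cball] by (rule finite_subset)
      then have finJ: "finite J" using inj by (simp add: finite_image_iff)
      have "nodes X V T (t * T) \<omega> \<inter> B \<subseteq> (\<lambda>i. position T (X i \<omega>) (row i \<omega>) (t * T)) ` J"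
      proof
        fix y assume y: "y \<in> nodes X V T (t * T) \<omega> \<inter> B"
        then obtain i where i: "i \<ge> 1" "y = position T (X i \<omega>) (row i \<omega>) (t * T)" by (auto simp: nodes_def)
        let ?a = "phase_disp 0 (row i \<omega>) t" and ?b = "T *\<^sub>R phase_disp 1 (row i \<omega>) t"
        have tt: "0 \<le> t" "t \<le> 1" using t by auto
        have "norm ?a \<le> 1" using regular_path.norm_phase_disp[of "row i \<omega>" t 0] elim(1) tt by force
        moreover have "norm (phase_disp 1 (row i \<omega>) t) \<le> 1"
          using regular_path.norm_phase_disp[of "row i \<omega>" t 1] elim(1) tt by force
        then have "norm ?b \<le> T" using T by (simp add: mult_left_le)
        moreover have "X i \<omega> = y - (?a + ?b)" 
          using i(2) position_phase_disp[OF T, of "X i \<omega>" "row i \<omega>" t] by (simp add: algebra_simps)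
        then have "norm (X i \<omega>) \<le> norm y + norm (?a + ?b)" by (metis norm_triangle_ineq4)
        moreover have "norm y \<le> R" using R y by blast
        ultimately have "norm (X i \<omega>) \<le> R + 1 + T" using norm_triangle_ineq[of ?a ?b] by linarith
        then have "i \<in> J" using i(1) by (simp add: J_def)
        then show "y \<in> (\<lambda>i. position T (X i \<omega>) (row i \<omega>) (t * T)) ` J" using i(2) by blast
      qed
      then show "finite (nodes X V T (t * T) \<omega> \<inter> B)" using finJ by (rule finite_subset[OF _ finite_imageI])
    qed
  qed
qed

lemma perc_range: "perc r \<phi> \<in> {0..1}"
  by (simp add: perc_def)

lemma coarse_level_tendsto:
  assumes r: "r > 0" and T: "T > 0" and t: "t \<in> {0..1}"
  shows "coarse_level r \<longlonglongrightarrow> (\<integral>\<omega>. perc r (nodes X V T (t * T) \<omega>) \<partial>M)"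
proof -
  have "(\<lambda>m. \<integral>\<omega>. coarse_perc r m (nodes X V T (t * T) \<omega>) \<partial>M) \<longlonglongrightarrow> (\<integral>\<omega>. perc r (nodes X V T (t * T) \<omega>) \<partial>M)"
  proof (rule integral_dominated_convergence[where w="\<lambda>_. 1"])
    show "AE \<omega> in M. (\<lambda>m. coarse_perc r m (nodes X V T (t * T) \<omega>)) \<longlonglongrightarrow> perc r (nodes X V T (t * T) \<omega>)"
      using nodes_locally_finite[OF T t] by eventually_elim (rule coarse_perc_tendsto[OF r])
    show "AE \<omega> in M. norm (coarse_perc r m (nodes X V T (t * T) \<omega>)) \<le> 1" for m
    proof (rule AE_I2)
      fix \<omega>
      show "norm (coarse_perc r m (nodes X V T (t * T) \<omega>)) \<le> 1"
        using coarse_perc_range[of r m "nodes X V T (t * T) \<omega>"] by simp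
    qed
  qed (auto intro: nodes_perc_measurable nodes_coarse_measurable)
  then show ?thesis unfolding expectation_coarse_nodes[OF T t] .
qed

text \<open>The probability that the nodes percolate from the origin at one time. Defining it as a
  limit of \<open>coarse_level\<close> makes its independence of \<open>T\<close> and of the time
  visible.\<close>

definition perc_level :: "real \<Rightarrow> real" where "perc_level r = lim (coarse_level r)"

lemma expectation_perc_nodes:
  assumes r: "r > 0" and T: "T > 0" and t: "t \<in> {0..1}"
  shows "(\<integral>\<omega>. perc r (nodes X V T (t * T) \<omega>) \<partial>M) = perc_level r"
  unfolding perc_level_def using coarse_level_tendsto[OF assms] by (rule limI[symmetric])

lemma perc_level_tendsto: "r > 0 \<Longrightarrow> coarse_level r \<longlonglongrightarrow> perc_level r"
  using coarse_level_tendsto[of r 1 0] expectation_perc_nodes[of r 1 0] by simp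

end

section \<open>The conditional percolation probability given the slow nodes\<close>

context mobility_limit begin

abbreviation slow_alg :: "real \<Rightarrow> 'v measure" where "slow_alg t \<equiv> generated_algebra N (slow_nodes Xbd t)"

abbreviation fast_int :: "real \<Rightarrow> real" where "fast_int \<equiv> fast_intensity lam M (V 0)"

lemma fast_int_nonneg: "0 \<le> fast_int t"
  using lam_pos by (simp add: fast_intensity_def)

lemma fast_int_measurable [measurable]: "fast_int \<in> borel_measurable borel"
proof -
  have [measurable]: "(\<lambda>p. fst p) \<in> borel_measurable (borel \<Otimes>\<^sub>M M)" "(\<lambda>p. snd p) \<in> measurable (borel \<Otimes>\<^sub>M M) M"
    by measurable
  have "{p\<in>space (borel \<Otimes>\<^sub>M M). fst p \<in> fast_times (row 0 (snd p))} \<in> sets (borel \<Otimes>\<^sub>M M)"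
    using fast_times_pair_measurable[of fst "borel \<Otimes>\<^sub>M M" snd] by (simp add: pred_def)
  from measurable_emeasure_Pair[OF this]
  have "(\<lambda>t. emeasure M {\<omega>\<in>space M. t \<in> fast_times (row 0 \<omega>)}) \<in> borel_measurable borel"
    by (rule measurable_cong[THEN iffD1, rotated]) (auto simp: space_pair_measure intro!: arg_cong[where f="emeasure M"])
  then show ?thesis unfolding fast_intensity_def measure_def by measurable
qed

text \<open>The explicit conditional expectation of the coarse functional of the union given the
  slow nodes: in each void event the fast part is replaced by its probability. Unlike an abstract
  conditional expectation, this formula is jointly measurable in time and sample point.\<close>

definition coarse_cond :: "nat \<Rightarrow> real \<Rightarrow> 'v \<Rightarrow> real" where
  "coarse_cond m t \<omega> = (\<Sum>B\<in>void_sets r m. void_coeff r m B *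
      of_bool (slow_nodes Xbd t \<omega> \<inter> B = {}) * exp (- (fast_int t * measure lborel B)))"

lemma Xbd_enumeration:
  obtains Z :: "nat \<times> nat \<Rightarrow> 'v \<Rightarrow> 'a \<times> real \<times> 'a" and D where "\<And>p. Z p \<in> borel_measurable N" "\<And>p. Measurable.pred N (D p)"
    "\<And>\<omega>. \<omega> \<in> space N \<Longrightarrow> Xbd \<omega> = {Z p \<omega> | p. D p \<omega>}"
  using measurable_enumeration[of N Xbd] poisson_point_processD(2,4)[OF Xbd_poisson] by blast

text \<open>An enumeration of the births is moved along the velocities; \<open>D\<close> selects the
  births that are alive at time \<open>t\<close>. Since time enters by an explicit formula,
  measurability is joint.\<close>

lemma slow_nodes_enumeration:
  obtains Z :: "nat \<times> nat \<Rightarrow> real \<Rightarrow> 'v \<Rightarrow> 'a" and D where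
    "\<And>p. (\<lambda>(t, \<omega>). Z p t \<omega>) \<in> borel_measurable (borel \<Otimes>\<^sub>M N)"
    "\<And>p. Measurable.pred (borel \<Otimes>\<^sub>M N) (\<lambda>(t, \<omega>). D p t \<omega>)"
    "\<And>t \<omega>. \<omega> \<in> space N \<Longrightarrow> slow_nodes Xbd t \<omega> = {Z p t \<omega> | p. D p t \<omega>}"
proof -
  obtain Z :: "nat \<times> nat \<Rightarrow> 'v \<Rightarrow> 'a \<times> real \<times> 'a" and D where Z: "\<And>p. Z p \<in> borel_measurable N"
    and D [measurable]: "\<And>p. Measurable.pred N (D p)"
    and e: "\<And>\<omega>. \<omega> \<in> space N \<Longrightarrow> Xbd \<omega> = {Z p \<omega> | p. D p \<omega>}"
    by (rule Xbd_enumeration) blast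
  have Z' [measurable]: "Z p \<in> measurable N (borel \<Otimes>\<^sub>M (borel \<Otimes>\<^sub>M borel))" for p
    using Z[of p] by (simp only: borel_prod)
  let ?Z = "\<lambda>p t \<omega>. fst (Z p \<omega>) + ((t - fst (snd (Z p \<omega>))) / norm (snd (snd (Z p \<omega>)))) *\<^sub>R snd (snd (Z p \<omega>))"
  let ?D = "\<lambda>p t \<omega>. D p \<omega> \<and> fst (snd (Z p \<omega>)) \<le> t \<and> t \<le> fst (snd (Z p \<omega>)) + norm (snd (snd (Z p \<omega>)))"
  show thesis
  proof (rule that[of ?Z ?D])
    show "(\<lambda>(t, \<omega>). ?Z p t \<omega>) \<in> borel_measurable (borel \<Otimes>\<^sub>M N)" for p
      by measurable
    show "Measurable.pred (borel \<Otimes>\<^sub>M N) (\<lambda>(t, \<omega>). ?D p t \<omega>)" for p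
      by measurable
    show "slow_nodes Xbd t \<omega> = {?Z p t \<omega> | p. ?D p t \<omega>}" if \<omega>: "\<omega> \<in> space N" for t \<omega>
    proof (intro equalityI subsetI)
      fix y assume "y \<in> slow_nodes Xbd t \<omega>"
      then obtain x \<sigma> v where q: "(x, \<sigma>, v) \<in> Xbd \<omega>" "\<sigma> \<le> t" "t \<le> \<sigma> + norm v" "y = x + ((t - \<sigma>) / norm v) *\<^sub>R v"
        unfolding slow_nodes_def by blast
      then obtain p where p: "(x, \<sigma>, v) = Z p \<omega>" "D p \<omega>" using e[OF \<omega>] by blast
      have "fst (Z p \<omega>) = x" "fst (snd (Z p \<omega>)) = \<sigma>" "snd (snd (Z p \<omega>)) = v" using p(1)[symmetric] by auto
      then show "y \<in> {?Z p t \<omega> | p. ?D p t \<omega>}" using q p(2) by (intro CollectI exI[of _ p]) simp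
    next
      fix y assume "y \<in> {?Z p t \<omega> | p. ?D p t \<omega>}"
      then obtain p where p: "y = ?Z p t \<omega>" "?D p t \<omega>" by blast
      then have "Z p \<omega> \<in> Xbd \<omega>" unfolding e[OF \<omega>] by blast
      then have "(fst (Z p \<omega>), fst (snd (Z p \<omega>)), snd (snd (Z p \<omega>))) \<in> Xbd \<omega>" by simp
      then show "y \<in> slow_nodes Xbd t \<omega>" unfolding slow_nodes_def using p by blast
    qed
  qed
qed

lemma slow_void_pair_measurable:
  assumes B [measurable]: "B \<in> sets borel"
  shows "Measurable.pred (borel \<Otimes>\<^sub>M N) (\<lambda>(t, \<omega>). slow_nodes Xbd t \<omega> \<inter> B = {})"
proof -
  obtain Z :: "nat \<times> nat \<Rightarrow> real \<Rightarrow> 'v \<Rightarrow> 'a" and D where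
    [measurable]: "\<And>p. (\<lambda>(t, \<omega>). Z p t \<omega>) \<in> borel_measurable (borel \<Otimes>\<^sub>M N)"
    "\<And>p. Measurable.pred (borel \<Otimes>\<^sub>M N) (\<lambda>(t, \<omega>). D p t \<omega>)"
    and e: "\<And>t \<omega>. \<omega> \<in> space N \<Longrightarrow> slow_nodes Xbd t \<omega> = {Z p t \<omega> | p. D p t \<omega>}"
    by (rule slow_nodes_enumeration) blast
  have "Measurable.pred (borel \<Otimes>\<^sub>M N) (\<lambda>x. \<forall>p. (case x of (t, \<omega>) \<Rightarrow> D p t \<omega>) \<longrightarrow> (case x of (t, \<omega>) \<Rightarrow> Z p t \<omega>) \<notin> B)"
    by measurable
  then show ?thesis
  proof (rule measurable_cong[THEN iffD1, rotated])
    fix x :: "real \<times> 'v" assume "x \<in> space (borel \<Otimes>\<^sub>M N)"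
    then obtain t \<omega> where x: "x = (t, \<omega>)" and \<omega>: "\<omega> \<in> space N" by (auto simp: space_pair_measure)
    have "(\<forall>p. D p t \<omega> \<longrightarrow> Z p t \<omega> \<notin> B) \<longleftrightarrow> slow_nodes Xbd t \<omega> \<inter> B = {}"
      unfolding e[OF \<omega>] by blast
    then show "(\<forall>p. (case x of (t, \<omega>) \<Rightarrow> D p t \<omega>) \<longrightarrow> (case x of (t, \<omega>) \<Rightarrow> Z p t \<omega>) \<notin> B) \<longleftrightarrow>
        (case x of (t, \<omega>) \<Rightarrow> slow_nodes Xbd t \<omega> \<inter> B = {})"
      by (simp add: x)
  qed
qed

lemma coarse_cond_measurable: "(\<lambda>(t, \<omega>). coarse_cond m t \<omega>) \<in> borel_measurable (borel \<Otimes>\<^sub>M N)"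
proof -
  have "(\<lambda>x. \<Sum>B\<in>void_sets r m. void_coeff r m B *
      of_bool (case x of (t, \<omega>) \<Rightarrow> slow_nodes Xbd t \<omega> \<inter> B = {}) * exp (- (fast_int (fst x) * measure lborel B))) \<in> borel_measurable (borel \<Otimes>\<^sub>M N)"
  proof (intro borel_measurable_sum)
    fix B :: "'a set" assume "B \<in> void_sets r m"
    then have [measurable]: "Measurable.pred (borel \<Otimes>\<^sub>M N) (\<lambda>(t, \<omega>). slow_nodes Xbd t \<omega> \<inter> B = {})"
      by (intro slow_void_pair_measurable void_sets_borel)
    show "(\<lambda>x. void_coeff r m B * of_bool (case x of (t, \<omega>) \<Rightarrow> slow_nodes Xbd t \<omega> \<inter> B = {}) *
        exp (- (fast_int (fst x) * measure lborel B))) \<in> borel_measurable (borel \<Otimes>\<^sub>M N)"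
      by measurable
  qed
  then show ?thesis unfolding coarse_cond_def by (simp add: split_beta')
qed

lemma coarse_cond_measurable_section: "coarse_cond m t \<in> borel_measurable N"
  using measurable_compose[OF measurable_Pair1'[of t borel N] coarse_cond_measurable[of m]] by simp

lemma perc_union_measurable:
  assumes t: "t \<in> {0..1}"
  shows "(\<lambda>\<omega>. perc r (slow_nodes Xbd t \<omega> \<union> X' t \<omega>)) \<in> borel_measurable N"
proof -
  obtain Z :: "nat \<times> nat \<Rightarrow> real \<Rightarrow> 'v \<Rightarrow> 'a" and D where
    Z: "\<And>p. (\<lambda>(t, \<omega>). Z p t \<omega>) \<in> borel_measurable (borel \<Otimes>\<^sub>M N)"
    and D: "\<And>p. Measurable.pred (borel \<Otimes>\<^sub>M N) (\<lambda>(t, \<omega>). D p t \<omega>)"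
    and e: "\<And>t \<omega>. \<omega> \<in> space N \<Longrightarrow> slow_nodes Xbd t \<omega> = {Z p t \<omega> | p. D p t \<omega>}"
    by (rule slow_nodes_enumeration) blast
  have Zt: "Z p t \<in> borel_measurable N" for p
    using measurable_compose[OF measurable_Pair1'[of t borel N] Z[of p]] by simp
  have Dt: "Measurable.pred N (D p t)" for p
    using measurable_compose[OF measurable_Pair1'[of t borel N] D[of p]] by simp
  note ppp = X'_poisson[OF t, unfolded homogeneous_poisson_def]
  obtain Z' :: "nat \<times> nat \<Rightarrow> 'v \<Rightarrow> 'a" and D' where Z': "\<And>p. Z' p \<in> borel_measurable N"
    and D': "\<And>p. Measurable.pred N (D' p)" and e': "\<And>\<omega>. \<omega> \<in> space N \<Longrightarrow> X' t \<omega> = {Z' p \<omega> | p. D' p \<omega>}"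
    using measurable_enumeration[of N "X' t"] poisson_point_processD(2,4)[OF ppp] by blast
  \<comment> \<open>The sum type merges the two enumerations into one countable index set.\<close>
  let ?Z = "case_sum (\<lambda>p. Z p t) Z'" and ?D = "case_sum (\<lambda>p. D p t) D'"
  have "(\<lambda>\<omega>. perc r {?Z q \<omega> | q. ?D q \<omega>}) \<in> borel_measurable N"
    by (rule perc_measurable) (auto simp: Zt Dt Z' D' split: sum.split)
  then show ?thesis
  proof (rule measurable_cong[THEN iffD1, rotated])
    fix \<omega> assume \<omega>: "\<omega> \<in> space N"
    have "{?Z q \<omega> | q. ?D q \<omega>} = {Z p t \<omega> | p. D p t \<omega>} \<union> {Z' p \<omega> | p. D' p \<omega>}"
    proof (intro equalityI subsetI)
      fix y assume "y \<in> {?Z q \<omega> | q. ?D q \<omega>}"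
      then obtain q where "y = ?Z q \<omega>" "?D q \<omega>" by blast
      then show "y \<in> {Z p t \<omega> | p. D p t \<omega>} \<union> {Z' p \<omega> | p. D' p \<omega>}" by (cases q) auto
    next
      fix y assume "y \<in> {Z p t \<omega> | p. D p t \<omega>} \<union> {Z' p \<omega> | p. D' p \<omega>}"
      then consider p where "y = Z p t \<omega>" "D p t \<omega>" | p where "y = Z' p \<omega>" "D' p \<omega>" by blast
      then show "y \<in> {?Z q \<omega> | q. ?D q \<omega>}"
      proof cases
        case (1 p)
        then show ?thesis by (intro CollectI exI[of _ "Inl p"]) simp
      next
        case (2 p)
        then show ?thesis by (intro CollectI exI[of _ "Inr p"]) simp
      qed
    qed
    then show "perc r {?Z q \<omega> | q. ?D q \<omega>} = perc r (slow_nodes Xbd t \<omega> \<union> X' t \<omega>)"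
      using e[OF \<omega>] e'[OF \<omega>] by simp
  qed
qed

lemma slow_alg_subalgebra:
  assumes t: "t \<in> {0..1}"
  shows "finite_measure_subalgebra N (slow_alg t)"
proof -
  \<comment> \<open>Independence of two families includes that their members are events, which
    yields the inclusion of the generated algebra.\<close>
  have "sets (slow_alg t) \<subseteq> sets N"
    using X'_indep[OF t] unfolding N.indep_set_def N.indep_sets_def by (auto split: bool.splits dest: spec[of _ True])
  moreover have "space (slow_alg t) = space N"
    unfolding generated_algebra_def by (rule space_measure_of) auto
  ultimately show ?thesis
    by unfold_locales (simp add: subalgebra_def)
qed

lemma generated_algebra_void:
  assumes "B \<in> sets borel" "bounded B"
  shows "{\<omega>\<in>space N. card (\<Phi> \<omega> \<inter> B) = 0} \<in> sets (generated_algebra N \<Phi>)"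
  unfolding generated_algebra_def using assms by (subst sets_measure_of) (auto intro!: sigma_sets.Basic)

end

context mobility_limit begin

definition coarse_union :: "nat \<Rightarrow> real \<Rightarrow> 'v \<Rightarrow> real" where
  "coarse_union m t \<omega> = coarse_perc r m (slow_nodes Xbd t \<omega> \<union> X' t \<omega>)"

definition perc_union :: "real \<Rightarrow> 'v \<Rightarrow> real" where
  "perc_union t \<omega> = perc r (slow_nodes Xbd t \<omega> \<union> X' t \<omega>)"

abbreviation slow_cond :: "real \<Rightarrow> 'v \<Rightarrow> real" where
  "slow_cond t \<equiv> real_cond_exp N (slow_alg t) (perc_union t)"

lemma slow_void_set: "B \<in> sets borel \<Longrightarrow> bounded B \<Longrightarrow> t \<in> {0..1} \<Longrightarrow> {\<omega>\<in>space N. slow_nodes Xbd t \<omega> \<inter> B = {}} \<in> sets N"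
  using slow_void(1)[of "{()}" "\<lambda>_. B" "\<lambda>_. t"] by simp

lemma X'_void:
  assumes t: "t \<in> {0..1}" and B: "B \<in> sets borel" "bounded B"
  shows "{\<omega>\<in>space N. X' t \<omega> \<inter> B = {}} \<in> sets N"
    and "N.prob {\<omega>\<in>space N. X' t \<omega> \<inter> B = {}} = exp (- (fast_int t * measure lborel B))"
    and "{\<omega>\<in>space N. X' t \<omega> \<inter> B = {}} \<in> sets (generated_algebra N (X' t))"
proof -
  note ppp = X'_poisson[OF t, unfolded homogeneous_poisson_def]
  show "{\<omega>\<in>space N. X' t \<omega> \<inter> B = {}} \<in> sets N"
    by (rule poisson_void(1)[OF ppp _ B(1)]) simp
  have "emeasure (scale_measure (ennreal (fast_int t)) lborel) B < \<infinity>"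
    using emeasure_bounded_finite[OF B(2)] by (simp add: ennreal_mult_less_top)
  then show "N.prob {\<omega>\<in>space N. X' t \<omega> \<inter> B = {}} = exp (- (fast_int t * measure lborel B))"
    using poisson_void(2)[OF ppp _ B(1)] fast_int_nonneg[of t] by (simp add: measure_def enn2real_mult)
  have "{\<omega>\<in>space N. X' t \<omega> \<inter> B = {}} = {\<omega>\<in>space N. card (X' t \<omega> \<inter> B) = 0}"
    using locally_finite_Int[OF poisson_point_processD(2)[OF ppp] B(2)] by auto
  then show "{\<omega>\<in>space N. X' t \<omega> \<inter> B = {}} \<in> sets (generated_algebra N (X' t))"
    using generated_algebra_void[OF B, of "X' t"] by simp
qed

lemma coarse_union_expand:
  assumes "\<omega> \<in> space N"
  shows "coarse_union m t \<omega> = (\<Sum>B\<in>void_sets r m. void_coeff r m B *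
     indicator ({\<omega>\<in>space N. slow_nodes Xbd t \<omega> \<inter> B = {}} \<inter> {\<omega>\<in>space N. X' t \<omega> \<inter> B = {}}) \<omega>)"
  unfolding coarse_union_def coarse_perc_expand
  by (intro sum.cong refl) (use assms in \<open>auto simp: indicator_def Int_Un_distrib2\<close>)

lemma coarse_union_measurable:
  assumes t: "t \<in> {0..1}" shows "coarse_union m t \<in> borel_measurable N"
proof -
  have "(\<lambda>\<omega>. \<Sum>B\<in>void_sets r m. void_coeff r m B *
     indicator ({\<omega>\<in>space N. slow_nodes Xbd t \<omega> \<inter> B = {}} \<inter> {\<omega>\<in>space N. X' t \<omega> \<inter> B = {}}) \<omega>) \<in> borel_measurable N"
    by (intro borel_measurable_sum borel_measurable_times borel_measurable_const borel_measurable_indicator sets.Int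
        slow_void_set X'_void(1) t void_sets_borel void_sets_bounded)
  then show ?thesis by (subst measurable_cong[OF coarse_union_expand])
qed

lemma coarse_union_range: "0 \<le> coarse_union m t \<omega>" "coarse_union m t \<omega> \<le> 1"
  using coarse_perc_range[of r m "slow_nodes Xbd t \<omega> \<union> X' t \<omega>"] by (auto simp: coarse_union_def)

lemma coarse_union_integrable:
  assumes t: "t \<in> {0..1}" shows "integrable N (coarse_union m t)"
proof (rule N.integrable_const_bound[of _ 1])
  show "AE \<omega> in N. norm (coarse_union m t \<omega>) \<le> 1"
    using coarse_union_range by (intro AE_I2) simp
qed (rule coarse_union_measurable[OF t])

lemma perc_union_integrable:
  assumes t: "t \<in> {0..1}" shows "integrable N (perc_union t)"
proof (rule N.integrable_const_bound[of _ 1])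
  show "AE \<omega> in N. norm (perc_union t \<omega>) \<le> 1"
    unfolding perc_union_def by (intro AE_I2) (simp add: perc_def)
  show "perc_union t \<in> borel_measurable N"
    unfolding perc_union_def by (rule perc_union_measurable[OF t])
qed

text \<open>Test against an event \<open>A\<close> of the slow algebra: \<open>A\<close> intersected
  with a slow void event is still in that algebra, so independence of \<open>X' t\<close> lets the
  fast void probability factor out of each term.\<close>

lemma coarse_cond_version:
  assumes t: "t \<in> {0..1}"
  shows "AE \<omega> in N. real_cond_exp N (slow_alg t) (coarse_union m t) \<omega> = coarse_cond m t \<omega>"
proof -
  interpret F: finite_measure_subalgebra N "slow_alg t" by (rule slow_alg_subalgebra[OF t])
  \<comment> \<open>The algebra is generated by counts, and \<open>card\<close> is also 0 for an
    infinite set. Count zero therefore agrees with emptiness only where the slow nodes are locally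
    finite, that is almost surely.\<close>
  define Sc where "Sc B = {\<omega>\<in>space N. card (slow_nodes Xbd t \<omega> \<inter> B) = 0}" for B
  define XV where "XV B = {\<omega>\<in>space N. X' t \<omega> \<inter> B = {}}" for B
  let ?BS = "void_sets r m :: 'a set set"
  have Sc: "Sc B \<in> sets (slow_alg t)" if "B \<in> ?BS" for B
    unfolding Sc_def using that by (intro generated_algebra_void void_sets_borel void_sets_bounded)
  have ScN: "Sc B \<in> sets N" if "B \<in> ?BS" for B
    using Sc[OF that] F.subalg by (auto simp: subalgebra_def)
  have XV: "XV B \<in> sets N" "XV B \<in> sets (generated_algebra N (X' t))"
    "N.prob (XV B) = exp (- (fast_int t * measure lborel B))" if "B \<in> ?BS" for B
    unfolding XV_def using X'_void[OF t void_sets_borel[OF that] void_sets_bounded[OF that]] by auto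
  define f where "f \<omega> = (\<Sum>B\<in>?BS. void_coeff r m B * indicator (Sc B \<inter> XV B) \<omega>)" for \<omega>
  define g where "g \<omega> = (\<Sum>B\<in>?BS. void_coeff r m B * exp (- (fast_int t * measure lborel B)) * indicator (Sc B) \<omega>)" for \<omega>
  have fm: "f \<in> borel_measurable N"
    unfolding f_def by (intro borel_measurable_sum borel_measurable_times borel_measurable_const borel_measurable_indicator sets.Int ScN XV)
  have gF: "g \<in> borel_measurable (slow_alg t)"
    unfolding g_def by (intro borel_measurable_sum borel_measurable_times borel_measurable_const borel_measurable_indicator Sc)
  have fi: "integrable N f"
    unfolding f_def by (intro Bochner_Integration.integrable_sum integrable_mult_right integrable_real_indicator sets.Int ScN XV)
      (auto simp: N.emeasure_eq_measure)
  have gi: "integrable N g"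
    unfolding g_def by (intro Bochner_Integration.integrable_sum integrable_mult_right integrable_real_indicator ScN)
      (auto simp: N.emeasure_eq_measure)
  have ae: "AE \<omega> in N. coarse_union m t \<omega> = f \<omega> \<and> coarse_cond m t \<omega> = g \<omega>"
    using slow_nodes_locally_finite[OF t] AE_space
  proof eventually_elim
    case (elim \<omega>)
    have S: "slow_nodes Xbd t \<omega> \<inter> B = {} \<longleftrightarrow> \<omega> \<in> Sc B" if "B \<in> ?BS" for B
      using locally_finite_Int[OF elim(1) void_sets_bounded[OF that]] elim(2) by (simp add: Sc_def)
    have "coarse_union m t \<omega> = f \<omega>"
      unfolding coarse_union_expand[OF elim(2)] f_def
      by (intro sum.cong refl) (use S elim(2) in \<open>auto simp: indicator_def XV_def\<close>)
    moreover have "coarse_cond m t \<omega> = g \<omega>"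
      unfolding coarse_cond_def g_def
      by (intro sum.cong refl) (use S in \<open>auto simp: indicator_def\<close>)
    ultimately show ?case ..
  qed
  have "AE \<omega> in N. real_cond_exp N (slow_alg t) f \<omega> = g \<omega>"
  proof (rule F.real_cond_exp_charact)
    fix A assume A: "A \<in> sets (slow_alg t)"
    then have AN: "A \<in> sets N" using F.subalg by (auto simp: subalgebra_def)
    have "(\<integral>\<omega>\<in>A. f \<omega> \<partial>N) = (\<integral>\<omega>. (\<Sum>B\<in>?BS. void_coeff r m B * indicator (A \<inter> Sc B \<inter> XV B) \<omega>) \<partial>N)"
      unfolding set_lebesgue_integral_def f_def
      by (intro Bochner_Integration.integral_cong refl) (auto simp: indicator_def sum_distrib_left intro!: sum.cong)
    also have "\<dots> = (\<Sum>B\<in>?BS. void_coeff r m B * N.prob (A \<inter> Sc B \<inter> XV B))"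
      by (subst Bochner_Integration.integral_sum)
        (use AN ScN XV in \<open>auto intro!: integrable_mult_right integrable_real_indicator sum.cong simp: N.emeasure_eq_measure\<close>)
    also have "\<dots> = (\<Sum>B\<in>?BS. void_coeff r m B * exp (- (fast_int t * measure lborel B)) * N.prob (A \<inter> Sc B))"
    proof (intro sum.cong refl)
      fix B assume B: "B \<in> ?BS"
      have "N.prob ((A \<inter> Sc B) \<inter> XV B) = N.prob (A \<inter> Sc B) * N.prob (XV B)"
        by (rule N.indep_setD[OF X'_indep[OF t] sets.Int[OF A Sc[OF B]] XV(2)[OF B]])
      then show "void_coeff r m B * N.prob (A \<inter> Sc B \<inter> XV B) =
          void_coeff r m B * exp (- (fast_int t * measure lborel B)) * N.prob (A \<inter> Sc B)"
        using XV(3)[OF B] by simp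
    qed
    also have "\<dots> = (\<integral>\<omega>. (\<Sum>B\<in>?BS. void_coeff r m B * exp (- (fast_int t * measure lborel B)) * indicator (A \<inter> Sc B) \<omega>) \<partial>N)"
      by (subst Bochner_Integration.integral_sum)
        (use AN ScN in \<open>auto intro!: integrable_mult_right integrable_real_indicator sum.cong simp: N.emeasure_eq_measure\<close>)
    also have "\<dots> = (\<integral>\<omega>\<in>A. g \<omega> \<partial>N)"
      unfolding set_lebesgue_integral_def g_def
      by (intro Bochner_Integration.integral_cong refl) (auto simp: indicator_def sum_distrib_left intro!: sum.cong)
    finally show "(\<integral>\<omega>\<in>A. f \<omega> \<partial>N) = (\<integral>\<omega>\<in>A. g \<omega> \<partial>N)" .
  qed (use fi gi gF in auto)
  moreover have "AE \<omega> in N. real_cond_exp N (slow_alg t) (coarse_union m t) \<omega> = real_cond_exp N (slow_alg t) f \<omega>"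
    by (rule F.real_cond_exp_cong) (use ae fm coarse_union_measurable[OF t] in \<open>auto elim: eventually_mono\<close>)
  ultimately show ?thesis using ae by eventually_elim simp
qed

lemma slow_cond_facts:
  assumes t: "t \<in> {0..1}"
  shows "integrable N (slow_cond t)" "(\<integral>\<omega>. slow_cond t \<omega> \<partial>N) = (\<integral>\<omega>. perc_union t \<omega> \<partial>N)"
    "AE \<omega> in N. 0 \<le> slow_cond t \<omega> \<and> slow_cond t \<omega> \<le> 1"
    "integrable N (coarse_cond m t)" "(\<integral>\<omega>. coarse_cond m t \<omega> \<partial>N) = (\<integral>\<omega>. coarse_union m t \<omega> \<partial>N)"
    "AE \<omega> in N. slow_cond t \<omega> \<le> coarse_cond m t \<omega> \<and> coarse_cond m t \<omega> \<le> 1"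
proof -
  interpret F: finite_measure_subalgebra N "slow_alg t" by (rule slow_alg_subalgebra[OF t])
  note pi = perc_union_integrable[OF t] and ci = coarse_union_integrable[OF t, of m]
  note cv = coarse_cond_version[OF t, of m]
  show "integrable N (slow_cond t)" "(\<integral>\<omega>. slow_cond t \<omega> \<partial>N) = (\<integral>\<omega>. perc_union t \<omega> \<partial>N)"
    using F.real_cond_exp_int[OF pi] by auto
  have "AE \<omega> in N. 0 \<le> slow_cond t \<omega>"
    by (rule F.real_cond_exp_ge_c[OF pi]) (simp add: perc_union_def perc_def)
  moreover have "AE \<omega> in N. slow_cond t \<omega> \<le> 1"
    by (rule F.real_cond_exp_le_c[OF pi]) (simp add: perc_union_def perc_def)
  ultimately show "AE \<omega> in N. 0 \<le> slow_cond t \<omega> \<and> slow_cond t \<omega> \<le> 1" by eventually_elim simp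
  have m: "coarse_cond m t \<in> borel_measurable N" by (rule coarse_cond_measurable_section)
  show "integrable N (coarse_cond m t)"
    by (rule integrable_cong_AE_imp[OF F.real_cond_exp_int(1)[OF ci] m]) (use cv in \<open>auto elim: eventually_mono\<close>)
  have "(\<integral>\<omega>. coarse_cond m t \<omega> \<partial>N) = (\<integral>\<omega>. real_cond_exp N (slow_alg t) (coarse_union m t) \<omega> \<partial>N)"
    by (rule integral_cong_AE[OF m]) (use cv in \<open>auto elim: eventually_mono\<close>)
  then show "(\<integral>\<omega>. coarse_cond m t \<omega> \<partial>N) = (\<integral>\<omega>. coarse_union m t \<omega> \<partial>N)"
    using F.real_cond_exp_int(2)[OF ci] by simp
  have "AE \<omega> in N. slow_cond t \<omega> \<le> real_cond_exp N (slow_alg t) (coarse_union m t) \<omega>"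
    by (rule F.real_cond_exp_mono[OF _ pi ci])
      (simp add: perc_union_def coarse_union_def perc_le_coarse_perc[OF r_pos])
  moreover have "AE \<omega> in N. real_cond_exp N (slow_alg t) (coarse_union m t) \<omega> \<le> 1"
    by (rule F.real_cond_exp_le_c[OF ci]) (simp add: coarse_union_range)
  ultimately show "AE \<omega> in N. slow_cond t \<omega> \<le> coarse_cond m t \<omega> \<and> coarse_cond m t \<omega> \<le> 1"
    using cv by eventually_elim simp
qed

lemma coarse_union_tendsto:
  assumes t: "t \<in> {0..1}"
  shows "(\<lambda>m. \<integral>\<omega>. coarse_cond m t \<omega> \<partial>N) \<longlonglongrightarrow> (\<integral>\<omega>. slow_cond t \<omega> \<partial>N)"
  unfolding slow_cond_facts(2,5)[OF t]
proof (rule integral_dominated_convergence[where w="\<lambda>_. 1"])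
  note ppp = X'_poisson[OF t, unfolded homogeneous_poisson_def]
  show "AE \<omega> in N. (\<lambda>m. coarse_union m t \<omega>) \<longlonglongrightarrow> perc_union t \<omega>"
    using slow_nodes_locally_finite[OF t] AE_space
  proof eventually_elim
    case (elim \<omega>)
    have "locally_finite_set (slow_nodes Xbd t \<omega> \<union> X' t \<omega>)"
      using elim(1) poisson_point_processD(2)[OF ppp elim(2)] by (simp add: locally_finite_set_def Int_Un_distrib2)
    then show ?case unfolding coarse_union_def perc_union_def by (rule coarse_perc_tendsto[OF r_pos])
  qed
  show "AE \<omega> in N. norm (coarse_union m t \<omega>) \<le> 1" for m
    using coarse_union_range by (intro AE_I2) simp
qed (use perc_union_integrable[OF t] coarse_union_measurable[OF t] in auto)

text \<open>An infimum fits because every coarse level bounds the percolation indicator from above.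
  The truncation ensures values in the unit interval everywhere, whereas \<open>coarse_cond\<close>
  is known to lie there only almost surely.\<close>

definition cond_perc :: "real \<Rightarrow> 'v \<Rightarrow> real" where
  "cond_perc t \<omega> = (INF m. max 0 (min 1 (coarse_cond m t \<omega>)))"

lemma cond_perc_bdd: "bdd_below (range (\<lambda>m. max 0 (min 1 (coarse_cond m t \<omega>))))"
  by (intro bdd_belowI[of _ 0]) auto

lemma cond_perc_range: "0 \<le> cond_perc t \<omega>" "cond_perc t \<omega> \<le> 1"
proof -
  show "0 \<le> cond_perc t \<omega>" unfolding cond_perc_def by (rule cINF_greatest) auto
  show "cond_perc t \<omega> \<le> 1" unfolding cond_perc_def
    by (rule cINF_lower2[OF cond_perc_bdd, of 0]) auto
qed

lemma cond_perc_measurable: "(\<lambda>(t, \<omega>). cond_perc t \<omega>) \<in> borel_measurable (borel \<Otimes>\<^sub>M N)"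
proof -
  have [measurable]: "(\<lambda>x. coarse_cond m (fst x) (snd x)) \<in> borel_measurable (borel \<Otimes>\<^sub>M N)" for m
    using coarse_cond_measurable[of m] by (simp add: split_beta')
  have "(\<lambda>x. INF m. max 0 (min 1 (coarse_cond m (fst x) (snd x)))) \<in> borel_measurable (borel \<Otimes>\<^sub>M N)"
    by (rule borel_measurable_cINF) (auto intro: cond_perc_bdd)
  then show ?thesis by (simp add: cond_perc_def split_beta')
qed

text \<open>Almost surely \<open>cond_perc\<close> lies between the conditional expectation and each
  \<open>coarse_cond m\<close>. The means of the outer two become equal as \<open>m\<close> grows,
  so the nonnegative difference has mean zero. Monotonicity in \<open>m\<close> does not
  enter.\<close>

lemma cond_perc_version:
  assumes t: "t \<in> {0..1}"
  shows "AE \<omega> in N. cond_perc t \<omega> = slow_cond t \<omega>"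
proof -
  note F = slow_cond_facts[OF t]
  have cm: "cond_perc t \<in> borel_measurable N"
    using measurable_compose[OF measurable_Pair1'[of t borel N] cond_perc_measurable] by simp
  have ci: "integrable N (cond_perc t)"
    by (rule N.integrable_const_bound[of _ 1]) (use cond_perc_range cm in auto)
  have le: "AE \<omega> in N. \<forall>m. slow_cond t \<omega> \<le> coarse_cond m t \<omega> \<and> coarse_cond m t \<omega> \<le> 1"
    using F(6) by (simp add: AE_all_countable)
  have lo: "AE \<omega> in N. 0 \<le> cond_perc t \<omega> - slow_cond t \<omega>"
    using le F(3)
  proof eventually_elim
    case (elim \<omega>)
    have "slow_cond t \<omega> \<le> cond_perc t \<omega>"
      unfolding cond_perc_def by (rule cINF_greatest) (use elim in \<open>auto simp: le_max_iff_disj\<close>)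
    then show ?case by simp
  qed
  have up: "(\<integral>\<omega>. cond_perc t \<omega> - slow_cond t \<omega> \<partial>N) \<le> (\<integral>\<omega>. coarse_cond m t \<omega> \<partial>N) - (\<integral>\<omega>. slow_cond t \<omega> \<partial>N)" for m
  proof -
    have "(\<integral>\<omega>. cond_perc t \<omega> - slow_cond t \<omega> \<partial>N) \<le> (\<integral>\<omega>. coarse_cond m t \<omega> - slow_cond t \<omega> \<partial>N)"
    proof (rule integral_mono_AE)
      show "AE \<omega> in N. cond_perc t \<omega> - slow_cond t \<omega> \<le> coarse_cond m t \<omega> - slow_cond t \<omega>"
        using le F(3)
      proof eventually_elim
        case (elim \<omega>)
        have "cond_perc t \<omega> \<le> max 0 (min 1 (coarse_cond m t \<omega>))"
          unfolding cond_perc_def by (rule cINF_lower[OF cond_perc_bdd]) simp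
        also have "\<dots> = coarse_cond m t \<omega>" using elim by (metis max.absorb2 min.absorb2 order_trans)
        finally show ?case by simp
      qed
    qed (use ci F in auto)
    then show ?thesis using F by simp
  qed
  have "(\<lambda>m. (\<integral>\<omega>. coarse_cond m t \<omega> \<partial>N) - (\<integral>\<omega>. slow_cond t \<omega> \<partial>N)) \<longlonglongrightarrow> 0"
    using tendsto_diff[OF coarse_union_tendsto[OF t] tendsto_const[of "\<integral>\<omega>. slow_cond t \<omega> \<partial>N"]] by simp
  then have "(\<integral>\<omega>. cond_perc t \<omega> - slow_cond t \<omega> \<partial>N) \<le> 0"
    by (rule LIMSEQ_le_const) (use up in auto)
  moreover have "0 \<le> (\<integral>\<omega>. cond_perc t \<omega> - slow_cond t \<omega> \<partial>N)"
    by (rule integral_nonneg_AE[OF lo])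
  ultimately have "(\<integral>\<omega>. cond_perc t \<omega> - slow_cond t \<omega> \<partial>N) = 0" by simp
  then have "AE \<omega> in N. cond_perc t \<omega> - slow_cond t \<omega> = 0"
    using integral_nonneg_eq_0_iff_AE[OF _ lo] ci F(1) by auto
  then show ?thesis by eventually_elim simp
qed

lemma conditional_perc_version_exists: "conditional_perc_version r N (slow_nodes Xbd) X' cond_perc"
  unfolding conditional_perc_version_def
proof (intro conjI ballI)
  have id: "(\<lambda>x. (fst x, snd x)) \<in> measurable (restrict_space borel {0..1} \<Otimes>\<^sub>M N) (borel \<Otimes>\<^sub>M N)"
    by (intro measurable_Pair measurable_snd measurable_compose[OF measurable_fst] measurable_restrict_space1) simp
  show "(\<lambda>(t, \<omega>). cond_perc t \<omega>) \<in> borel_measurable (restrict_space borel {0..1} \<Otimes>\<^sub>M N)"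
    using measurable_compose[OF id cond_perc_measurable] by (simp add: split_beta')
  show "cond_perc t \<omega> \<in> {0..1}" for t \<omega> using cond_perc_range by simp
  show "AE \<omega> in N. cond_perc t \<omega> = real_cond_exp N (slow_alg t) (\<lambda>\<omega>'. perc r (slow_nodes Xbd t \<omega>' \<union> X' t \<omega>')) \<omega>"
    if "t \<in> {0..1}" for t
    using cond_perc_version[OF that] unfolding perc_union_def .
qed

end

section \<open>Weak convergence of random densities\<close>

text \<open>Distribution functions of measures on the unit interval with a density in
  \<open>{0..1}\<close>, extended to the whole line by constants. Both the empirical measures and
  the limit live here.\<close>

definition lip_cdfs :: "(real \<Rightarrow> real) set" where
  "lip_cdfs = {H. (\<forall>x y. x \<le> y \<longrightarrow> H x \<le> H y \<and> H y - H x \<le> y - x) \<and>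
     (\<forall>x\<le>0. H x = 0) \<and> (\<forall>x\<ge>1. H x = H 1)}"

lemma lip_cdfsD:
  assumes "H \<in> lip_cdfs"
  shows "x \<le> y \<Longrightarrow> H x \<le> H y" "x \<le> y \<Longrightarrow> H y - H x \<le> y - x" "x \<le> 0 \<Longrightarrow> H x = 0" "x \<ge> 1 \<Longrightarrow> H x = H 1"
  using assms unfolding lip_cdfs_def by blast+

lemma lip_cdfs_bounds:
  assumes "H \<in> lip_cdfs" shows "0 \<le> H x" "H x \<le> 1"
proof -
  have "H 0 = 0" "H 1 - H 0 \<le> 1"
    using lip_cdfsD(2)[OF assms, of 0 1] lip_cdfsD(3)[OF assms, of 0] by auto
  then show "0 \<le> H x" "H x \<le> 1"
    using lip_cdfsD(1)[OF assms, of 0 x] lip_cdfsD(1)[OF assms, of x 1] lip_cdfsD(3)[OF assms, of x]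
      lip_cdfsD(4)[OF assms, of x]
    by linarith+
qed

lemma lip_cdfs_continuous:
  assumes "H \<in> lip_cdfs" shows "continuous_on UNIV H"
proof (rule uniformly_continuous_imp_continuous)
  have "dist (H x) (H y) \<le> 1 * dist x y" for x y
    using lip_cdfsD(1,2)[OF assms, of x y] lip_cdfsD(1,2)[OF assms, of y x]
    by (cases "x \<le> y") (auto simp: dist_real_def)
  then show "uniformly_continuous_on UNIV H"
    unfolding uniformly_continuous_on_def by (metis mult_1 dist_commute order.strict_trans1)
qed

text \<open>Tychonoff: in the topology of pointwise convergence this is a closed subset of a product
  of unit intervals, each condition involving at most two evaluations.\<close>

lemma compact_lip_cdfs: "compact lip_cdfs"
proof -
  have "compactin (product_topology (\<lambda>_. euclidean) UNIV) (PiE UNIV (\<lambda>_::real. {0..1::real}))"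
    by (subst compactin_PiE) auto
  then have c: "compact (PiE UNIV (\<lambda>_::real. {0..1::real}))"
    by (simp add: euclidean_product_topology)
  have eval [continuous_intros]: "continuous_on UNIV (\<lambda>H :: real \<Rightarrow> real. H x)" for x
    by simp
  have "lip_cdfs = (\<Inter>p\<in>{p. fst p \<le> snd p}. {H. H (fst p) \<le> H (snd p)} \<inter> {H. H (snd p) - H (fst p) \<le> snd p - fst p})
      \<inter> (\<Inter>x\<in>{..0}. {H. H x = 0}) \<inter> (\<Inter>x\<in>{1..}. {H. H x = H 1})"
    by (auto simp: lip_cdfs_def)
  moreover have "closed \<dots>"
    by (intro closed_Int closed_INT ballI closed_Collect_le closed_Collect_eq continuous_intros)
  ultimately have "closed lip_cdfs" by simp
  moreover have "lip_cdfs \<subseteq> PiE UNIV (\<lambda>_. {0..1})"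
    using lip_cdfs_bounds by auto
  ultimately show ?thesis
    using c compact_Int_closed by (metis inf.absorb_iff2)
qed

definition cdf_measure :: "(real \<Rightarrow> real) \<Rightarrow> real measure" where
  "cdf_measure H = restrict_space (interval_measure H) {0..1}"

lemma sets_cdf_measure: "sets (cdf_measure H) = sets (restrict_space borel {0..1})"
  unfolding cdf_measure_def by (intro sets_restrict_space_cong) simp

lemma space_cdf_measure [simp]: "space (cdf_measure H) = {0..1}"
  by (simp add: cdf_measure_def space_restrict_space)

lemma emeasure_cdf_measure:
  assumes H: "H \<in> lip_cdfs" and "0 \<le> a" "a \<le> b" "b \<le> 1"
  shows "emeasure (cdf_measure H) {a<..b} = ennreal (H b - H a)"
    and "emeasure (cdf_measure H) {a..b} = ennreal (H b - H a)"
proof -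
  note c = lip_cdfs_continuous[OF H]
  have rc: "continuous (at_right a) H" for a
    using c by (auto simp: continuous_on_eq_continuous_within intro: continuous_within_subset)
  show "emeasure (cdf_measure H) {a<..b} = ennreal (H b - H a)"
    unfolding cdf_measure_def
    by (subst emeasure_restrict_space) (use assms lip_cdfsD(1)[OF H] rc in \<open>auto simp: emeasure_interval_measure_Ioc\<close>)
  show "emeasure (cdf_measure H) {a..b} = ennreal (H b - H a)"
    unfolding cdf_measure_def
    by (subst emeasure_restrict_space) (use assms lip_cdfsD(1)[OF H] c in \<open>auto simp: emeasure_interval_measure_Icc\<close>)
qed

lemma finite_measure_cdf_measure:
  assumes H: "H \<in> lip_cdfs" shows "finite_measure (cdf_measure H)"
  by (rule finite_measureI) (use emeasure_cdf_measure(2)[OF H, of 0 1] in simp)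

text \<open>The error bound is the same for all \<open>H\<close>, because every such measure has
  total mass at most 1.\<close>

lemma cdf_measure_Riemann_sum:
  assumes H: "H \<in> lip_cdfs" and f: "continuous_on {0..1} f" and n: "n > 0"
    and e: "\<And>x y. x \<in> {0..1} \<Longrightarrow> y \<in> {0..1} \<Longrightarrow> \<bar>x - y\<bar> \<le> 1 / real n \<Longrightarrow> \<bar>f x - f y\<bar> \<le> e"
  shows "\<bar>(\<integral>x. f x \<partial>cdf_measure H) - (\<Sum>i<n. f (real (Suc i) / n) * (H (real (Suc i) / n) - H (real i / n)))\<bar> \<le> e"
proof -
  interpret finite_measure "cdf_measure H" by (rule finite_measure_cdf_measure[OF H])
  define g where "g = (\<lambda>x. \<Sum>i<n. f (real (Suc i) / n) * indicator {real i / n<..real (Suc i) / n} x)"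
  have e0: "e \<ge> 0" using e[of 0 0] by auto
  have I: "{real i / n<..real (Suc i) / n} \<in> sets (cdf_measure H)" if "i < n" for i
  proof -
    have "real (Suc i) / n \<le> 1" using that n by (simp add: field_simps)
    then have "{real i / n<..real (Suc i) / n} = {real i / n<..real (Suc i) / n} \<inter> {0..1}"
      by (auto intro: order_trans[OF _ less_imp_le] simp: order_trans)
        (metis divide_nonneg_nonneg less_le_trans linorder_not_less nle_le of_nat_0_le_iff)
    then show ?thesis
      unfolding sets_cdf_measure by (subst sets_restrict_space_iff) auto
  qed
  have ms: "measure (cdf_measure H) {real i / n<..real (Suc i) / n} = H (real (Suc i) / n) - H (real i / n)" if "i < n" for i
  proof -
    have "real (Suc i) / n \<le> 1" "real i / n \<le> real (Suc i) / n"
      using that n by (auto simp: field_simps)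
    then show ?thesis
      using emeasure_cdf_measure(1)[OF H, of "real i / n" "real (Suc i) / n"] lip_cdfsD(1)[OF H, of "real i / n" "real (Suc i) / n"]
      by (simp add: measure_def)
  qed
  have ig: "integrable (cdf_measure H) g" unfolding g_def
    by (intro Bochner_Integration.integrable_sum integrable_mult_right integrable_real_indicator I) (auto simp: emeasure_eq_measure)
  have gI: "(\<integral>x. g x \<partial>cdf_measure H) = (\<Sum>i<n. f (real (Suc i) / n) * (H (real (Suc i) / n) - H (real i / n)))"
    unfolding g_def
    apply (subst Bochner_Integration.integral_sum)
     apply (intro integrable_mult_right integrable_real_indicator I; auto simp: emeasure_eq_measure)
    apply (intro sum.cong refl)
    apply (subst integral_mult_right_zero)
    using ms sets.sets_into_space[OF I] by (simp add: Int_absorb2 del: of_nat_Suc)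
  have fm: "f \<in> borel_measurable (cdf_measure H)"
    using borel_measurable_continuous_on_restrict[OF f] sets_cdf_measure[of H] measurable_cong_sets by blast
  obtain B where B: "\<And>x. x \<in> {0..1} \<Longrightarrow> \<bar>f x\<bar> \<le> B"
    using compact_imp_bounded[OF compact_continuous_image[OF f compact_Icc]] unfolding bounded_iff by fastforce
  have if': "integrable (cdf_measure H) f"
    by (rule integrable_const_bound[of _ B]) (use B fm in auto)
  have ae: "AE x in cdf_measure H. \<bar>f x - g x\<bar> \<le> e"
  \<comment> \<open>The half-open cells miss the point 0, which carries no mass since
    \<open>H\<close> is continuous.\<close>
  proof (rule AE_I[where N="{0..0}"])
    show "emeasure (cdf_measure H) {0..0} = 0"
      using emeasure_cdf_measure(2)[OF H, of 0 0] by simp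
    show "{0..0} \<in> sets (cdf_measure H)"
      unfolding sets_cdf_measure by (subst sets_restrict_space_iff) auto
    show "{x \<in> space (cdf_measure H). \<not> \<bar>f x - g x\<bar> \<le> e} \<subseteq> {0..0}"
    proof (rule subsetI, rule ccontr)
      fix x assume x: "x \<in> {x \<in> space (cdf_measure H). \<not> \<bar>f x - g x\<bar> \<le> e}" "x \<notin> {0..0}"
      then have x01: "0 < x" "x \<le> 1" by auto
      \<comment> \<open>The cell of \<open>x > 0\<close> is open on the left, hence the ceiling
        minus one and not the floor.\<close>
      define i where "i = nat (\<lceil>n * x\<rceil> - 1)"
      have "n * x > 0" using x01 n by simp
      then have ci: "real_of_int \<lceil>n * x\<rceil> = real (Suc i)" unfolding i_def by simp
      have i1: "real i < n * x" "n * x \<le> real (Suc i)" using ci by linarith+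
      have "n * x \<le> n" using x01 n by (simp add: mult_left_le)
      then have "i < n" using i1 by linarith
      have *: "indicator {real j / n<..real (Suc j) / n} x = (if j = i then 1 else 0 :: real)" for j
      proof -
        have "x \<in> {real j / n<..real (Suc j) / n} \<longleftrightarrow> real j < n * x \<and> n * x \<le> real (Suc j)"
          using n by (auto simp: field_simps)
        also have "\<dots> \<longleftrightarrow> j = i" using i1 by auto
        finally show ?thesis by (simp add: indicator_def)
      qed
      have "g x = f (real (Suc i) / n)"
        unfolding g_def * using \<open>i < n\<close> by (simp add: if_distrib sum.delta cong: if_cong)
      moreover have "\<bar>x - real (Suc i) / n\<bar> \<le> 1 / n" "real (Suc i) / n \<le> 1"
        using i1 n \<open>i < n\<close> by (auto simp: field_simps abs_if)
      ultimately have "\<bar>f x - g x\<bar> \<le> e"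
        using e[of x "real (Suc i) / n"] x01 by auto
      with x show False by auto
    qed
  qed
  have "\<bar>(\<integral>x. f x \<partial>cdf_measure H) - (\<integral>x. g x \<partial>cdf_measure H)\<bar> = \<bar>\<integral>x. f x - g x \<partial>cdf_measure H\<bar>"
    using if' ig by simp
  also have "\<dots> \<le> (\<integral>x. \<bar>f x - g x\<bar> \<partial>cdf_measure H)"
    by (rule integral_abs_bound)
  also have "\<dots> \<le> (\<integral>x. e \<partial>cdf_measure H)"
    by (rule integral_mono_AE) (use if' ig ae in auto)
  also have "\<dots> \<le> e"
    using emeasure_cdf_measure(2)[OF H, of 0 1] lip_cdfs_bounds[OF H, of 1] lip_cdfsD(3)[OF H, of 0] e0
    by (simp add: measure_def mult_left_le_one_le)
  finally show ?thesis using gI by simp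
qed

text \<open>Each Riemann sum involves finitely many evaluations of \<open>H\<close>, so it is
  continuous for pointwise convergence, and the sums converge uniformly on
  \<open>lip_cdfs\<close>.\<close>

lemma continuous_on_integral_cdf_measure:
  fixes f :: "real \<Rightarrow> real"
  assumes f: "continuous_on {0..1} f"
  shows "continuous_on lip_cdfs (\<lambda>H. \<integral>x. f x \<partial>cdf_measure H)"
proof (rule uniform_limit_theorem[of _ _ sequentially])
  let ?R = "\<lambda>n H. \<Sum>i<Suc n. f (real (Suc i) / Suc n) * (H (real (Suc i) / Suc n) - H (real i / Suc n))"
  show "\<forall>\<^sub>F n in sequentially. continuous_on lip_cdfs (?R n)"
    by (intro always_eventually allI continuous_intros continuous_on_subset[OF continuous_on_product_coordinates]) auto
  show "uniform_limit lip_cdfs ?R (\<lambda>H. \<integral>x. f x \<partial>cdf_measure H) sequentially"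
  proof (rule uniform_limitI)
    fix e :: real assume e: "e > 0"
    have "uniformly_continuous_on {0..1} f" by (rule compact_uniformly_continuous[OF f compact_Icc])
    then obtain d where d: "d > 0" "\<And>x y. x \<in> {0..1} \<Longrightarrow> y \<in> {0..1} \<Longrightarrow> \<bar>y - x\<bar> < d \<Longrightarrow> \<bar>f y - f x\<bar> < e/2"
      by (rule uniformly_continuous_onE[OF _ half_gt_zero[OF e]]) (auto simp: dist_real_def)
    obtain n0 where n0: "1 / real (Suc n0) < d" using nat_approx_posE[OF d(1)] by (metis )
    show "\<forall>\<^sub>F n in sequentially. \<forall>H\<in>lip_cdfs. dist (?R n H) (\<integral>x. f x \<partial>cdf_measure H) < e"
      unfolding eventually_sequentially
    proof (intro exI allI impI ballI)
      fix n H assume n: "n \<ge> n0" and H: "H \<in> lip_cdfs"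
      have "1 / real (Suc n) \<le> 1 / real (Suc n0)" using n by (simp add: frac_le)
      then have "\<bar>f x - f y\<bar> \<le> e/2" if "x \<in> {0..1}" "y \<in> {0..1}" "\<bar>x - y\<bar> \<le> 1 / real (Suc n)" for x y
        using d(2)[of y x] that n0 by auto
      from cdf_measure_Riemann_sum[OF H f _ this, of "Suc n"]
      show "dist (?R n H) (\<integral>x. f x \<partial>cdf_measure H) < e"
        using e by (simp add: dist_real_def abs_minus_commute)
    qed
  qed
qed auto

text \<open>Test functions on the space of measures become continuous functions on a compact set of
  functions, where polynomial approximation is available.\<close>

lemma continuous_map_cdf_measure:
  "continuous_map (top_of_set lip_cdfs) (weak_measure_topology {0..1}) cdf_measure"
  unfolding weak_measure_topology_def
proof (rule continuous_on_generated_topo)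
  fix W assume "W \<in> {{\<mu>. sets \<mu> = sets (restrict_space borel {0..1}) \<and> finite_measure \<mu> \<and> integral\<^sup>L \<mu> f \<in> U} |f U.
             continuous_on {0..1} f \<and> bounded (f ` {0..1::real}) \<and> open (U :: real set)}"
  then obtain f U where f: "continuous_on {0..1} f" and U: "open (U :: real set)"
    and W: "W = {\<mu>. sets \<mu> = sets (restrict_space borel {0..1}) \<and> finite_measure \<mu> \<and> integral\<^sup>L \<mu> f \<in> U}" by blast
  have "cdf_measure -` W \<inter> topspace (top_of_set lip_cdfs) = lip_cdfs \<inter> (\<lambda>H. \<integral>x. f x \<partial>cdf_measure H) -` U"
    using sets_cdf_measure finite_measure_cdf_measure by (auto simp: W)
  then show "openin (top_of_set lip_cdfs) (cdf_measure -` W \<inter> topspace (top_of_set lip_cdfs))"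
    using continuous_openin_preimage_gen[OF continuous_on_integral_cdf_measure[OF f] U] by simp
next
  have "cdf_measure ` lip_cdfs \<subseteq> topspace (weak_measure_topology {0..1})"
    using sets_cdf_measure finite_measure_cdf_measure by (auto simp: topspace_weak_measure_topology)
  then show "cdf_measure ` topspace (top_of_set lip_cdfs) \<subseteq> \<Union> {{\<mu>. sets \<mu> = sets (restrict_space borel {0..1}) \<and> finite_measure \<mu> \<and> integral\<^sup>L \<mu> f \<in> U} |f U.
             continuous_on {0..1} f \<and> bounded (f ` {0..1::real}) \<and> open (U :: real set)}"
    by (simp add: weak_measure_topology_def topology_generated_by_topspace)
qed

section \<open>Distribution functions of densities on the unit interval\<close>

definition cdf_of :: "(real \<Rightarrow> real) \<Rightarrow> real \<Rightarrow> real" where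
  "cdf_of h x = (\<integral>t. indicator {..x} t * h t \<partial>unit_lborel)"

lemma indicator_measurable_unit [measurable]: "(\<lambda>t. indicator {..x} t :: real) \<in> borel_measurable unit_lborel"
  by (intro measurable_restrict_space1) measurable

context
  fixes h :: "real \<Rightarrow> real"
  assumes h [measurable]: "h \<in> borel_measurable unit_lborel"
    and hb: "\<And>t. t \<in> {0..1} \<Longrightarrow> h t \<in> {0..1}"
begin

interpretation prob_space unit_lborel by (rule prob_space_unit_lborel)

lemma cdf_of_integrable: "integrable unit_lborel (\<lambda>t. indicator {..x} t * h t)"
proof (rule integrable_const_bound[of _ 1])
  have "norm (indicator {..x} t * h t) \<le> 1" if "t \<in> {0..1}" for t
    using hb[OF that] by (auto simp: indicator_def)
  then show "AE t in unit_lborel. norm (indicator {..x} t * h t) \<le> 1"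
    by (intro AE_I2) simp
qed measurable

lemma measure_unit_lborel_Ioc_le:
  assumes "x \<le> y"
  shows "measure unit_lborel ({x<..y} \<inter> {0..1}) \<le> y - x"
proof -
  have "measure unit_lborel ({x<..y} \<inter> {0..1}) = measure lborel ({x<..y} \<inter> {0..1})"
    by (rule measure_restrict_space) auto
  also have "\<dots> \<le> measure lborel {x<..y}"
    by (rule measure_mono_fmeasurable) (use assms in \<open>auto simp: fmeasurable_def\<close>)
  finally show ?thesis using assms by simp
qed

lemma cdf_of_in_lip_cdfs: "cdf_of h \<in> lip_cdfs"
  unfolding lip_cdfs_def
proof (intro CollectI conjI allI impI)
  fix x y :: real assume xy: "x \<le> y"
  have "cdf_of h y - cdf_of h x = (\<integral>t. indicator {..y} t * h t - indicator {..x} t * h t \<partial>unit_lborel)"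
    unfolding cdf_of_def using cdf_of_integrable by (subst Bochner_Integration.integral_diff) auto
  also have "\<dots> = (\<integral>t. indicator ({x<..y} \<inter> {0..1}) t * h t \<partial>unit_lborel)"
    by (intro Bochner_Integration.integral_cong) (use xy in \<open>auto simp: indicator_def\<close>)
  finally have eq: "cdf_of h y - cdf_of h x = (\<integral>t. indicator ({x<..y} \<inter> {0..1}) t * h t \<partial>unit_lborel)" .
  have "{x<..y} \<inter> {0..1} \<in> sets unit_lborel"
    by (subst sets_restrict_space_iff) auto
  then have int: "integrable unit_lborel (\<lambda>t. indicator ({x<..y} \<inter> {0..1}) t :: real)"
    by (intro integrable_real_indicator) (auto simp: emeasure_eq_measure)
  have "0 \<le> (\<integral>t. indicator ({x<..y} \<inter> {0..1}) t * h t \<partial>unit_lborel)"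
    using hb by (intro Bochner_Integration.integral_nonneg) (simp add: indicator_def)
  then show "cdf_of h x \<le> cdf_of h y" using eq by simp
  have "(\<integral>t. indicator ({x<..y} \<inter> {0..1}) t * h t \<partial>unit_lborel) \<le> (\<integral>t. indicator ({x<..y} \<inter> {0..1}) t \<partial>unit_lborel)"
  proof (rule integral_mono'[OF int])
    fix t assume "t \<in> space unit_lborel"
    then show "indicator ({x<..y} \<inter> {0..1}) t * h t \<le> indicator ({x<..y} \<inter> {0..1}) t"
      using hb[of t] by (simp add: indicator_def)
  qed simp
  also have "\<dots> \<le> y - x"
    using measure_unit_lborel_Ioc_le[OF xy] by (simp add: Int_assoc)
  finally show "cdf_of h y - cdf_of h x \<le> y - x" using eq by simp
next
  fix x :: real assume "x \<le> 0"
  have "AE t in unit_lborel. t \<noteq> 0"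
    using AE_lborel_singleton[of 0] by (subst AE_restrict_space_iff) (auto elim: eventually_mono)
  then have "cdf_of h x = (\<integral>t. 0 \<partial>unit_lborel)"
    unfolding cdf_of_def
  proof (intro integral_cong_AE)
    show "AE t in unit_lborel. indicator {..x} t * h t = 0"
      using \<open>AE t in unit_lborel. t \<noteq> 0\<close> AE_space
      by eventually_elim (use \<open>x \<le> 0\<close> in \<open>simp add: indicator_def\<close>)
  qed measurable
  then show "cdf_of h x = 0" by simp
next
  fix x :: real assume "1 \<le> x"
  then show "cdf_of h x = cdf_of h 1"
    unfolding cdf_of_def by (intro Bochner_Integration.integral_cong) (auto simp: indicator_def)
qed

text \<open>Extended by zero to the line, the density measure has \<open>cdf_of h\<close> as its
  distribution function, and a finite Borel measure on the line is determined by that function.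
  Restricting back gives the claim.\<close>

lemma cdf_measure_cdf_of:
  "cdf_measure (cdf_of h) = density unit_lborel (\<lambda>t. ennreal (h t))"
proof -
  let ?H = "cdf_of h"
  note L = cdf_of_in_lip_cdfs
  define G where "G = (\<lambda>t. ennreal (h t) * indicator {0..1} t)"
  have G [measurable]: "G \<in> borel_measurable lborel"
  proof -
    have "{0..1} \<inter> space lborel \<in> sets (lborel :: real measure)" by simp
    from borel_measurable_restrict_space_iff_ennreal[OF this, of "\<lambda>t. ennreal (h t)"] show ?thesis
      unfolding G_def using measurable_compose[OF h measurable_ennreal] by blast
  qed
  define \<nu> where "\<nu> = density lborel G"
  have sets\<nu> [simp]: "sets \<nu> = sets borel" by (simp add: \<nu>_def)
  have em: "emeasure \<nu> (A \<inter> {0..1}) = emeasure (density unit_lborel (\<lambda>t. ennreal (h t))) (A \<inter> {0..1})"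
    if [measurable]: "A \<in> sets borel" for A
  proof -
    have A: "A \<inter> {0..1} \<in> sets unit_lborel" using that by (subst sets_restrict_space_iff) auto
    have "emeasure (density unit_lborel (\<lambda>t. ennreal (h t))) (A \<inter> {0..1}) = (\<integral>\<^sup>+t. ennreal (h t) * indicator (A \<inter> {0..1}) t \<partial>unit_lborel)"
      by (rule emeasure_density) (use A in auto)
    also have "\<dots> = (\<integral>\<^sup>+t. ennreal (h t) * indicator (A \<inter> {0..1}) t * indicator {0..1} t \<partial>lborel)"
      by (subst nn_integral_restrict_space) auto
    also have "\<dots> = (\<integral>\<^sup>+t. G t * indicator (A \<inter> {0..1}) t \<partial>lborel)"
      by (intro nn_integral_cong) (auto simp: G_def indicator_def)
    also have "\<dots> = emeasure \<nu> (A \<inter> {0..1})"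
      unfolding \<nu>_def by (rule emeasure_density[symmetric]) auto
    finally show ?thesis by simp
  qed
  have out: "emeasure \<nu> A = emeasure \<nu> (A \<inter> {0..1})" if [measurable]: "A \<in> sets borel" for A
  proof -
    have "(\<integral>\<^sup>+t. G t * indicator A t \<partial>lborel) = (\<integral>\<^sup>+t. G t * indicator (A \<inter> {0..1}) t \<partial>lborel)"
      by (intro nn_integral_cong) (auto simp: G_def indicator_def)
    then show ?thesis
      unfolding \<nu>_def by (subst (1 2) emeasure_density) (use that in auto)
  qed
  have Iic: "emeasure \<nu> {..x} = ennreal (?H x)" for x
  proof -
    have A: "{..x} \<inter> {0..1} \<in> sets unit_lborel" by (subst sets_restrict_space_iff) auto
    have "emeasure \<nu> {..x} = emeasure (density unit_lborel (\<lambda>t. ennreal (h t))) ({..x} \<inter> {0..1})"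
      using out[of "{..x}"] em[of "{..x}"] by simp
    also have "\<dots> = (\<integral>\<^sup>+t. ennreal (h t) * indicator ({..x} \<inter> {0..1}) t \<partial>unit_lborel)"
      by (rule emeasure_density) (use A in auto)
    also have "\<dots> = (\<integral>\<^sup>+t. ennreal (indicator {..x} t * h t) \<partial>unit_lborel)"
      by (intro nn_integral_cong) (auto simp: indicator_def)
    also have "\<dots> = ennreal (?H x)"
      unfolding cdf_of_def by (rule nn_integral_eq_integral[OF cdf_of_integrable])
        (use hb in \<open>intro AE_I2; simp add: indicator_def\<close>)
    finally show ?thesis .
  qed
  have fin: "emeasure \<nu> (space \<nu>) \<noteq> \<infinity>"
  proof -
    have "{..1} \<inter> {0..1} = UNIV \<inter> {0..1::real}" by auto
    then have "emeasure \<nu> UNIV = emeasure \<nu> {..1}"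
      using out[of UNIV] out[of "{..1}"] by (metis sets\<nu> borel_closed closed_atMost sets.top space_borel)
    moreover have "space \<nu> = UNIV" by (simp add: \<nu>_def)
    ultimately have "emeasure \<nu> (space \<nu>) = emeasure \<nu> {..1}" by simp
    then show ?thesis using Iic[of 1] by simp
  qed
  have f\<nu>: "finite_borel_measure \<nu>"
    by (intro finite_borel_measure.intro finite_measureI finite_borel_measure_axioms.intro fin) simp
  have cont: "continuous (at_right a) ?H" for a
    using lip_cdfs_continuous[OF L] by (auto simp: continuous_on_eq_continuous_within intro: continuous_within_subset)
  have bot: "(?H \<longlongrightarrow> 0) at_bot"
    using lip_cdfsD(3)[OF L] by (intro tendsto_eventually) (auto simp: eventually_at_bot_linorder)
  have top: "(?H \<longlongrightarrow> ?H 1) at_top"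
    by (rule tendsto_eventually, rule eventually_mono[OF eventually_ge_at_top[of 1]]) (erule lip_cdfsD(4)[OF L])
  have "finite_borel_measure (interval_measure ?H)"
    by (rule finite_borel_measure_interval_measure[OF lip_cdfsD(1)[OF L] cont bot top lip_cdfs_bounds(1)[OF L]])
  moreover have "cdf (interval_measure ?H) = ?H"
    by (rule cdf_interval_measure[OF lip_cdfsD(1)[OF L] cont bot])
  moreover have "cdf \<nu> = ?H"
    using Iic lip_cdfs_bounds(1)[OF L] by (simp add: cdf_def measure_def fun_eq_iff)
  ultimately have "interval_measure ?H = \<nu>"
    using cdf_unique'[OF _ f\<nu>] by metis
  then show ?thesis
    unfolding cdf_measure_def
  proof (intro measure_eqI)
    show "sets (restrict_space (interval_measure ?H) {0..1}) = sets (density unit_lborel (\<lambda>t. ennreal (h t)))"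
      unfolding sets_density sets_unit_lborel by (intro sets_restrict_space_cong) simp
    fix A assume "A \<in> sets (restrict_space (interval_measure ?H) {0..1})"
    then have "A \<in> sets borel" "A \<subseteq> {0..1}"
      by (auto simp: sets_restrict_space_iff)
    then have "A \<inter> {0..1} = A" by auto
    then show "emeasure (restrict_space (interval_measure ?H) {0..1}) A = emeasure (density unit_lborel (\<lambda>t. ennreal (h t))) A"
      using em[OF \<open>A \<in> sets borel\<close>] \<open>A \<subseteq> {0..1}\<close> \<open>interval_measure ?H = \<nu>\<close>
      by (subst emeasure_restrict_space) auto
  qed
qed

end


text \<open>
  Restriction to rational arguments: the library makes a function space Hausdorff only for a countable index
  type, and for such a type the Borel sets are generated by the evaluations.
\<close>

definition rat_cdf :: "(real \<Rightarrow> real) \<Rightarrow> rat \<Rightarrow> real" where "rat_cdf H q = H (of_rat q)"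

text \<open>A continuous injection on a compact set. It is injective because continuous functions
  that agree at the rationals coincide.\<close>

lemma rat_cdf_homeomorphism: "\<exists>g. homeomorphism lip_cdfs (rat_cdf ` lip_cdfs) rat_cdf g"
proof (rule homeomorphism_compact[OF compact_lip_cdfs _ refl])
  show "continuous_on lip_cdfs rat_cdf"
    unfolding rat_cdf_def
    by (intro continuous_on_coordinatewise_then_product continuous_on_subset[OF continuous_on_product_coordinates]) auto
  show "inj_on rat_cdf lip_cdfs"
  proof (rule inj_onI, rule ccontr)
    fix H K assume H: "H \<in> lip_cdfs" and K: "K \<in> lip_cdfs" and eq: "rat_cdf H = rat_cdf K" and "H \<noteq> K"
    have "open {x. H x \<noteq> K x}"
      by (intro open_Collect_neq lip_cdfs_continuous H K)
    moreover obtain x where "x \<in> {x. H x \<noteq> K x}" using \<open>H \<noteq> K\<close> by auto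
    ultimately obtain e where e: "e > 0" "\<And>y. dist y x < e \<Longrightarrow> H y \<noteq> K y"
      unfolding open_dist by blast
    obtain q :: rat where "x < of_rat q" "of_rat q < x + e"
      using of_rat_dense[of x "x + e"] e(1) by auto
    then have "H (of_rat q) \<noteq> K (of_rat q)" by (intro e(2)) (auto simp: dist_real_def)
    then show False using eq by (auto simp: rat_cdf_def fun_eq_iff)
  qed
qed

text \<open>Polynomials in the evaluations: they separate points trivially, and their expectations
  are linear combinations of mixed moments of the distribution function.\<close>

inductive_set cdf_polys :: "((rat \<Rightarrow> real) \<Rightarrow> real) set" where
  const: "(\<lambda>_. c) \<in> cdf_polys"
| eval: "(\<lambda>H. H x) \<in> cdf_polys"
| add: "f \<in> cdf_polys \<Longrightarrow> g \<in> cdf_polys \<Longrightarrow> (\<lambda>H. f H + g H) \<in> cdf_polys"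
| mult: "f \<in> cdf_polys \<Longrightarrow> g \<in> cdf_polys \<Longrightarrow> (\<lambda>H. f H * g H) \<in> cdf_polys"

interpretation cdf_ring: function_ring_on cdf_polys "rat_cdf ` lip_cdfs"
proof
  show "compact (rat_cdf ` lip_cdfs)"
    using rat_cdf_homeomorphism compact_lip_cdfs compact_continuous_image homeomorphism_def by blast
  show "continuous_on (rat_cdf ` lip_cdfs) f" if "f \<in> cdf_polys" for f
    using that
  proof induction
    case (eval x)
    show ?case by (rule continuous_on_subset[OF continuous_on_product_coordinates]) auto
  qed (auto intro: continuous_intros)
  show "\<exists>f\<in>cdf_polys. f H \<noteq> f K" if "H \<noteq> K" for H K
  proof -
    obtain x where "H x \<noteq> K x" using \<open>H \<noteq> K\<close> by blast
    then show ?thesis by (intro bexI[OF _ cdf_polys.eval[of x]])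
  qed
qed (auto intro: cdf_polys.intros)

section \<open>Random densities and the method of moments\<close>

locale unit_density = prob_space M for M :: "'w measure" +
  fixes h :: "real \<Rightarrow> 'w \<Rightarrow> real"
  assumes h_meas: "(\<lambda>(t, \<omega>). h t \<omega>) \<in> borel_measurable (restrict_space borel {0..1} \<Otimes>\<^sub>M M)"
    and h_range: "\<And>t \<omega>. t \<in> {0..1} \<Longrightarrow> \<omega> \<in> space M \<Longrightarrow> h t \<omega> \<in> {0..1}"
begin

definition cdf_path :: "'w \<Rightarrow> real \<Rightarrow> real" where "cdf_path \<omega> = cdf_of (\<lambda>t. h t \<omega>)"

lemma h_meas_unit: "(\<lambda>(t, \<omega>). h t \<omega>) \<in> borel_measurable (unit_lborel \<Otimes>\<^sub>M M)"
  using h_meas by (subst measurable_cong_sets[OF sets_pair_measure_cong[OF sets_unit_lborel refl] refl])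

lemma h_meas_section: "\<omega> \<in> space M \<Longrightarrow> (\<lambda>t. h t \<omega>) \<in> borel_measurable unit_lborel"
  using measurable_compose[OF measurable_Pair2' h_meas_unit] by simp

lemma cdf_path_in_lip_cdfs: "\<omega> \<in> space M \<Longrightarrow> cdf_path \<omega> \<in> lip_cdfs"
  unfolding cdf_path_def by (rule cdf_of_in_lip_cdfs[OF h_meas_section h_range])

lemma density_eq_cdf_measure:
  "\<omega> \<in> space M \<Longrightarrow> density unit_lborel (\<lambda>t. ennreal (h t \<omega>)) = cdf_measure (cdf_path \<omega>)"
  unfolding cdf_path_def by (rule cdf_measure_cdf_of[OF h_meas_section h_range, symmetric])

lemma cdf_path_measurable [measurable]: "(\<lambda>\<omega>. cdf_path \<omega> x) \<in> borel_measurable M"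
proof -
  interpret U: prob_space unit_lborel by (rule prob_space_unit_lborel)
  have "(\<lambda>(\<omega>, t). indicator {..x} t * h t \<omega>) \<in> borel_measurable (M \<Otimes>\<^sub>M unit_lborel)"
    using measurable_compose[OF measurable_pair_swap' h_meas_unit]
    by (simp add: case_prod_beta') measurable
  then show ?thesis
    unfolding cdf_path_def cdf_of_def by (rule U.borel_measurable_lebesgue_integral)
qed

text \<open>A weakly open set of measures corresponds to a relatively open set of restrictions to
  the rationals, and the random restriction is Borel measurable because its coordinates are.\<close>

lemma random_element_density:
  "random_element M (weak_measure_topology {0..1}) (\<lambda>\<omega>. density unit_lborel (\<lambda>t. ennreal (h t \<omega>)))"
  unfolding random_element_def
proof (intro conjI ballI allI impI)
  fix \<omega> assume \<omega>: "\<omega> \<in> space M"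
  show "density unit_lborel (\<lambda>t. ennreal (h t \<omega>)) \<in> topspace (weak_measure_topology {0..1})"
    unfolding density_eq_cdf_measure[OF \<omega>]
    using sets_cdf_measure finite_measure_cdf_measure[OF cdf_path_in_lip_cdfs[OF \<omega>]]
    by (simp add: topspace_weak_measure_topology)
next
  fix U :: "real measure set" assume U: "openin (weak_measure_topology {0..1}) U"
  obtain g where hom: "homeomorphism lip_cdfs (rat_cdf ` lip_cdfs) rat_cdf g"
    using rat_cdf_homeomorphism by blast
  have "openin (top_of_set lip_cdfs) {H \<in> lip_cdfs. cdf_measure H \<in> U}"
    using openin_continuous_map_preimage[OF continuous_map_cdf_measure U] by simp
  then have "openin (top_of_set (rat_cdf ` lip_cdfs)) (rat_cdf ` {H \<in> lip_cdfs. cdf_measure H \<in> U})"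
    using homeomorphism_imp_open_map[OF hom] by blast
  then obtain W where W: "open W" "rat_cdf ` {H \<in> lip_cdfs. cdf_measure H \<in> U} = rat_cdf ` lip_cdfs \<inter> W"
    by (auto simp: openin_open)
  have "cdf_measure (cdf_path \<omega>) \<in> U \<longleftrightarrow> rat_cdf (cdf_path \<omega>) \<in> W" if "\<omega> \<in> space M" for \<omega>
  proof -
    have inj: "H = K" if "H \<in> lip_cdfs" "K \<in> lip_cdfs" "rat_cdf H = rat_cdf K" for H K
      using that hom unfolding homeomorphism_def by metis
    have "rat_cdf (cdf_path \<omega>) \<in> W \<longleftrightarrow> rat_cdf (cdf_path \<omega>) \<in> rat_cdf ` {H \<in> lip_cdfs. cdf_measure H \<in> U}"
      using W(2) cdf_path_in_lip_cdfs[OF that] by blast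
    also have "\<dots> \<longleftrightarrow> cdf_measure (cdf_path \<omega>) \<in> U"
      using inj cdf_path_in_lip_cdfs[OF that] by blast
    finally show ?thesis by simp
  qed
  then have "(\<lambda>\<omega>. density unit_lborel (\<lambda>t. ennreal (h t \<omega>))) -` U \<inter> space M = (\<lambda>\<omega>. rat_cdf (cdf_path \<omega>)) -` W \<inter> space M"
    using density_eq_cdf_measure by auto
  moreover have "(\<lambda>\<omega>. rat_cdf (cdf_path \<omega>)) \<in> borel_measurable M"
    by (rule measurable_coordinatewise_then_product) (simp add: rat_cdf_def)
  ultimately show "(\<lambda>\<omega>. density unit_lborel (\<lambda>t. ennreal (h t \<omega>))) -` U \<inter> space M \<in> sets M"
    using W(1) by (simp add: measurable_sets)
qed

lemma cdf_polys_measurable: "g \<in> cdf_polys \<Longrightarrow> (\<lambda>\<omega>. g (rat_cdf (cdf_path \<omega>))) \<in> borel_measurable M"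
  by (induction rule: cdf_polys.induct) (auto simp: rat_cdf_def)

lemma cdf_polys_integrable:
  assumes g: "g \<in> cdf_polys" shows "integrable M (\<lambda>\<omega>. g (rat_cdf (cdf_path \<omega>)))"
proof -
  have "bounded (g ` rat_cdf ` lip_cdfs)"
    by (intro compact_imp_bounded compact_continuous_image cdf_ring.compact cdf_ring.continuous g)
  then obtain B where "\<And>H. H \<in> lip_cdfs \<Longrightarrow> \<bar>g (rat_cdf H)\<bar> \<le> B" by (auto simp: bounded_iff)
  then show ?thesis
    by (intro integrable_const_bound[of _ B] cdf_polys_measurable g AE_I2) (auto intro: cdf_path_in_lip_cdfs)
qed

end

text \<open>All the measures come from the compact set \<open>lip_cdfs\<close>, so a continuous test
  function is uniformly approximated by polynomials in evaluations. Convergence of mixed moments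
  therefore suffices, without a separate tightness argument.\<close>

lemma converges_in_distribution_densities:
  fixes h :: "real \<Rightarrow> real \<Rightarrow> 'w \<Rightarrow> real"
  assumes "\<And>T. unit_density M (h T)" and "unit_density N k"
    and mom: "\<And>xs. ((\<lambda>T. \<integral>\<omega>. prod_list (map (cdf_of (\<lambda>t. h T t \<omega>)) xs) \<partial>M) \<longlongrightarrow>
        (\<integral>\<omega>. prod_list (map (cdf_of (\<lambda>t. k t \<omega>)) xs) \<partial>N)) at_top"
  shows "converges_in_distribution (weak_measure_topology {0..1})
     M (\<lambda>T \<omega>. density unit_lborel (\<lambda>t. ennreal (h T t \<omega>))) at_top
     N (\<lambda>\<omega>. density unit_lborel (\<lambda>t. ennreal (k t \<omega>)))"
proof -
  interpret M: unit_density M "h T" for T by fact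
  interpret N: unit_density N k by fact
  have lim: "((\<lambda>T. \<integral>\<omega>. g (rat_cdf (M.cdf_path T \<omega>)) \<partial>M) \<longlongrightarrow> (\<integral>\<omega>. g (rat_cdf (N.cdf_path \<omega>)) \<partial>N)) at_top"
    if g: "g \<in> cdf_polys" for g
  proof -
    define Cv where "Cv G \<longleftrightarrow> G \<in> cdf_polys \<and>
       ((\<lambda>T. \<integral>\<omega>. G (rat_cdf (M.cdf_path T \<omega>)) \<partial>M) \<longlongrightarrow> (\<integral>\<omega>. G (rat_cdf (N.cdf_path \<omega>)) \<partial>N)) at_top" for G
    have plus: "Cv (\<lambda>H. G1 H + G2 H)" if "Cv G1" "Cv G2" for G1 G2
      using that unfolding Cv_def
      by (auto simp: M.cdf_polys_integrable N.cdf_polys_integrable intro: cdf_polys.intros tendsto_add)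
    have scale: "Cv (\<lambda>H. c * G H)" if "Cv G" for G c
      using that unfolding Cv_def by (auto intro: cdf_polys.intros tendsto_mult_left)
    have pl: "(\<lambda>H. prod_list (map H xs)) \<in> cdf_polys" for xs
      by (induction xs) (auto intro: cdf_polys.intros)
    have base: "Cv (\<lambda>H. prod_list (map H xs))" for xs
    proof -
      have "map (rat_cdf H) xs = map H (map of_rat xs)" for H by (simp add: rat_cdf_def)
      then show ?thesis
        unfolding Cv_def M.cdf_path_def N.cdf_path_def using pl mom[of "map of_rat xs"] by presburger
    qed
    \<comment> \<open>Convergence of the means of two factors says nothing about their product. The
      induction therefore carries an accumulated factor \<open>G\<close> and an arbitrary monomial,
      which expands \<open>g\<close> into monomials; \<open>G = 1\<close> and the empty list give
      the claim.\<close>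
    have "\<forall>G. (\<forall>xs. Cv (\<lambda>H. G H * prod_list (map H xs))) \<longrightarrow> (\<forall>xs. Cv (\<lambda>H. G H * g H * prod_list (map H xs)))"
      using g
    proof induction
      case (const c)
      show ?case using scale[of _ c] by (auto simp: mult_ac)
    next
      case (eval x)
      show ?case
      proof (intro allI impI)
        fix G xs assume "\<forall>xs. Cv (\<lambda>H. G H * prod_list (map H xs))"
        then have "Cv (\<lambda>H. G H * prod_list (map H (x # xs)))" by blast
        then show "Cv (\<lambda>H. G H * H x * prod_list (map H xs))" by (simp add: mult_ac)
      qed
    next
      case (add f g)
      show ?case
      proof (intro allI impI)
        fix G xs assume "\<forall>xs. Cv (\<lambda>H. G H * prod_list (map H xs))"
        then have "Cv (\<lambda>H. G H * f H * prod_list (map H xs))" "Cv (\<lambda>H. G H * g H * prod_list (map H xs))"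
          using add.IH by blast+
        from plus[OF this] show "Cv (\<lambda>H. G H * (f H + g H) * prod_list (map H xs))" by (simp add: algebra_simps)
      qed
    next
      case (mult f g)
      show ?case
      proof (intro allI impI)
        fix G xs assume "\<forall>xs. Cv (\<lambda>H. G H * prod_list (map H xs))"
        then have "\<forall>xs. Cv (\<lambda>H. (G H * f H) * prod_list (map H xs))"
          using mult.IH by blast
        then have "Cv (\<lambda>H. (G H * f H) * g H * prod_list (map H xs))"
          using mult.IH(2)[rule_format, of "\<lambda>H. G H * f H"] by blast
        then show "Cv (\<lambda>H. G H * (f H * g H) * prod_list (map H xs))" by (simp add: mult_ac)
      qed
    qed
    from this[rule_format, of "\<lambda>_. 1" "[]"] base have "Cv g" by simp
    then show ?thesis by (simp add: Cv_def)
  qed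
  show ?thesis
    unfolding converges_in_distribution_def
  proof (intro conjI allI impI always_eventually M.random_element_density N.random_element_density)
    fix F assume F: "continuous_map (weak_measure_topology {0..1}) euclideanreal F"
      and bF: "bounded (F ` topspace (weak_measure_topology {0..1::real}))"
    define E where "E = (\<lambda>T. \<integral>\<omega>. F (density unit_lborel (\<lambda>t. ennreal (h T t \<omega>))) \<partial>M)"
    define E' where "E' = (\<integral>\<omega>. F (density unit_lborel (\<lambda>t. ennreal (k t \<omega>))) \<partial>N)"
    have "continuous_map (top_of_set lip_cdfs) euclideanreal (F \<circ> cdf_measure)"
      by (rule continuous_map_compose[OF continuous_map_cdf_measure F])
    then have cF: "continuous_on lip_cdfs (F \<circ> cdf_measure)" by simp
    \<comment> \<open>The uniform error passes to expectations under any law; it is used for each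
      \<open>T\<close> and for the limit.\<close>
    have close: "\<bar>(\<integral>\<omega>. F (density unit_lborel (\<lambda>t. ennreal (u t \<omega>))) \<partial>P) - (\<integral>\<omega>. g (rat_cdf (unit_density.cdf_path u \<omega>)) \<partial>P)\<bar> \<le> e"
      if "unit_density P u" "g \<in> cdf_polys" "\<And>H. H \<in> lip_cdfs \<Longrightarrow> \<bar>(F \<circ> cdf_measure) H - g (rat_cdf H)\<bar> < e"
      for P :: "'x measure" and u g e
    proof -
      interpret P: unit_density P u by fact
      have rm: "(\<lambda>\<omega>. F (density unit_lborel (\<lambda>t. ennreal (u t \<omega>)))) \<in> borel_measurable P"
      proof (rule borel_measurableI)
        fix S :: "real set" assume "open S"
        then have "openin (weak_measure_topology {0..1}) {\<mu> \<in> topspace (weak_measure_topology {0..1}). F \<mu> \<in> S}"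
          using openin_continuous_map_preimage[OF F, of S] by simp
        then have "(\<lambda>\<omega>. density unit_lborel (\<lambda>t. ennreal (u t \<omega>))) -` {\<mu> \<in> topspace (weak_measure_topology {0..1}). F \<mu> \<in> S} \<inter> space P \<in> sets P"
          using P.random_element_density unfolding random_element_def by blast
        also have "(\<lambda>\<omega>. density unit_lborel (\<lambda>t. ennreal (u t \<omega>))) -` {\<mu> \<in> topspace (weak_measure_topology {0..1}). F \<mu> \<in> S} \<inter> space P =
          (\<lambda>\<omega>. F (density unit_lborel (\<lambda>t. ennreal (u t \<omega>)))) -` S \<inter> space P"
          using P.random_element_density unfolding random_element_def by auto
        finally show "(\<lambda>\<omega>. F (density unit_lborel (\<lambda>t. ennreal (u t \<omega>)))) -` S \<inter> space P \<in> sets P" .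
      qed
      obtain B where B: "\<And>\<mu>. \<mu> \<in> topspace (weak_measure_topology {0..1::real}) \<Longrightarrow> \<bar>F \<mu>\<bar> \<le> B"
        using bF by (auto simp: bounded_iff)
      have i1: "integrable P (\<lambda>\<omega>. F (density unit_lborel (\<lambda>t. ennreal (u t \<omega>))))"
        by (rule P.integrable_const_bound[of _ B])
          (use P.random_element_density in \<open>auto simp: random_element_def intro!: AE_I2 B rm\<close>)
      note i2 = P.cdf_polys_integrable[OF that(2)]
      have "\<bar>(\<integral>\<omega>. F (density unit_lborel (\<lambda>t. ennreal (u t \<omega>))) \<partial>P) - (\<integral>\<omega>. g (rat_cdf (P.cdf_path \<omega>)) \<partial>P)\<bar> =
         \<bar>\<integral>\<omega>. F (density unit_lborel (\<lambda>t. ennreal (u t \<omega>))) - g (rat_cdf (P.cdf_path \<omega>)) \<partial>P\<bar>"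
        using i1 i2 by simp
      also have "\<dots> \<le> (\<integral>\<omega>. \<bar>F (density unit_lborel (\<lambda>t. ennreal (u t \<omega>))) - g (rat_cdf (P.cdf_path \<omega>))\<bar> \<partial>P)"
        by (rule integral_abs_bound)
      also have "\<dots> \<le> (\<integral>\<omega>. e \<partial>P)"
        using that(3)[OF P.cdf_path_in_lip_cdfs] P.density_eq_cdf_measure i1 i2
        by (intro integral_mono) (auto intro!: less_imp_le)
      finally show ?thesis by (simp add: P.prob_space)
    qed
    show "(E \<longlongrightarrow> E') at_top"
    proof (rule tendstoI)
      fix e :: real assume e: "e > 0"
      obtain g where g: "g \<in> cdf_polys" "\<And>H. H \<in> lip_cdfs \<Longrightarrow> \<bar>(F \<circ> cdf_measure) H - g (rat_cdf H)\<bar> < e / 4"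
      proof -
        obtain \<gamma> where hom: "homeomorphism lip_cdfs (rat_cdf ` lip_cdfs) rat_cdf \<gamma>"
          using rat_cdf_homeomorphism by blast
        have "continuous_on (rat_cdf ` lip_cdfs) ((F \<circ> cdf_measure) \<circ> \<gamma>)"
          using hom cF unfolding homeomorphism_def by (metis continuous_on_compose)
        then obtain g where "g \<in> cdf_polys" "\<And>s. s \<in> rat_cdf ` lip_cdfs \<Longrightarrow> \<bar>((F \<circ> cdf_measure) \<circ> \<gamma>) s - g s\<bar> < e / 4"
          using cdf_ring.Stone_Weierstrass_basic[of _ "e / 4"] e by (metis divide_pos_pos zero_less_numeral)
        moreover have "\<gamma> (rat_cdf H) = H" if "H \<in> lip_cdfs" for H
          using hom that unfolding homeomorphism_def by blast
        ultimately show ?thesis using that by fastforce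
      qed
      have "\<forall>\<^sub>F T in at_top. dist (\<integral>\<omega>. g (rat_cdf (M.cdf_path T \<omega>)) \<partial>M) (\<integral>\<omega>. g (rat_cdf (N.cdf_path \<omega>)) \<partial>N) < e / 4"
        by (rule tendstoD[OF lim[OF g(1)]]) (use e in simp)
      then show "\<forall>\<^sub>F T in at_top. dist (E T) E' < e"
      proof eventually_elim
        case (elim T)
        have "\<bar>E T - (\<integral>\<omega>. g (rat_cdf (M.cdf_path T \<omega>)) \<partial>M)\<bar> \<le> e / 4"
          unfolding E_def by (rule close[OF M.unit_density_axioms g])
        moreover have "\<bar>E' - (\<integral>\<omega>. g (rat_cdf (N.cdf_path \<omega>)) \<partial>N)\<bar> \<le> e / 4"
          unfolding E'_def by (rule close[OF N.unit_density_axioms g])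
        ultimately show ?case using elim e unfolding dist_real_def by linarith
      qed
    qed
  qed
qed

section \<open>Moments\<close>

text \<open>Multiplying out selects one void set \<open>g k\<close> per time, and a product of void
  indicators is the indicator of a joint void event. The factor \<open>e\<close> carries the fast
  void probabilities of the limit.\<close>

lemma prod_sum_void:
  fixes c :: "'b \<Rightarrow> real"
  assumes I: "finite I" and \<B>: "finite \<B>"
  shows "(\<Prod>k\<in>I. \<Sum>B\<in>\<B>. c B * of_bool (P k B) * e k B) =
    (\<Sum>g\<in>PiE I (\<lambda>_. \<B>). (\<Prod>k\<in>I. c (g k) * e k (g k)) * of_bool (\<forall>k\<in>I. P k (g k)))"
proof -
  have "(\<Prod>k\<in>I. of_bool (P k (g k))) = (of_bool (\<forall>k\<in>I. P k (g k)) :: real)" for g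
    using I by (induction I rule: finite_induct) auto
  then show ?thesis
    unfolding prod_sum_PiE[OF I \<B>] by (simp add: prod.distrib mult_ac)
qed

lemma (in prob_space) expectation_void_sum:
  assumes "finite S" and "\<And>g. g \<in> S \<Longrightarrow> {\<omega>\<in>space M. Q g \<omega>} \<in> events"
  shows "(\<integral>\<omega>. (\<Sum>g\<in>S. c g * of_bool (Q g \<omega>)) \<partial>M) = (\<Sum>g\<in>S. c g * prob {\<omega>\<in>space M. Q g \<omega>})"
proof -
  have "(\<integral>\<omega>. (\<Sum>g\<in>S. c g * of_bool (Q g \<omega>)) \<partial>M) = (\<integral>\<omega>. (\<Sum>g\<in>S. c g * indicator {\<omega>\<in>space M. Q g \<omega>} \<omega>) \<partial>M)"
    by (intro Bochner_Integration.integral_cong refl sum.cong) (auto simp: indicator_def)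
  also have "\<dots> = (\<Sum>g\<in>S. \<integral>\<omega>. c g * indicator {\<omega>\<in>space M. Q g \<omega>} \<omega> \<partial>M)"
    using assms by (intro Bochner_Integration.integral_sum integrable_mult_right integrable_real_indicator) (auto simp: emeasure_eq_measure)
  also have "\<dots> = (\<Sum>g\<in>S. c g * prob {\<omega>\<in>space M. Q g \<omega>})"
    by (intro sum.cong refl) (simp add: Int_absorb2 del: Collect_mem_eq)
  finally show ?thesis .
qed

text \<open>Products of numbers in the unit interval differ by at most the sum of the differences of
  the factors. The order \<open>f k \<le> g k\<close> removes the absolute values, so the bound
  involves only the means of the single factors.\<close>

lemma (in prob_space) expectation_prod_diff:
  fixes f g :: "'i \<Rightarrow> 'a \<Rightarrow> real"
  assumes I: "finite I" and int: "\<And>k. k \<in> I \<Longrightarrow> integrable M (f k)" "\<And>k. k \<in> I \<Longrightarrow> integrable M (g k)"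
    and b: "\<And>k. k \<in> I \<Longrightarrow> AE \<omega> in M. 0 \<le> f k \<omega> \<and> f k \<omega> \<le> g k \<omega> \<and> g k \<omega> \<le> 1"
  shows "\<bar>(\<integral>\<omega>. (\<Prod>k\<in>I. f k \<omega>) \<partial>M) - (\<integral>\<omega>. (\<Prod>k\<in>I. g k \<omega>) \<partial>M)\<bar> \<le> (\<Sum>k\<in>I. (\<integral>\<omega>. g k \<omega> \<partial>M) - (\<integral>\<omega>. f k \<omega> \<partial>M))"
proof -
  have ae: "AE \<omega> in M. \<forall>k\<in>I. 0 \<le> f k \<omega> \<and> f k \<omega> \<le> g k \<omega> \<and> g k \<omega> \<le> 1"
    using b I by (intro AE_ball_countable[THEN iffD2] countable_finite) auto
  have m: "(\<lambda>\<omega>. \<Prod>k\<in>I. f k \<omega>) \<in> borel_measurable M" "(\<lambda>\<omega>. \<Prod>k\<in>I. g k \<omega>) \<in> borel_measurable M"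
    using int by (auto intro!: borel_measurable_prod)
  have pi: "integrable M (\<lambda>\<omega>. \<Prod>k\<in>I. f k \<omega>)" "integrable M (\<lambda>\<omega>. \<Prod>k\<in>I. g k \<omega>)"
  proof -
    have "AE \<omega> in M. norm (\<Prod>k\<in>I. f k \<omega>) \<le> 1 \<and> norm (\<Prod>k\<in>I. g k \<omega>) \<le> 1"
      using ae
    proof eventually_elim
      case (elim \<omega>)
      then have "\<bar>f k \<omega>\<bar> \<le> 1 \<and> \<bar>g k \<omega>\<bar> \<le> 1" if "k \<in> I" for k using that by fastforce
      then show ?case by (auto simp: abs_prod intro!: prod_le_1)
    qed
    then have nb: "AE \<omega> in M. norm (\<Prod>k\<in>I. f k \<omega>) \<le> 1" "AE \<omega> in M. norm (\<Prod>k\<in>I. g k \<omega>) \<le> 1" by auto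
    show "integrable M (\<lambda>\<omega>. \<Prod>k\<in>I. f k \<omega>)" "integrable M (\<lambda>\<omega>. \<Prod>k\<in>I. g k \<omega>)"
      using integrable_const_bound[OF nb(1) m(1)] integrable_const_bound[OF nb(2) m(2)] by auto
  qed
  have "\<bar>(\<integral>\<omega>. (\<Prod>k\<in>I. f k \<omega>) \<partial>M) - (\<integral>\<omega>. (\<Prod>k\<in>I. g k \<omega>) \<partial>M)\<bar> = \<bar>\<integral>\<omega>. (\<Prod>k\<in>I. f k \<omega>) - (\<Prod>k\<in>I. g k \<omega>) \<partial>M\<bar>"
    using pi by simp
  also have "\<dots> \<le> (\<integral>\<omega>. \<bar>(\<Prod>k\<in>I. f k \<omega>) - (\<Prod>k\<in>I. g k \<omega>)\<bar> \<partial>M)" by (rule integral_abs_bound)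
  also have "\<dots> \<le> (\<integral>\<omega>. (\<Sum>k\<in>I. g k \<omega> - f k \<omega>) \<partial>M)"
  proof (rule integral_mono_AE)
    show "AE \<omega> in M. \<bar>(\<Prod>k\<in>I. f k \<omega>) - (\<Prod>k\<in>I. g k \<omega>)\<bar> \<le> (\<Sum>k\<in>I. g k \<omega> - f k \<omega>)"
      using ae
    proof eventually_elim
      case (elim \<omega>)
      have "norm ((\<Prod>k\<in>I. f k \<omega>) - (\<Prod>k\<in>I. g k \<omega>)) \<le> (\<Sum>k\<in>I. norm (f k \<omega> - g k \<omega>))"
        by (rule norm_prod_diff) (use elim in force)+
      also have "\<dots> = (\<Sum>k\<in>I. g k \<omega> - f k \<omega>)" by (intro sum.cong refl) (use elim in auto)
      finally show ?case by simp
    qed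
  qed (use pi int in auto)
  also have "\<dots> = (\<Sum>k\<in>I. (\<integral>\<omega>. g k \<omega> \<partial>M) - (\<integral>\<omega>. f k \<omega> \<partial>M))"
    using int by (subst Bochner_Integration.integral_sum) auto
  finally show ?thesis .
qed

section \<open>Product moments at fixed generic times\<close>

context mobility_limit begin

text \<open>Identifies the one-time law of the limit without computing it: with a single time,
  \<open>void_limit\<close> is the limit of a quantity that does not depend on
  \<open>T\<close>.\<close>

lemma prob_slow_void_single:
  assumes t: "t \<in> {0..1}" and gen: "AE \<omega> in M. generic_times {k} (\<lambda>_. t) (row 0 \<omega>)" and B: "B \<in> sets borel" "bounded B"
  shows "N.prob {\<omega>\<in>space N. slow_nodes Xbd t \<omega> \<inter> B = {}} * exp (- (fast_int t * measure lborel B)) = exp (- (lam * measure lborel B))"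
proof (rule tendsto_unique[of at_top])
  show "((\<lambda>T. prob {\<omega>\<in>space M. nodes X V T (t * T) \<omega> \<inter> B = {}}) \<longlongrightarrow>
     N.prob {\<omega>\<in>space N. slow_nodes Xbd t \<omega> \<inter> B = {}} * exp (- (fast_int t * measure lborel B))) at_top"
    using void_limit[of "{k}" "\<lambda>_. B" "\<lambda>_. t"] t gen B by simp
  show "((\<lambda>T. prob {\<omega>\<in>space M. nodes X V T (t * T) \<omega> \<inter> B = {}}) \<longlongrightarrow> exp (- (lam * measure lborel B))) at_top"
    by (rule tendsto_eventually, rule eventually_mono[OF eventually_gt_at_top[of 0]]) (rule node_void_single[OF _ t B])
qed simp

lemma expectation_coarse_cond:
  assumes t: "t \<in> {0..1}" and gen: "AE \<omega> in M. generic_times {k} (\<lambda>_. t) (row 0 \<omega>)"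
  shows "(\<integral>\<omega>. coarse_cond m t \<omega> \<partial>N) = coarse_level r m" "(\<integral>\<omega>. slow_cond t \<omega> \<partial>N) = perc_level r"
proof -
  have c: "(\<integral>\<omega>. coarse_cond m t \<omega> \<partial>N) = coarse_level r m" for m
  proof -
    have "(\<integral>\<omega>. coarse_cond m t \<omega> \<partial>N) = (\<integral>\<omega>. (\<Sum>B\<in>void_sets r m. (void_coeff r m B * exp (- (fast_int t * measure lborel B))) * of_bool (slow_nodes Xbd t \<omega> \<inter> B = {})) \<partial>N)"
      by (simp add: coarse_cond_def mult_ac)
    also have "\<dots> = (\<Sum>B\<in>void_sets r m. (void_coeff r m B * exp (- (fast_int t * measure lborel B))) * N.prob {\<omega>\<in>space N. slow_nodes Xbd t \<omega> \<inter> B = {}})"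
      by (rule N.expectation_void_sum) (auto intro: slow_void_set void_sets_borel void_sets_bounded t)
    also have "\<dots> = coarse_level r m"
      unfolding coarse_level_def
      by (intro sum.cong refl) (simp add: prob_slow_void_single[OF t gen void_sets_borel void_sets_bounded, symmetric])
    finally show ?thesis .
  qed
  then show "(\<integral>\<omega>. coarse_cond m t \<omega> \<partial>N) = coarse_level r m" .
  show "(\<integral>\<omega>. slow_cond t \<omega> \<partial>N) = perc_level r"
    using coarse_union_tendsto[OF t] perc_level_tendsto[OF r_pos] unfolding c by (rule LIMSEQ_unique)
qed

text \<open>Both sides are expanded over the same choices of void sets, and
  \<open>void_limit\<close> applies to each of the finitely many terms.\<close>

lemma coarse_product_limit:
  assumes I: "finite I" and t: "\<And>k. k \<in> I \<Longrightarrow> t k \<in> {0..1}"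
    and gen: "AE \<omega> in M. generic_times I t (row 0 \<omega>)"
  shows "((\<lambda>T. \<integral>\<omega>. (\<Prod>k\<in>I. coarse_perc r m (nodes X V T (t k * T) \<omega>)) \<partial>M) \<longlongrightarrow>
     (\<integral>\<omega>. (\<Prod>k\<in>I. coarse_cond m (t k) \<omega>) \<partial>N)) at_top"
proof -
  let ?S = "PiE I (\<lambda>_. void_sets r m :: 'a set set)"
  have finS: "finite ?S" using I by (intro finite_PiE) auto
  have gB: "g k \<in> void_sets r m" if "g \<in> ?S" "k \<in> I" for g k using that by auto
  let ?c = "\<lambda>g. \<Prod>k\<in>I. void_coeff r m (g k)"
  let ?e = "\<lambda>g. \<Prod>k\<in>I. exp (- (fast_int (t k) * measure lborel (g k)))"
  have 1: "(\<integral>\<omega>. (\<Prod>k\<in>I. coarse_perc r m (nodes X V T (t k * T) \<omega>)) \<partial>M) =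
      (\<Sum>g\<in>?S. ?c g * prob {\<omega>\<in>space M. \<forall>k\<in>I. nodes X V T (t k * T) \<omega> \<inter> g k = {}})" for T
  proof -
    have "(\<integral>\<omega>. (\<Prod>k\<in>I. coarse_perc r m (nodes X V T (t k * T) \<omega>)) \<partial>M) =
        (\<integral>\<omega>. (\<Sum>g\<in>?S. ?c g * of_bool (\<forall>k\<in>I. nodes X V T (t k * T) \<omega> \<inter> g k = {})) \<partial>M)"
      unfolding coarse_perc_expand
      using prod_sum_void[OF I, of "void_sets r m" "void_coeff r m" "\<lambda>k B. nodes X V T (t k * T) \<omega> \<inter> B = {}" "\<lambda>_ _. 1" for \<omega>]
      by simp
    also have "\<dots> = (\<Sum>g\<in>?S. ?c g * prob {\<omega>\<in>space M. \<forall>k\<in>I. nodes X V T (t k * T) \<omega> \<inter> g k = {}})"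
    proof (rule expectation_void_sum[OF finS])
      fix g assume g: "g \<in> ?S"
      have "Measurable.pred M (\<lambda>\<omega>. \<forall>k\<in>I. nodes X V T (t k * T) \<omega> \<inter> g k = {})"
        by (intro pred_intros_finite I nodes_void_measurable void_sets_borel[OF gB[OF g]])
      then show "{\<omega>\<in>space M. \<forall>k\<in>I. nodes X V T (t k * T) \<omega> \<inter> g k = {}} \<in> events" by (simp add: pred_def)
    qed
    finally show ?thesis .
  qed
  have 2: "(\<integral>\<omega>. (\<Prod>k\<in>I. coarse_cond m (t k) \<omega>) \<partial>N) =
      (\<Sum>g\<in>?S. ?c g * (N.prob {\<omega>\<in>space N. \<forall>k\<in>I. slow_nodes Xbd (t k) \<omega> \<inter> g k = {}} * ?e g))"
  proof -
    have "(\<integral>\<omega>. (\<Prod>k\<in>I. coarse_cond m (t k) \<omega>) \<partial>N) =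
        (\<integral>\<omega>. (\<Sum>g\<in>?S. (\<Prod>k\<in>I. void_coeff r m (g k) * exp (- (fast_int (t k) * measure lborel (g k)))) *
          of_bool (\<forall>k\<in>I. slow_nodes Xbd (t k) \<omega> \<inter> g k = {})) \<partial>N)"
      unfolding coarse_cond_def
      by (subst prod_sum_void[OF I]) auto
    also have "\<dots> = (\<Sum>g\<in>?S. (\<Prod>k\<in>I. void_coeff r m (g k) * exp (- (fast_int (t k) * measure lborel (g k)))) *
         N.prob {\<omega>\<in>space N. \<forall>k\<in>I. slow_nodes Xbd (t k) \<omega> \<inter> g k = {}})"
    proof (rule N.expectation_void_sum[OF finS])
      fix g assume g: "g \<in> ?S"
      show "{\<omega>\<in>space N. \<forall>k\<in>I. slow_nodes Xbd (t k) \<omega> \<inter> g k = {}} \<in> N.events"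
        by (rule slow_void(1)[OF I void_sets_borel[OF gB[OF g]] void_sets_bounded[OF gB[OF g]] t])
    qed
    finally show ?thesis by (simp add: prod.distrib mult_ac)
  qed
  show ?thesis
    unfolding 1 2
  proof (intro tendsto_sum tendsto_mult_left)
    fix g assume g: "g \<in> ?S"
    show "((\<lambda>T. prob {\<omega>\<in>space M. \<forall>k\<in>I. nodes X V T (t k * T) \<omega> \<inter> g k = {}}) \<longlongrightarrow>
      N.prob {\<omega>\<in>space N. \<forall>k\<in>I. slow_nodes Xbd (t k) \<omega> \<inter> g k = {}} * ?e g) at_top"
      by (rule void_limit[OF I void_sets_borel[OF gB[OF g]] void_sets_bounded[OF gB[OF g]] t gen])
  qed
qed

text \<open>Replacing percolation by its coarse version costs at most
  \<open>card I * \<delta> m\<close>, for the nodes uniformly in \<open>T\<close> and equally for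
  the limit. So \<open>m\<close> can be fixed before \<open>T\<close> tends to infinity.\<close>

lemma product_limit:
  assumes I: "finite I" and t: "\<And>k. k \<in> I \<Longrightarrow> t k \<in> {0..1}"
    and gen: "AE \<omega> in M. generic_times I t (row 0 \<omega>)"
  shows "((\<lambda>T. \<integral>\<omega>. (\<Prod>k\<in>I. perc r (nodes X V T (t k * T) \<omega>)) \<partial>M) \<longlongrightarrow>
     (\<integral>\<omega>. (\<Prod>k\<in>I. slow_cond (t k) \<omega>) \<partial>N)) at_top"
proof (rule tendstoI)
  fix e :: real assume e: "e > 0"
  \<comment> \<open>The mean error at one time, common to all generic times, to all
    \<open>T > 0\<close> and to the limit, since the one-time laws agree.\<close>
  define \<delta> where "\<delta> m = coarse_level r m - perc_level r" for m
  have gk: "AE \<omega> in M. generic_times {k} (\<lambda>_. t k) (row 0 \<omega>)" if "k \<in> I" for k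
    using gen by eventually_elim (use that in \<open>auto simp: generic_times_def\<close>)
  have dM: "\<bar>(\<integral>\<omega>. (\<Prod>k\<in>I. perc r (nodes X V T (t k * T) \<omega>)) \<partial>M) - (\<integral>\<omega>. (\<Prod>k\<in>I. coarse_perc r m (nodes X V T (t k * T) \<omega>)) \<partial>M)\<bar> \<le> card I * \<delta> m"
    if T: "T > 0" for T m
  proof -
    have "\<bar>(\<integral>\<omega>. (\<Prod>k\<in>I. perc r (nodes X V T (t k * T) \<omega>)) \<partial>M) - (\<integral>\<omega>. (\<Prod>k\<in>I. coarse_perc r m (nodes X V T (t k * T) \<omega>)) \<partial>M)\<bar> \<le>
       (\<Sum>k\<in>I. (\<integral>\<omega>. coarse_perc r m (nodes X V T (t k * T) \<omega>) \<partial>M) - (\<integral>\<omega>. perc r (nodes X V T (t k * T) \<omega>) \<partial>M))"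
    proof (rule expectation_prod_diff[OF I])
      fix k
      have b: "0 \<le> perc r (nodes X V T (t k * T) \<omega>)" "perc r (nodes X V T (t k * T) \<omega>) \<le> coarse_perc r m (nodes X V T (t k * T) \<omega>)"
        "coarse_perc r m (nodes X V T (t k * T) \<omega>) \<le> 1" for \<omega>
        using perc_range[of r "nodes X V T (t k * T) \<omega>"] perc_le_coarse_perc[OF r_pos, of "nodes X V T (t k * T) \<omega>" m]
          coarse_perc_range[of r m "nodes X V T (t k * T) \<omega>"] by auto
      show "integrable M (\<lambda>\<omega>. perc r (nodes X V T (t k * T) \<omega>))"
      proof (rule integrable_const_bound[of _ 1])
        show "AE \<omega> in M. norm (perc r (nodes X V T (t k * T) \<omega>)) \<le> 1" by (simp add: perc_def)
      qed (rule nodes_perc_measurable; simp)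
      show "integrable M (\<lambda>\<omega>. coarse_perc r m (nodes X V T (t k * T) \<omega>))"
      proof (rule integrable_const_bound[of _ 1])
        show "AE \<omega> in M. norm (coarse_perc r m (nodes X V T (t k * T) \<omega>)) \<le> 1"
          using b order_trans[OF b(1,2)] by (intro AE_I2) simp
      qed (rule nodes_coarse_measurable)
      show "AE \<omega> in M. 0 \<le> perc r (nodes X V T (t k * T) \<omega>) \<and> perc r (nodes X V T (t k * T) \<omega>) \<le> coarse_perc r m (nodes X V T (t k * T) \<omega>) \<and>
          coarse_perc r m (nodes X V T (t k * T) \<omega>) \<le> 1"
        using b by (intro AE_I2) blast
    qed
    also have "\<dots> = (\<Sum>k\<in>I. \<delta> m)"
      by (intro sum.cong refl) (simp add: expectation_coarse_nodes[OF T t] expectation_perc_nodes[OF r_pos T t] \<delta>_def)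
    finally show ?thesis by simp
  qed
  have dN: "\<bar>(\<integral>\<omega>. (\<Prod>k\<in>I. slow_cond (t k) \<omega>) \<partial>N) - (\<integral>\<omega>. (\<Prod>k\<in>I. coarse_cond m (t k) \<omega>) \<partial>N)\<bar> \<le> card I * \<delta> m" for m
  proof -
    have "\<bar>(\<integral>\<omega>. (\<Prod>k\<in>I. slow_cond (t k) \<omega>) \<partial>N) - (\<integral>\<omega>. (\<Prod>k\<in>I. coarse_cond m (t k) \<omega>) \<partial>N)\<bar> \<le>
        (\<Sum>k\<in>I. (\<integral>\<omega>. coarse_cond m (t k) \<omega> \<partial>N) - (\<integral>\<omega>. slow_cond (t k) \<omega> \<partial>N))"
    proof (rule N.expectation_prod_diff[OF I])
      fix k assume k: "k \<in> I"
      note F = slow_cond_facts[OF t[OF k]]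
      show "integrable N (slow_cond (t k))" "integrable N (coarse_cond m (t k))" by (rule F)+
      show "AE \<omega> in N. 0 \<le> slow_cond (t k) \<omega> \<and> slow_cond (t k) \<omega> \<le> coarse_cond m (t k) \<omega> \<and> coarse_cond m (t k) \<omega> \<le> 1"
        using F(3) F(6)[of m] by eventually_elim simp
    qed
    also have "\<dots> = (\<Sum>k\<in>I. \<delta> m)"
      by (intro sum.cong refl) (simp add: expectation_coarse_cond[OF t gk] \<delta>_def)
    finally show ?thesis by simp
  qed
  have "\<delta> \<longlonglongrightarrow> 0"
    unfolding \<delta>_def using tendsto_diff[OF perc_level_tendsto[OF r_pos] tendsto_const[of "perc_level r"]] by simp
  then have "(\<lambda>m. card I * \<delta> m) \<longlonglongrightarrow> real (card I) * 0" by (intro tendsto_intros)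
  then have "\<forall>\<^sub>F m in sequentially. card I * \<delta> m < e / 3" by (rule order_tendstoD) (use e in simp)
  then obtain m where m: "card I * \<delta> m < e / 3" by (auto simp: eventually_sequentially)
  have "\<forall>\<^sub>F T in at_top. dist (\<integral>\<omega>. (\<Prod>k\<in>I. coarse_perc r m (nodes X V T (t k * T) \<omega>)) \<partial>M) (\<integral>\<omega>. (\<Prod>k\<in>I. coarse_cond m (t k) \<omega>) \<partial>N) < e / 3"
    by (rule tendstoD[OF coarse_product_limit[OF I t gen]]) (use e in auto)
  then show "\<forall>\<^sub>F T in at_top. dist (\<integral>\<omega>. (\<Prod>k\<in>I. perc r (nodes X V T (t k * T) \<omega>)) \<partial>M) (\<integral>\<omega>. (\<Prod>k\<in>I. slow_cond (t k) \<omega>) \<partial>N) < e"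
    using eventually_gt_at_top[of 0]
  proof eventually_elim
    case (elim T)
    show ?case using elim(1) dM[OF elim(2), of m] dN[of m] m unfolding dist_real_def by linarith
  qed
qed

end

section \<open>Mixed moments as integrals over tuples of times\<close>

lemma indicator_prod_measurable:
  "(\<lambda>t. \<Prod>k\<in>I. indicator {..x k} (t k) :: real) \<in> borel_measurable (PiM I (\<lambda>_. unit_lborel))"
proof (rule borel_measurable_prod)
  fix k assume "k \<in> I"
  then have "(\<lambda>t. t k) \<in> measurable (PiM I (\<lambda>_. unit_lborel)) unit_lborel" by (rule measurable_component_singleton)
  from measurable_compose[OF this indicator_measurable_unit]
  show "(\<lambda>t. indicator {..x k} (t k) :: real) \<in> borel_measurable (PiM I (\<lambda>_. unit_lborel))" .
qed

context unit_density begin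

text \<open>A product of integrals over the unit interval is one integral over a cube, and Fubini
  moves the expectation inside. Coordinates are list positions, so repeated arguments get separate
  times.\<close>

lemma cdf_moment:
  fixes xs :: "real list"
  defines "I \<equiv> {..<length xs}"
  shows "(\<integral>\<omega>. prod_list (map (cdf_of (\<lambda>t. h t \<omega>)) xs) \<partial>M) =
    (\<integral>t. (\<Prod>k\<in>I. indicator {..xs ! k} (t k)) * (\<integral>\<omega>. (\<Prod>k\<in>I. h (t k) \<omega>) \<partial>M) \<partial>PiM I (\<lambda>_. unit_lborel))"
    and "(\<lambda>t. \<integral>\<omega>. (\<Prod>k\<in>I. h (t k) \<omega>) \<partial>M) \<in> borel_measurable (PiM I (\<lambda>_. unit_lborel))"
    and "t \<in> space (PiM I (\<lambda>_. unit_lborel)) \<Longrightarrow> \<bar>\<integral>\<omega>. (\<Prod>k\<in>I. h (t k) \<omega>) \<partial>M\<bar> \<le> 1"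
proof -
  interpret U: prob_space unit_lborel by (rule prob_space_unit_lborel)
  interpret PS: product_prob_space "\<lambda>_. unit_lborel" I ..
  let ?P = "PiM I (\<lambda>_. unit_lborel)"
  interpret P: prob_space ?P by (rule prob_space_PiM) (rule prob_space_unit_lborel)
  interpret Q: pair_prob_space ?P M ..
  have I: "finite I" by (simp add: I_def)
  let ?ind = "\<lambda>t. \<Prod>k\<in>I. indicator {..xs ! k} (t k) :: real"
  have tk: "t k \<in> {0..1}" if "t \<in> space ?P" "k \<in> I" for t k
    using that by (auto simp: space_PiM)
  have hk: "(\<lambda>p. h (fst p k) (snd p)) \<in> borel_measurable (?P \<Otimes>\<^sub>M M)" if "k \<in> I" for k
  proof -
    have "(\<lambda>p. (fst p k, snd p)) \<in> measurable (?P \<Otimes>\<^sub>M M) (unit_lborel \<Otimes>\<^sub>M M)"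
      using that by (intro measurable_Pair measurable_snd measurable_compose[OF measurable_fst measurable_component_singleton])
    from measurable_compose[OF this h_meas_unit] show ?thesis by simp
  qed
  have pm: "(\<lambda>p. \<Prod>k\<in>I. h (fst p k) (snd p)) \<in> borel_measurable (?P \<Otimes>\<^sub>M M)"
    by (intro borel_measurable_prod hk)
  then show m2: "(\<lambda>t. \<integral>\<omega>. (\<Prod>k\<in>I. h (t k) \<omega>) \<partial>M) \<in> borel_measurable ?P"
    by (intro borel_measurable_lebesgue_integral) (simp add: split_beta')
  have im: "?ind \<in> borel_measurable ?P"
    by (rule indicator_prod_measurable)
  have hb: "0 \<le> (\<Prod>k\<in>I. h (t k) \<omega>)" "(\<Prod>k\<in>I. h (t k) \<omega>) \<le> 1" if "t \<in> space ?P" "\<omega> \<in> space M" for t \<omega>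
    using h_range[OF tk[OF that(1)] that(2)] by (auto intro!: prod_nonneg prod_le_1)
  have ib: "0 \<le> ?ind t" "?ind t \<le> 1" for t by (auto intro!: prod_nonneg prod_le_1 simp: indicator_def)
  show "\<bar>\<integral>\<omega>. (\<Prod>k\<in>I. h (t k) \<omega>) \<partial>M\<bar> \<le> 1" if t: "t \<in> space ?P" for t
  proof -
    have "(\<lambda>\<omega>. \<Prod>k\<in>I. h (t k) \<omega>) \<in> borel_measurable M"
      using measurable_compose[OF measurable_Pair1'[OF t] pm] by simp
    then have i: "integrable M (\<lambda>\<omega>. \<Prod>k\<in>I. h (t k) \<omega>)"
      by (intro integrable_const_bound[of _ 1]) (use hb[OF t] in \<open>auto intro!: AE_I2\<close>)
    have "0 \<le> (\<integral>\<omega>. (\<Prod>k\<in>I. h (t k) \<omega>) \<partial>M)" by (rule Bochner_Integration.integral_nonneg) (rule hb[OF t])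
    moreover have "(\<integral>\<omega>. (\<Prod>k\<in>I. h (t k) \<omega>) \<partial>M) \<le> (\<integral>\<omega>. 1 \<partial>M)" by (rule integral_mono[OF i]) (use hb[OF t] in auto)
    ultimately show ?thesis by (simp add: prob_space)
  qed
  have "(\<integral>\<omega>. prod_list (map (cdf_of (\<lambda>t. h t \<omega>)) xs) \<partial>M) =
      (\<integral>\<omega>. (\<integral>t. ?ind t * (\<Prod>k\<in>I. h (t k) \<omega>) \<partial>?P) \<partial>M)"
  proof (intro Bochner_Integration.integral_cong refl)
    fix \<omega> assume \<omega>: "\<omega> \<in> space M"
    have int: "integrable unit_lborel (\<lambda>t. indicator {..x} t * h t \<omega>)" for x
      by (rule cdf_of_integrable[OF h_meas_section[OF \<omega>] h_range[OF _ \<omega>]])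
    have "prod_list (map (cdf_of (\<lambda>t. h t \<omega>)) xs) = (\<Prod>k\<in>I. cdf_of (\<lambda>t. h t \<omega>) (xs ! k))"
      by (simp add: prod.list_conv_set_nth I_def atLeast0LessThan)
    also have "\<dots> = (\<integral>t. (\<Prod>k\<in>I. indicator {..xs ! k} (t k) * h (t k) \<omega>) \<partial>?P)"
      unfolding cdf_of_def by (rule PS.product_integral_prod[OF I int, symmetric])
    finally show "prod_list (map (cdf_of (\<lambda>t. h t \<omega>)) xs) = (\<integral>t. ?ind t * (\<Prod>k\<in>I. h (t k) \<omega>) \<partial>?P)"
      by (simp add: prod.distrib)
  qed
  also have "\<dots> = (\<integral>t. (\<integral>\<omega>. ?ind t * (\<Prod>k\<in>I. h (t k) \<omega>) \<partial>M) \<partial>?P)"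
  proof (rule Q.Fubini_integral)
    show "integrable (?P \<Otimes>\<^sub>M M) (\<lambda>(t, \<omega>). ?ind t * (\<Prod>k\<in>I. h (t k) \<omega>))"
    proof (rule Q.integrable_const_bound[of _ 1])
      show "AE p in ?P \<Otimes>\<^sub>M M. norm (case p of (t, \<omega>) \<Rightarrow> ?ind t * (\<Prod>k\<in>I. h (t k) \<omega>)) \<le> 1"
        using hb ib by (intro AE_I2) (auto simp: space_pair_measure abs_mult intro!: mult_le_one)
      have "(\<lambda>p. ?ind (fst p)) \<in> borel_measurable (?P \<Otimes>\<^sub>M M)" by (rule measurable_compose[OF measurable_fst im])
      then show "(\<lambda>(t, \<omega>). ?ind t * (\<Prod>k\<in>I. h (t k) \<omega>)) \<in> borel_measurable (?P \<Otimes>\<^sub>M M)"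
        using pm by (simp add: split_beta')
    qed
  qed
  finally show "(\<integral>\<omega>. prod_list (map (cdf_of (\<lambda>t. h t \<omega>)) xs) \<partial>M) =
      (\<integral>t. ?ind t * (\<integral>\<omega>. (\<Prod>k\<in>I. h (t k) \<omega>) \<partial>M) \<partial>?P)" by simp
qed

end

context mobility_limit begin

lemma unit_density_nodes: "unit_density M (\<lambda>t \<omega>. perc r (nodes X V T (t * T) \<omega>))"
proof unfold_locales
  have 1: "(\<lambda>p. fst p * T) \<in> borel_measurable (restrict_space borel {0..1} \<Otimes>\<^sub>M M)"
    by (intro borel_measurable_times borel_measurable_const measurable_compose[OF measurable_fst] measurable_restrict_space1) simp
  show "(\<lambda>(t, \<omega>). perc r (nodes X V T (t * T) \<omega>)) \<in> borel_measurable (restrict_space borel {0..1} \<Otimes>\<^sub>M M)"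
    using nodes_perc_measurable[OF 1 measurable_snd] by (simp add: split_beta')
qed (simp add: perc_def)

text \<open>The inner expectations converge for almost every tuple of times by
  \<open>product_limit\<close> and are bounded by 1, so dominated convergence over the cube
  applies.\<close>

lemma moment_limit:
  assumes \<Theta>: "conditional_perc_version r N (slow_nodes Xbd) X' \<Theta>"
  shows "((\<lambda>T. \<integral>\<omega>. prod_list (map (cdf_of (\<lambda>t. perc r (nodes X V T (t * T) \<omega>))) xs) \<partial>M) \<longlongrightarrow>
     (\<integral>\<omega>. prod_list (map (cdf_of (\<lambda>t. \<Theta> t \<omega>)) xs) \<partial>N)) at_top"
proof -
  interpret U: prob_space unit_lborel by (rule prob_space_unit_lborel)
  interpret h: unit_density M "\<lambda>t \<omega>. perc r (nodes X V T (t * T) \<omega>)" for T by (rule unit_density_nodes)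
  interpret k: unit_density N \<Theta>
    by unfold_locales (use \<Theta> in \<open>auto simp: conditional_perc_version_def\<close>)
  define I where "I = {..<length xs}"
  have I: "finite I" by (simp add: I_def)
  let ?P = "PiM I (\<lambda>_. unit_lborel)"
  interpret P: prob_space ?P by (rule prob_space_PiM) (rule prob_space_unit_lborel)
  let ?ind = "\<lambda>t. \<Prod>k\<in>I. indicator {..xs ! k} (t k) :: real"
  have im: "?ind \<in> borel_measurable ?P"
    by (rule indicator_prod_measurable)
  have ib: "\<bar>?ind t\<bar> \<le> 1" for t by (auto simp: abs_prod indicator_def intro!: prod_le_1)
  note hm = h.cdf_moment[where xs=xs, folded I_def] and km = k.cdf_moment[where xs=xs, folded I_def]
  have bound: "norm (?ind t * (\<integral>\<omega>. (\<Prod>k\<in>I. perc r (nodes X V T (t k * T) \<omega>)) \<partial>M)) \<le> 1" if "t \<in> space ?P" for T t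
    using hm(3)[OF that, of T] ib[of t] by (simp add: abs_mult mult_le_one)
  have lim: "AE t in ?P. ((\<lambda>T. ?ind t * (\<integral>\<omega>. (\<Prod>k\<in>I. perc r (nodes X V T (t k * T) \<omega>)) \<partial>M)) \<longlongrightarrow>
        ?ind t * (\<integral>\<omega>. (\<Prod>k\<in>I. \<Theta> (t k) \<omega>) \<partial>N)) at_top"
    using AE_generic_times[OF I] AE_space
  proof eventually_elim
    case (elim t)
    have t: "t k \<in> {0..1}" if "k \<in> I" for k
      using elim(2) that unfolding space_PiM space_unit_lborel by (rule PiE_mem)
    \<comment> \<open>A version agrees with the conditional expectation almost surely at each fixed
      time, with an exceptional set depending on the time. This suffices, because only finitely many
      times occur at once.\<close>
    have v: "AE \<omega> in N. \<Theta> (t k) \<omega> = slow_cond (t k) \<omega>" if "k \<in> I" for k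
      using \<Theta> t[OF that] unfolding conditional_perc_version_def perc_union_def by blast
    have "AE \<omega> in N. \<forall>k\<in>I. \<Theta> (t k) \<omega> = slow_cond (t k) \<omega>"
      using v I by (intro AE_ball_countable[THEN iffD2] countable_finite) auto
    then have ae: "AE \<omega> in N. (\<Prod>k\<in>I. \<Theta> (t k) \<omega>) = (\<Prod>k\<in>I. slow_cond (t k) \<omega>)"
      by eventually_elim (rule prod.cong, auto)
    have \<Theta>m: "\<Theta> s \<in> borel_measurable N" if "s \<in> {0..1}" for s
      using measurable_compose[OF measurable_Pair1'[of s] k.h_meas_unit] that by simp
    have "(\<integral>\<omega>. (\<Prod>k\<in>I. \<Theta> (t k) \<omega>) \<partial>N) = (\<integral>\<omega>. (\<Prod>k\<in>I. slow_cond (t k) \<omega>) \<partial>N)"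
    proof (rule integral_cong_AE[OF _ _ ae])
      show "(\<lambda>\<omega>. \<Prod>k\<in>I. \<Theta> (t k) \<omega>) \<in> borel_measurable N" by (intro borel_measurable_prod \<Theta>m t)
      show "(\<lambda>\<omega>. \<Prod>k\<in>I. slow_cond (t k) \<omega>) \<in> borel_measurable N"
        by (intro borel_measurable_prod borel_measurable_integrable slow_cond_facts(1) t)
    qed
    then show ?case using product_limit[OF I t elim(1)] by (intro tendsto_mult_left) simp
  qed
  have "((\<lambda>T. \<integral>t. ?ind t * (\<integral>\<omega>. (\<Prod>k\<in>I. perc r (nodes X V T (t k * T) \<omega>)) \<partial>M) \<partial>?P) \<longlongrightarrow>
      (\<integral>t. ?ind t * (\<integral>\<omega>. (\<Prod>k\<in>I. \<Theta> (t k) \<omega>) \<partial>N) \<partial>?P)) at_top"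
  proof (rule integral_dominated_convergence_at_top[where w="\<lambda>_. 1", OF _ _ _ lim])
    show "\<forall>\<^sub>F T in at_top. AE t in ?P. norm (?ind t * (\<integral>\<omega>. (\<Prod>k\<in>I. perc r (nodes X V T (t k * T) \<omega>)) \<partial>M)) \<le> 1"
      using bound by (auto intro!: always_eventually AE_I2)
    show "(\<lambda>t. ?ind t * (\<integral>\<omega>. (\<Prod>k\<in>I. \<Theta> (t k) \<omega>) \<partial>N)) \<in> borel_measurable ?P"
      by (rule borel_measurable_times[OF im km(2)])
    show "(\<lambda>t. ?ind t * (\<integral>\<omega>. (\<Prod>k\<in>I. perc r (nodes X V T (t k * T) \<omega>)) \<partial>M)) \<in> borel_measurable ?P" for T
      by (rule borel_measurable_times[OF im hm(2)])
  qed simp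
  then show ?thesis unfolding hm(1) km(1) .
qed

end

text \<open>The existence of a version keeps the statement about all versions from being vacuous.
  The witness is \<open>cond_perc\<close>, and the moment argument applies to every version
  alike.\<close>

theorem theorem1:
  fixes r lam :: real
    and \<kappa> :: "'a::euclidean_space measure"
    and M :: "'w measure" and X :: "nat \<Rightarrow> 'w \<Rightarrow> 'a" and V :: "nat \<Rightarrow> nat \<Rightarrow> 'w \<Rightarrow> 'a"
    and L :: "'u measure" and Y :: "real \<Rightarrow> 'u \<Rightarrow> 'a set"
    and N :: "'v measure" and Xbd :: "'v \<Rightarrow> ('a \<times> real \<times> 'a) set" and X' :: "real \<Rightarrow> 'v \<Rightarrow> 'a set"
  assumes dim: "DIM('a) \<ge> 2"
    and r_pos: "r > 0"
    and lam_pos: "lam > 0"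
    \<comment> \<open>the law of the increments\<close>
    and kappa_prob: "prob_space \<kappa>"
    and kappa_sets: "sets \<kappa> = sets borel"
    and kappa_isotropic: "isotropic \<kappa>"
    and kappa_bounded: "bounded (measure_support \<kappa>)"
    and kappa_ac: "absolutely_continuous lborel \<kappa>"
    \<comment> \<open>the mobility model\<close>
    and M_prob: "prob_space M"
    and X_measurable: "\<And>i. i \<ge> 1 \<Longrightarrow> X i \<in> borel_measurable M"
    and X_distinct: "\<And>\<omega>. \<omega> \<in> space M \<Longrightarrow> inj_on (\<lambda>i. X i \<omega>) {1..}"
    and X_poisson: "homogeneous_poisson M lam (\<lambda>\<omega>. (\<lambda>i. X i \<omega>) ` {1..})"
    and V_indep: "prob_space.indep_vars M (\<lambda>_. borel) (\<lambda>(i, j). V i j) UNIV"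
    and V_law: "\<And>i j. distr M borel (V i j) = \<kappa>"
    and X_V_indep: "prob_space.indep_set M
          (sets (vimage_algebra (space M) (\<lambda>\<omega>. \<lambda>i\<in>{1..}. X i \<omega>) (\<Pi>\<^sub>M i\<in>{1..}. borel)))
          (sets (vimage_algebra (space M) (\<lambda>\<omega> (i, j). V i j \<omega>) (\<Pi>\<^sub>M p\<in>UNIV. borel)))"
    \<comment> \<open>Poisson point processes of all intensities, defining the critical intensity\<close>
    and Y_poisson: "\<And>lam'. lam' \<ge> 0 \<Longrightarrow> homogeneous_poisson L lam' (Y lam')"
    \<comment> \<open>the limit objects\<close>
    and N_prob: "prob_space N"
    and Xbd_poisson: "poisson_point_process N
          (birth_death_intensity lam (slow_start_measure M (V 0)) \<kappa>) Xbd"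
    and X'_poisson: "\<And>t. t \<in> {0..1} \<Longrightarrow> homogeneous_poisson N (fast_intensity lam M (V 0) t) (X' t)"
    and X'_indep: "\<And>t. t \<in> {0..1} \<Longrightarrow> prob_space.indep_set N
          (sets (generated_algebra N (slow_nodes Xbd t))) (sets (generated_algebra N (X' t)))"
    and supercritical: "ereal lam > critical_intensity r L Y"
  shows "(\<exists>\<Theta>. conditional_perc_version r N (slow_nodes Xbd) X' \<Theta>) \<and>
         (\<forall>\<Theta>. conditional_perc_version r N (slow_nodes Xbd) X' \<Theta> \<longrightarrow>
            converges_in_distribution (weak_measure_topology {0..1})
              M (\<lambda>T \<omega>. percolation_time r X V T \<omega>) at_top
              N (\<lambda>\<omega>. density (restrict_space lborel {0..1}) (\<lambda>t. ennreal (\<Theta> t \<omega>))))"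
proof -
  interpret M: prob_space M by (rule M_prob)
  \<comment> \<open>Absolute continuity enters through the absence of atoms, which yields positive
    leg durations and distinct fast sums.\<close>
  have atomless: "emeasure \<kappa> {x} = 0" for x
  proof -
    have "{x} \<in> null_sets lborel" by (auto simp: null_sets_def)
    then show ?thesis using kappa_ac unfolding absolutely_continuous_def by blast
  qed
  interpret mobility_limit M lam \<kappa> X V N r Xbd X'
    by (intro mobility_limit.intro mobility.intro mobility_axioms.intro mobility_limit_axioms.intro)
      (fact M_prob lam_pos X_measurable X_distinct X_poisson V_indep V_law X_V_indep atomless
        r_pos kappa_bounded N_prob Xbd_poisson X'_poisson X'_indep)+
  show ?thesis
  proof (intro conjI exI allI impI)
    show "conditional_perc_version r N (slow_nodes Xbd) X' cond_perc"
      by (rule conditional_perc_version_exists)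
    fix \<Theta> assume \<Theta>: "conditional_perc_version r N (slow_nodes Xbd) X' \<Theta>"
    have "unit_density N \<Theta>"
      by unfold_locales (use \<Theta> in \<open>auto simp: conditional_perc_version_def\<close>)
    from converges_in_distribution_densities[of M "\<lambda>T t \<omega>. perc r (nodes X V T (t * T) \<omega>)", OF unit_density_nodes this moment_limit[OF \<Theta>]]
    show "converges_in_distribution (weak_measure_topology {0..1})
              M (\<lambda>T \<omega>. percolation_time r X V T \<omega>) at_top
              N (\<lambda>\<omega>. density (restrict_space lborel {0..1}) (\<lambda>t. ennreal (\<Theta> t \<omega>)))"
      unfolding percolation_time_def .
  qed
qed

end
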